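(* Suppose that the initialization $\rho_0\in\mathcal{P}(\mathbb{R}^d)$ satisfies $\mathrm{supp}(\rho_0)=\mathbb{R}^d$. Consider the Wasserstein-Fisher-Rao gradient descent $\{\rho_n\}_{n\ge0}$ with step size $\eta$ started from $\rho_0$ (as defined in the context). There exists $\eta_0>0$ determined by the samples $\{X_i\}_{1\le i\le N}$, such that if $0<\eta\le\eta_0$ and $\rho_n$ converges weakly to $\widehat\rho$ as $n\to\infty$, then $\widehat\rho$ is the NPMLE.
   Context: $X_1,\dots,X_N\in\mathbb{R}^d$ are i.i.d. samples from an isotropic Gaussian mixture $\rho^\star*\mathcal{N}(0,I_d)$, where $\rho^\star$ is a mixing distribution over $\mathbb{R}^d$. $\mathcal{P}(\mathbb{R}^d)$ is the set of probability measures on $\mathbb{R}^d$; $\mathrm{supp}(\rho)$ is the smallest closed set $C$ with $\rho(C)=1$; weak convergence means convergence of integrals of all bounded continuous functions. Let $\phi(x)=(2\pi)^{-d/2}\exp(-\|x\|_2^2/2)$, $(\rho*\phi)(x)=\int_{\mathbb{R}^d}\phi(x-y)\,\rho(\mathrm{d}y)$, and let $\ell_N(\rho)=-\frac1N\sum_{i=1}^N\log[(\rho*\phi)(X_i)]$ be the negative log-likelihood. The NPMLE (nonparametric maximum likelihood estimator) is a minimizer of $\ell_N$ over $\mathcal{P}(\mathbb{R}^d)$; if the minimizer is not unique, "the NPMLE" refers to any minimizer. The first variation of $\ell_N$ at $\rho$ is $\delta\ell_N(\rho)(x)=-\frac1N\sum_{i=1}^N\frac{\phi(x-X_i)}{(\rho*\phi)(X_i)}$.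 $T_\#\rho$ denotes the pushforward of $\rho$ by a map $T:\mathbb{R}^d\to\mathbb{R}^d$, and $\mathrm{id}$ is the identity map. Wasserstein-Fisher-Rao gradient descent with step size $\eta>0$: for $n=0,1,\dots$, given $\rho_n$, define $\widetilde\rho_n$ by $\frac{\mathrm{d}\widetilde\rho_n}{\mathrm{d}\rho_n}=1-\eta[1+\delta\ell_N(\rho_n)]$ (Fisher-Rao gradient update), and then $\rho_{n+1}=[\mathrm{id}-\eta\nabla\delta\ell_N(\widetilde\rho_n)]_\#\widetilde\rho_n$ (Wasserstein gradient update). *)

theory Defs
  imports "HOL-Probability.Probability"
begin

text \<open>\<open>space (prob_algebra borel)\<close> is the set of Borel probability measures.\<close>

abbreviation prob_measures :: "'a::topological_space measure set" where
  "prob_measures \<equiv> space (prob_algebra borel)"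

definition supp :: "'a::topological_space measure \<Rightarrow> 'a set" where
  "supp \<rho> = \<Inter>{C. closed C \<and> measure \<rho> C = 1}"

text \<open>The library's \<open>weak_conv_m\<close> covers measures on the real line only.\<close>

definition weakly_converges ::
    "(nat \<Rightarrow> 'a::topological_space measure) \<Rightarrow> 'a measure \<Rightarrow> bool" where
  "weakly_converges \<rho> \<rho>' \<longleftrightarrow>
     (\<forall>f :: 'a \<Rightarrow> real. continuous_on UNIV f \<longrightarrow> bounded (range f) \<longrightarrow>
        (\<lambda>n. \<integral>x. f x \<partial>\<rho> n) \<longlonglongrightarrow> (\<integral>x. f x \<partial>\<rho>'))"

definition gauss :: "real ^ 'd \<Rightarrow> real" where
  "gauss x = (2 * pi) powr (- real CARD('d) / 2) * exp (- (norm x)\<^sup>2 / 2)"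

definition std_gaussian :: "(real ^ 'd) measure" where
  "std_gaussian = density lborel (\<lambda>x. ennreal (gauss x))"

definition gauss_conv :: "(real ^ 'd) measure \<Rightarrow> real ^ 'd \<Rightarrow> real" where
  "gauss_conv \<rho> x = (\<integral>y. gauss (x - y) \<partial>\<rho>)"

definition gaussian_mixture_samples ::
    "(real ^ 'd) measure \<Rightarrow> 'w measure \<Rightarrow> nat \<Rightarrow> (nat \<Rightarrow> 'w \<Rightarrow> real ^ 'd) \<Rightarrow> bool" where
  "gaussian_mixture_samples \<rho>s \<Omega> N X \<longleftrightarrow>
     \<rho>s \<in> prob_measures \<and> prob_space \<Omega> \<and>
     prob_space.indep_vars \<Omega> (\<lambda>_. borel) X {1..N} \<and>
     (\<forall>i\<in>{1..N}. distr \<Omega> borel (X i) = (\<rho>s \<star> std_gaussian))"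

text \<open>In the following, \<open>x 1, \<dots>, x N\<close> are the realized sample points.\<close>

definition nll :: "nat \<Rightarrow> (nat \<Rightarrow> real ^ 'd) \<Rightarrow> (real ^ 'd) measure \<Rightarrow> real" where
  "nll N x \<rho> = - (1 / real N) * (\<Sum>i=1..N. ln (gauss_conv \<rho> (x i)))"

definition is_npmle :: "nat \<Rightarrow> (nat \<Rightarrow> real ^ 'd) \<Rightarrow> (real ^ 'd) measure \<Rightarrow> bool" where
  "is_npmle N x \<rho> \<longleftrightarrow> is_arg_min (nll N x) (\<lambda>\<mu>. \<mu> \<in> prob_measures) \<rho>"

definition first_variation ::
    "nat \<Rightarrow> (nat \<Rightarrow> real ^ 'd) \<Rightarrow> (real ^ 'd) measure \<Rightarrow> real ^ 'd \<Rightarrow> real" where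
  "first_variation N x \<rho> y =
     - (1 / real N) * (\<Sum>i=1..N. gauss (y - x i) / gauss_conv \<rho> (x i))"

definition gradient :: "('a::real_inner \<Rightarrow> real) \<Rightarrow> 'a \<Rightarrow> 'a" where
  "gradient f y = (THE D. GDERIV f y :> D)"

text \<open>Since \<open>first_variation N x \<rho> \<le> 0\<close>, the density below is nonnegative whenever
  \<open>0 \<le> \<eta> \<le> 1\<close>, so that \<open>ennreal\<close> truncates nothing there.\<close>

definition fisher_rao_step ::
    "nat \<Rightarrow> (nat \<Rightarrow> real ^ 'd) \<Rightarrow> real \<Rightarrow> (real ^ 'd) measure \<Rightarrow> (real ^ 'd) measure" where
  "fisher_rao_step N x \<eta> \<rho> =
     density \<rho> (\<lambda>y. ennreal (1 - \<eta> * (1 + first_variation N x \<rho> y)))"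

definition wasserstein_step ::
    "nat \<Rightarrow> (nat \<Rightarrow> real ^ 'd) \<Rightarrow> real \<Rightarrow> (real ^ 'd) measure \<Rightarrow> (real ^ 'd) measure" where
  "wasserstein_step N x \<eta> \<rho> =
     distr \<rho> borel (\<lambda>y. y - \<eta> *\<^sub>R gradient (first_variation N x \<rho>) y)"

primrec wfr_gd ::
    "nat \<Rightarrow> (nat \<Rightarrow> real ^ 'd) \<Rightarrow> real \<Rightarrow> (real ^ 'd) measure \<Rightarrow> nat \<Rightarrow> (real ^ 'd) measure" where
  "wfr_gd N x \<eta> \<rho>0 0 = \<rho>0"
| "wfr_gd N x \<eta> \<rho>0 (Suc n) =
     wasserstein_step N x \<eta> (fisher_rao_step N x \<eta> (wfr_gd N x \<eta> \<rho>0 n))"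

end

theory Submission
  imports Defs
begin

text \<open>A weak limit \<open>\<rho>\<close> is a fixed point of the step. Suppose first that the step is small compared with all
  likelihoods at \<open>\<rho>\<close>. Then neither part of the step can decrease the mean of the potential frozen
  between them, so both leave it unchanged and \<open>\<rho>\<close> is a critical point: it
  lives in the convex hull of the samples, which bounds the likelihoods below in terms of the samples.

  Otherwise all mass sits far away. The mass created per step by points that overshoot is at most
  about \<open>\<eta>/2\<close>, too little to sustain the decay of the outer mass, so a fixed fraction of \<open>\<rho>\<close> lies in
  the shell where growth and decay nearly balance. This mass drifts inwards and grows
  by more than conservation of mass permits, a contradiction.

  Finally, if the potential of \<open>\<rho>\<close> exceeded \<open>1\<close> somewhere, Sard's theorem would give a regular level
  \<open>c > 1\<close> of it. Its superlevel set eventually traps the particles, it is charged because the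
  particle map is onto (Brouwer), and the mass in it grows geometrically. Hence the potential is at most
  \<open>1\<close>, which is the optimality condition for the convex negative log-likelihood.\<close>

section \<open>Sard's theorem for real-valued functions\<close>

text \<open>The bound on \<eta> may depend on the samples only, while the limit may depend on \<eta>
  and on the initialization; so no lower bound on the likelihoods, on which a plain descent estimate
  would rest, is available in advance. Freezing the potential between the two half-steps replaces
  it: the second-order loss is controlled as soon as this potential stays below
  \<open>1 / \<eta>\<close>, and since \<open>gauss 0\<close> is the maximum of
  \<open>gauss\<close>, this holds when every likelihood is at least
  \<open>\<eta> * gauss 0\<close>. That is the threshold of the case split. Below it, one tiny
  likelihood makes \<eta> times the potential large near the samples, with constants free of \<eta>,
  and this locates the slow particles.

  Regular levels are needed because the particles follow the potentials of the iterates, which only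
  converge to that of the limit: a trap must survive a small perturbation of the force, so the force
  may not vanish on its boundary. In dimension d this uses derivatives of order up to d + 1; hence
  Sard's theorem is proved for algebras closed under differentiation.\<close>

lemma negligible_hoelder_image:
  fixes f :: "'a::euclidean_space \<Rightarrow> real"
  assumes "bounded S"
    and hoelder: "\<And>y y'. y \<in> S \<Longrightarrow> y' \<in> S \<Longrightarrow> \<bar>f y' - f y\<bar> \<le> K * norm (y' - y) ^ Suc DIM('a)"
  shows "negligible (f ` S)"
proof -
  let ?d = "DIM('a)"
  obtain B where B: "B > 0" "\<And>y. y \<in> S \<Longrightarrow> norm y \<le> B"
    using \<open>bounded S\<close> bounded_pos by blast
  have K: "\<bar>f y' - f y\<bar> \<le> max K 0 * norm (y' - y) ^ Suc ?d" if "y \<in> S" "y' \<in> S" for y y'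
    using hoelder[OF that] mult_right_mono[of K "max K 0" "norm (y' - y) ^ Suc ?d"] by fastforce
  define L where "L = max K 0"
  have L0: "L \<ge> 0" by (simp add: L_def)
  \<comment> \<open>\<open>idx n y\<close> labels the cell of side \<open>1 / n\<close> that
    contains \<open>y\<close>. There are about \<open>n ^ d\<close> cells, each with an image of
    length about \<open>1 / n ^ (d + 1)\<close>, so the images have total length of order
    \<open>1 / n\<close>.\<close>
  define idx :: "nat \<Rightarrow> 'a \<Rightarrow> 'a \<Rightarrow> nat" where
    "idx n y = (\<lambda>b\<in>Basis. nat \<lfloor>(y \<bullet> b + B) * real n\<rfloor>)" for n y
  define I where "I n = (PiE (Basis :: 'a set) (\<lambda>_. {..nat \<lfloor>2 * B * real n\<rfloor>}))" for n
  define \<delta> where "\<delta> n = L * (real ?d / real n) ^ Suc ?d" for n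
  have comp: "\<bar>y \<bullet> b\<bar> \<le> B" if "y \<in> S" "b \<in> Basis" for y b
    using Basis_le_norm[OF that(2), of y] B(2)[OF that(1)] by linarith
  have idxI: "idx n y \<in> I n" if "y \<in> S" for n y
  proof -
    have "nat \<lfloor>(y \<bullet> b + B) * real n\<rfloor> \<le> nat \<lfloor>2 * B * real n\<rfloor>" if "b \<in> Basis" for b
    proof -
      have "(y \<bullet> b + B) * real n \<le> 2 * B * real n"
        using comp[OF \<open>y \<in> S\<close> that] by (intro mult_right_mono) auto
      then show ?thesis by (intro nat_mono floor_mono)
    qed
    then show ?thesis by (auto simp: I_def idx_def)
  qed
  have close: "norm (y' - y) \<le> real ?d / real n"
    if "y \<in> S" "y' \<in> S" "idx n y = idx n y'" "n > 0" for n y y'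
  proof -
    have "\<bar>(y' - y) \<bullet> b\<bar> \<le> 1 / real n" if b: "b \<in> Basis" for b
    proof -
      have "nat \<lfloor>(y \<bullet> b + B) * real n\<rfloor> = nat \<lfloor>(y' \<bullet> b + B) * real n\<rfloor>"
        using \<open>idx n y = idx n y'\<close> b by (metis (mono_tags, lifting) idx_def restrict_apply')
      moreover have "(y \<bullet> b + B) * real n \<ge> 0" "(y' \<bullet> b + B) * real n \<ge> 0"
        using comp[OF \<open>y \<in> S\<close> b] comp[OF \<open>y' \<in> S\<close> b] by (auto intro!: mult_nonneg_nonneg)
      ultimately have "\<lfloor>(y \<bullet> b + B) * real n\<rfloor> = \<lfloor>(y' \<bullet> b + B) * real n\<rfloor>"
        by (metis eq_nat_nat_iff zero_le_floor)
      then have "\<bar>(y' \<bullet> b + B) * real n - (y \<bullet> b + B) * real n\<bar> < 1"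
        by linarith
      then have "\<bar>(y' - y) \<bullet> b\<bar> * real n < 1"
        by (simp add: abs_mult inner_diff_left flip: left_diff_distrib)
      then show ?thesis using \<open>n > 0\<close> by (simp add: field_simps)
    qed
    then have "(\<Sum>b\<in>Basis. \<bar>(y' - y) \<bullet> b\<bar>) \<le> (\<Sum>b\<in>(Basis::'a set). 1 / real n)"
      by (rule sum_mono)
    then show ?thesis using norm_le_l1[of "y' - y"] by simp
  qed
  \<comment> \<open>An empty cell gets an arbitrary representative; its interval only enlarges the
    cover.\<close>
  define rep where "rep n i = (SOME y. y \<in> S \<and> idx n y = i)" for n i
  define T where "T n = (\<Union>i\<in>I n. cball (f (rep n i)) (\<delta> n))" for n
  have finI: "finite (I n)" for n by (auto simp: I_def intro: finite_PiE)
  have cardI: "card (I n) = Suc (nat \<lfloor>2 * B * real n\<rfloor>) ^ ?d" for n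
    by (simp add: I_def card_PiE)
  have \<delta>0: "\<delta> n \<ge> 0" for n by (simp add: \<delta>_def L0)
  have cover: "f ` S \<subseteq> T n" if "n > 0" for n
  proof clarify
    fix y assume "y \<in> S"
    let ?r = "rep n (idx n y)"
    have r: "?r \<in> S \<and> idx n ?r = idx n y"
      unfolding rep_def by (rule someI[of _ y]) (simp add: \<open>y \<in> S\<close>)
    have "\<bar>f y - f ?r\<bar> \<le> L * norm (y - ?r) ^ Suc ?d"
      using K r \<open>y \<in> S\<close> by (simp add: L_def)
    also have "\<dots> \<le> \<delta> n"
      unfolding \<delta>_def using close[of ?r y n] r \<open>y \<in> S\<close> that L0
      by (intro mult_left_mono power_mono) auto
    finally have "f y \<in> cball (f ?r) (\<delta> n)" by (simp add: dist_real_def abs_minus_commute)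
    then show "f y \<in> T n" unfolding T_def using idxI[OF \<open>y \<in> S\<close>] by blast
  qed
  have Tm: "T n \<in> lmeasurable" for n
    unfolding T_def using finI by (intro fmeasurable.finite_Union) auto
  have measT: "measure lebesgue (T n) \<le> real (card (I n)) * (2 * \<delta> n)" for n
  proof -
    have "measure lebesgue (T n) \<le> (\<Sum>i\<in>I n. measure lebesgue (cball (f (rep n i)) (\<delta> n)))"
      unfolding T_def by (rule measure_UNION_le) (auto simp: finI)
    also have "\<dots> = real (card (I n)) * (2 * \<delta> n)"
      using \<delta>0[of n] by (simp add: cball_eq_atLeastAtMost)
    finally show ?thesis .
  qed
  have bound: "real (card (I n)) * (2 * \<delta> n) \<le> 2 * L * (2 * B + 1) ^ ?d * real ?d ^ Suc ?d / real n"
    if "n > 0" for n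
  proof -
    have "real (Suc (nat \<lfloor>2 * B * real n\<rfloor>)) \<le> (2 * B + 1) * real n"
    proof -
      have "real (nat \<lfloor>2 * B * real n\<rfloor>) \<le> 2 * B * real n"
        using B(1) by (simp add: of_nat_floor)
      then show ?thesis using that by (simp add: algebra_simps)
    qed
    then have "real (card (I n)) \<le> ((2 * B + 1) * real n) ^ ?d"
      unfolding cardI of_nat_power by (intro power_mono) auto
    then have "real (card (I n)) * (2 * \<delta> n) \<le> ((2 * B + 1) * real n) ^ ?d * (2 * \<delta> n)"
      using \<delta>0[of n] by (intro mult_right_mono) auto
    also have "\<dots> = 2 * L * (2 * B + 1) ^ ?d * real ?d ^ Suc ?d / real n"
      unfolding \<delta>_def power_mult_distrib power_divide using that by simp
    finally show ?thesis .
  qed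
  show ?thesis
    unfolding negligible_outer
  proof (intro allI impI)
    fix e :: real assume "e > 0"
    let ?A = "2 * L * (2 * B + 1) ^ ?d * real ?d ^ Suc ?d"
    obtain n :: nat where n: "n > 0" "?A / e < real n"
      using reals_Archimedean2[of "max (?A / e) 0"] by auto
    then have "?A / real n < e" using \<open>e > 0\<close> by (simp add: field_simps)
    then have "measure lebesgue (T n) < e"
      using measT[of n] bound[OF n(1)] by linarith
    then show "\<exists>T. f ` S \<subseteq> T \<and> T \<in> lmeasurable \<and> measure lebesgue T < e"
      using cover[OF n(1)] Tm by blast
  qed
qed

text \<open>Plays the role of the smooth functions: the argument differentiates \<open>f\<close>
  repeatedly along fields built from earlier gradients, and closure under products and partial
  derivatives keeps every such expression inside \<open>R\<close>. The axiom \<open>basis\<close>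
  supplies the constants 0 and 1, hence the coordinate fields.\<close>

locale smooth_algebra =
  fixes R :: "('a::euclidean_space \<Rightarrow> real) set" and grad :: "('a \<Rightarrow> real) \<Rightarrow> 'a \<Rightarrow> 'a"
  assumes zero: "(\<lambda>_. 0) \<in> R"
    and add: "f \<in> R \<Longrightarrow> g \<in> R \<Longrightarrow> (\<lambda>y. f y + g y) \<in> R"
    and diff: "f \<in> R \<Longrightarrow> g \<in> R \<Longrightarrow> (\<lambda>y. f y - g y) \<in> R"
    and mult: "f \<in> R \<Longrightarrow> g \<in> R \<Longrightarrow> (\<lambda>y. f y * g y) \<in> R"
    and basis: "b \<in> Basis \<Longrightarrow> b' \<in> Basis \<Longrightarrow> (\<lambda>_. b \<bullet> b') \<in> R"
    and deriv: "f \<in> R \<Longrightarrow> (f has_derivative (\<lambda>h. h \<bullet> grad f y)) (at y)"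
    and grad: "f \<in> R \<Longrightarrow> b \<in> Basis \<Longrightarrow> (\<lambda>y. grad f y \<bullet> b) \<in> R"
begin

definition fields :: "('a \<Rightarrow> 'a) set" where
  "fields = {X. \<forall>b\<in>Basis. (\<lambda>y. X y \<bullet> b) \<in> R}"

definition dv :: "('a \<Rightarrow> 'a) \<Rightarrow> ('a \<Rightarrow> real) \<Rightarrow> 'a \<Rightarrow> real" where
  "dv X u y = X y \<bullet> grad u y"

primrec dvs :: "('a \<Rightarrow> 'a) list \<Rightarrow> ('a \<Rightarrow> real) \<Rightarrow> 'a \<Rightarrow> real" where
  "dvs [] u = u"
| "dvs (X # w) u = dv X (dvs w u)"

lemma sum_in: "finite A \<Longrightarrow> (\<And>i. i \<in> A \<Longrightarrow> f i \<in> R) \<Longrightarrow> (\<lambda>y. \<Sum>i\<in>A. f i y) \<in> R"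
  by (induction A rule: finite_induct) (auto simp: zero intro: add)

lemma dv_in: assumes "X \<in> fields" "u \<in> R" shows "dv X u \<in> R"
proof -
  have "dv X u = (\<lambda>y. \<Sum>b\<in>Basis. (X y \<bullet> b) * (grad u y \<bullet> b))"
    by (auto simp: dv_def euclidean_inner[of _ "grad u _"])
  also have "\<dots> \<in> R"
    using assms by (intro sum_in) (auto simp: fields_def intro!: mult grad)
  finally show ?thesis .
qed

lemma dvs_in: "set w \<subseteq> fields \<Longrightarrow> u \<in> R \<Longrightarrow> dvs w u \<in> R"
  by (induction w) (auto intro: dv_in)

lemma continuous_R: "f \<in> R \<Longrightarrow> continuous_on S f"
  by (meson deriv continuous_at_imp_continuous_on has_derivative_continuous)

lemma continuous_field: assumes "X \<in> fields" shows "continuous_on S X"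
  using assms by (subst continuous_on_componentwise) (auto simp: fields_def intro: continuous_R)

lemma grad_field: "f \<in> R \<Longrightarrow> grad f \<in> fields"
  by (auto simp: fields_def intro: grad)

definition cut :: "('a \<Rightarrow> real) \<Rightarrow> ('a \<Rightarrow> 'a) \<Rightarrow> ('a \<Rightarrow> 'a) \<Rightarrow> 'a \<Rightarrow> 'a" where
  "cut h Y X y = dv Y h y *\<^sub>R X y - dv X h y *\<^sub>R Y y"

lemma cut_field: assumes "X \<in> fields" "Y \<in> fields" "h \<in> R" shows "cut h Y X \<in> fields"
  unfolding fields_def
proof (clarify)
  fix b :: 'a assume "b \<in> Basis"
  then have "(\<lambda>y. dv Y h y * (X y \<bullet> b) - dv X h y * (Y y \<bullet> b)) \<in> R"
    using assms by (intro diff mult dv_in) (auto simp: fields_def)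
  then show "(\<lambda>y. cut h Y X y \<bullet> b) \<in> R"
    by (simp add: cut_def inner_diff_left)
qed

text \<open>\<open>M\<close> is the submanifold cut out by \<open>G\<close> in the open set \<open>Om\<close>, and the fields \<open>XS\<close> span its tangent
  spaces. Cutting \<open>M\<close> further by \<open>h\<close>, where some field \<open>Y\<close> has \<open>Y h \<noteq> 0\<close>, the fields
  \<open>(Y h) X - (X h) Y\<close> span the new tangent spaces; no chart is needed.\<close>

definition stage :: "('a \<Rightarrow> real) set \<Rightarrow> ('a \<Rightarrow> 'a) set \<Rightarrow> 'a set \<Rightarrow> 'a set \<Rightarrow> bool" where
  "stage G XS Om M \<longleftrightarrow> finite G \<and> G \<subseteq> R \<and> finite XS \<and> XS \<subseteq> fields \<and> open Om \<and>
     M = {y \<in> Om. \<forall>g\<in>G. g y = 0} \<and>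
     (\<forall>y\<in>M. inj_on (\<lambda>g. grad g y) G \<and> independent ((\<lambda>g. grad g y) ` G) \<and>
        span ((\<lambda>X. X y) ` XS) = {v. \<forall>g\<in>G. v \<bullet> grad g y = 0})"

text \<open>\<open>Y\<close> is orthogonal to every \<open>grad g\<close> but not to
  \<open>grad h\<close>, so \<open>grad h\<close> is independent of the old gradients; in particular
  \<open>h\<close> is new and the number of equations really grows. For spanning, the linear map
  taking \<open>v\<close> to \<open>(Y h) v - (v \<bullet> grad h) Y\<close> carries the old fields
  to the cut ones and multiplies a vector already orthogonal to \<open>grad h\<close> by the nonzero
  number \<open>Y h\<close>.\<close>

lemma stage_step:
  assumes st: "stage G XS Om M" and h: "h \<in> R" and Y: "Y \<in> XS"
  shows "stage (insert h G) (cut h Y ` XS) {y \<in> Om. dv Y h y \<noteq> 0} {y \<in> M. h y = 0 \<and> dv Y h y \<noteq> 0}"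
    and "{y \<in> M. h y = 0 \<and> dv Y h y \<noteq> 0} \<noteq> {} \<Longrightarrow> h \<notin> G"
proof -
  let ?M = "{y \<in> M. h y = 0 \<and> dv Y h y \<noteq> 0}"
  have fin: "finite G" "G \<subseteq> R" "finite XS" "XS \<subseteq> fields" "open Om"
    and M: "M = {y \<in> Om. \<forall>g\<in>G. g y = 0}"
    and ind: "\<And>y. y \<in> M \<Longrightarrow> inj_on (\<lambda>g. grad g y) G \<and> independent ((\<lambda>g. grad g y) ` G)"
    and sp: "\<And>y. y \<in> M \<Longrightarrow> span ((\<lambda>X. X y) ` XS) = {v. \<forall>g\<in>G. v \<bullet> grad g y = 0}"
    using st unfolding stage_def by blast+
  have Yf: "Y \<in> fields" using Y fin by auto
  have tang: "X y \<bullet> grad g y = 0" if "y \<in> M" "X \<in> XS" "g \<in> G" for X y g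
  proof -
    have "X y \<in> span ((\<lambda>X. X y) ` XS)" using that by (auto intro: span_base)
    then show ?thesis using sp that by auto
  qed
  have nsp: "grad h y \<notin> span ((\<lambda>g. grad g y) ` G)" if "y \<in> ?M" for y
  proof
    assume "grad h y \<in> span ((\<lambda>g. grad g y) ` G)"
    then have "orthogonal (Y y) (grad h y)"
      by (rule orthogonal_to_span) (use that Y tang in \<open>auto simp: orthogonal_def\<close>)
    then show False using that by (simp add: dv_def orthogonal_def)
  qed
  then show hG: "?M \<noteq> {} \<Longrightarrow> h \<notin> G" by (auto intro: span_base)
  have op: "open {y \<in> Om. dv Y h y \<noteq> 0}"
  proof -
    have "continuous_on Om (dv Y h)" using continuous_R[OF dv_in[OF Yf h]] .
    then have "open (Om \<inter> dv Y h -` (- {0}))"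
      by (rule continuous_open_preimage[OF _ \<open>open Om\<close>]) auto
    also have "Om \<inter> dv Y h -` (- {0}) = {y \<in> Om. dv Y h y \<noteq> 0}" by auto
    finally show ?thesis .
  qed
  have "span ((\<lambda>X. X y) ` cut h Y ` XS) = {v. \<forall>g\<in>insert h G. v \<bullet> grad g y = 0}"
    if y: "y \<in> ?M" for y
  proof
    have yM: "y \<in> M" using y by auto
    have "subspace {v. \<forall>g\<in>insert h G. v \<bullet> grad g y = 0}"
      by (auto simp: subspace_def inner_add_left)
    then show "span ((\<lambda>X. X y) ` cut h Y ` XS) \<subseteq> {v. \<forall>g\<in>insert h G. v \<bullet> grad g y = 0}"
      using tang[OF yM] Y
      by (intro span_minimal) (auto simp: cut_def dv_def inner_diff_left)
    show "{v. \<forall>g\<in>insert h G. v \<bullet> grad g y = 0} \<subseteq> span ((\<lambda>X. X y) ` cut h Y ` XS)"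
    proof
      fix v assume v: "v \<in> {v. \<forall>g\<in>insert h G. v \<bullet> grad g y = 0}"
      let ?c = "\<lambda>v. dv Y h y *\<^sub>R v - (v \<bullet> grad h y) *\<^sub>R Y y"
      have lin: "linear ?c"
        by (rule linearI) (auto simp: algebra_simps)
      have "v \<in> span ((\<lambda>X. X y) ` XS)" using v sp[OF yM] by auto
      then have "?c v \<in> ?c ` span ((\<lambda>X. X y) ` XS)" by blast
      also have "\<dots> = span (?c ` (\<lambda>X. X y) ` XS)"
        using linear_span_image[OF lin] by metis
      also have "?c ` (\<lambda>X. X y) ` XS = (\<lambda>X. X y) ` cut h Y ` XS"
        by (auto simp: cut_def dv_def image_iff)
      finally have "?c v \<in> span ((\<lambda>X. X y) ` cut h Y ` XS)" .
      moreover have "?c v = dv Y h y *\<^sub>R v" using v by auto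
      ultimately have "(1 / dv Y h y) *\<^sub>R (dv Y h y *\<^sub>R v) \<in> span ((\<lambda>X. X y) ` cut h Y ` XS)"
        by (metis span_mul)
      then show "v \<in> span ((\<lambda>X. X y) ` cut h Y ` XS)" using y by simp
    qed
  qed
  moreover have "inj_on (\<lambda>g. grad g y) (insert h G) \<and> independent ((\<lambda>g. grad g y) ` insert h G)"
    if y: "y \<in> ?M" for y
  proof -
    have "grad h y \<notin> (\<lambda>g. grad g y) ` G" using nsp[OF y] span_base by metis
    then show ?thesis
      using ind[of y] y nsp[OF y] by (auto simp: independent_insert)
  qed
  ultimately show "stage (insert h G) (cut h Y ` XS) {y \<in> Om. dv Y h y \<noteq> 0} ?M"
    unfolding stage_def using fin h op Yf by (auto simp: M intro!: cut_field)
qed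

text \<open>The fields \<open>XS\<close> may be linearly dependent, so a quadratic form replaces
  coordinates: \<open>q\<close> sums the squared products with the fields and the gradients. It is
  positive definite at \<open>z\<close>, since a vector in its kernel is orthogonal to the
  gradients, hence in the span of the fields, hence orthogonal to itself; compactness of the sphere
  keeps it definite nearby. It is applied to the tangential part \<open>p\<close> of
  \<open>w\<close>, which has the same products with the fields as \<open>w\<close> and none with
  the gradients.\<close>

lemma stage_slope:
  assumes st: "stage G XS Om M" and z: "z \<in> M"
  obtains W c where "open W" "z \<in> W" "c > 0"
    "\<And>y w v. y \<in> M \<inter> W \<Longrightarrow> \<forall>g\<in>G. v \<bullet> grad g y = 0 \<Longrightarrow>
       \<bar>w \<bullet> v\<bar> \<le> c * norm v * (\<Sum>X\<in>XS. \<bar>X y \<bullet> w\<bar>)"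
proof -
  have fin: "finite G" "G \<subseteq> R" "finite XS" "XS \<subseteq> fields"
    and sp: "\<And>y. y \<in> M \<Longrightarrow> span ((\<lambda>X. X y) ` XS) = {v. \<forall>g\<in>G. v \<bullet> grad g y = 0}"
    using st unfolding stage_def by blast+
  define V where "V = XS \<union> grad ` G"
  have finV: "finite V" "V \<subseteq> fields" using fin by (auto simp: V_def grad_field)
  define q where "q y v = (\<Sum>X\<in>V. (v \<bullet> X y)\<^sup>2)" for y v
  have qpos: "q z v > 0" if "v \<noteq> 0" for v
  proof (rule ccontr)
    assume "\<not> q z v > 0"
    moreover have "q z v \<ge> 0" unfolding q_def by (intro sum_nonneg) auto
    ultimately have "q z v = 0" by simp
    then have 0: "v \<bullet> X z = 0" if "X \<in> V" for X
      using that finV by (simp add: q_def sum_nonneg_eq_0_iff)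
    then have "\<forall>g\<in>G. v \<bullet> grad g z = 0" by (auto simp: V_def)
    then have "v \<in> span ((\<lambda>X. X z) ` XS)" using sp[OF z] by auto
    then have "orthogonal v v"
      by (intro orthogonal_to_span[of v]) (use 0 in \<open>auto simp: orthogonal_def V_def\<close>)
    then show False using that by (simp add: orthogonal_def)
  qed
  have "compact (sphere (0::'a) 1)" "sphere (0::'a) 1 \<noteq> {}" by auto
  moreover have "continuous_on (sphere 0 1) (q z)" unfolding q_def by (intro continuous_intros)
  ultimately obtain v0 where v0: "v0 \<in> sphere 0 1" "\<And>v. v \<in> sphere 0 1 \<Longrightarrow> q z v0 \<le> q z v"
    using continuous_attains_inf by metis
  define \<beta> where "\<beta> = q z v0"
  have "v0 \<noteq> 0" using v0(1) by auto
  then have \<beta>: "\<beta> > 0" using qpos by (simp add: \<beta>_def)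
  define r where "r y = (\<Sum>X\<in>V. norm (X y - X z) * (norm (X y) + norm (X z)))" for y
  have "continuous_on UNIV r"
    unfolding r_def using finV by (intro continuous_intros continuous_field) auto
  then have "open (r -` {..<\<beta>/2})" by (simp add: open_vimage continuous_on_eq_continuous_at)
  moreover have "z \<in> r -` {..<\<beta>/2}" using \<beta> by (simp add: r_def)
  moreover have qlow: "q y v \<ge> \<beta> / 2 * (norm v)\<^sup>2" if y: "r y < \<beta> / 2" for y v
  proof (cases "v = 0")
    case False
    define u where "u = v /\<^sub>R norm v"
    have u: "norm u = 1" using False by (simp add: u_def)
    have "q z u - q y u = (\<Sum>X\<in>V. (u \<bullet> X z)\<^sup>2 - (u \<bullet> X y)\<^sup>2)"
      by (simp add: q_def sum_subtractf)
    also have "\<dots> \<le> r y"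
      unfolding r_def
    proof (rule sum_mono)
      fix X assume "X \<in> V"
      have "(u \<bullet> X z)\<^sup>2 - (u \<bullet> X y)\<^sup>2 = (u \<bullet> (X z - X y)) * (u \<bullet> (X z + X y))"
        by (simp add: power2_eq_square algebra_simps inner_simps)
      also have "\<dots> \<le> \<bar>u \<bullet> (X z - X y)\<bar> * \<bar>u \<bullet> (X z + X y)\<bar>"
        by (metis abs_ge_self abs_mult)
      also have "\<dots> \<le> (norm u * norm (X z - X y)) * (norm u * norm (X z + X y))"
        by (intro mult_mono Cauchy_Schwarz_ineq2) auto
      also have "\<dots> \<le> norm (X y - X z) * (norm (X y) + norm (X z))"
        using u norm_triangle_ineq[of "X z" "X y"]
        by (simp add: norm_minus_commute mult_left_mono)
      finally show "(u \<bullet> X z)\<^sup>2 - (u \<bullet> X y)\<^sup>2 \<le> norm (X y - X z) * (norm (X y) + norm (X z))" .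
    qed
    finally have "q y u \<ge> \<beta> / 2" using v0(2)[of u] u y by (simp add: \<beta>_def)
    moreover have "q y v = (norm v)\<^sup>2 * q y u"
    proof -
      have v: "v = norm v *\<^sub>R u" using False by (simp add: u_def)
      have "q y v = q y (norm v *\<^sub>R u)" using v by simp
      also have "\<dots> = (norm v)\<^sup>2 * q y u"
        by (simp add: q_def sum_distrib_left power_mult_distrib)
      finally show ?thesis .
    qed
    ultimately show ?thesis by (metis mult.commute mult_left_mono zero_le_power2)
  qed (simp add: q_def)
  moreover have "\<bar>w \<bullet> v\<bar> \<le> sqrt (2 / \<beta>) * norm v * (\<Sum>X\<in>XS. \<bar>X y \<bullet> w\<bar>)"
    if y: "y \<in> M \<inter> r -` {..<\<beta>/2}" and v: "\<forall>g\<in>G. v \<bullet> grad g y = 0" for y w v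
  proof -
    have yM: "y \<in> M" using y by auto
    let ?S = "(\<lambda>X. X y) ` XS"
    obtain p o' where p: "p \<in> span ?S" and o': "\<And>u. u \<in> span ?S \<Longrightarrow> orthogonal o' u" and w: "w = p + o'"
      using orthogonal_subspace_decomp_exists by metis
    have "v \<in> span ?S" using v sp[OF yM] by auto
    then have wv: "w \<bullet> v = p \<bullet> v" using o'[of v] by (simp add: w orthogonal_def inner_add_left)
    have pX: "p \<bullet> X y = X y \<bullet> w" if "X \<in> XS" for X
    proof -
      have "X y \<in> span ?S" using that by (auto intro: span_base)
      then have "orthogonal o' (X y)" by (rule o')
      then show ?thesis by (simp add: w orthogonal_def inner_add_right inner_commute)
    qed
    have pg: "p \<bullet> grad g y = 0" if "g \<in> G" for g using p sp[OF yM] that by auto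
    have "\<beta> / 2 * (norm p)\<^sup>2 \<le> q y p" using qlow y by auto
    also have "\<dots> \<le> (\<Sum>X\<in>XS. (p \<bullet> X y)\<^sup>2) + (\<Sum>X\<in>grad ` G. (p \<bullet> X y)\<^sup>2)"
      unfolding q_def V_def using fin by (subst sum_Un) (auto intro: sum_nonneg)
    also have "(\<Sum>X\<in>grad ` G. (p \<bullet> X y)\<^sup>2) = 0" using pg by (intro sum.neutral) auto
    also have "(\<Sum>X\<in>XS. (p \<bullet> X y)\<^sup>2) + 0 = (\<Sum>X\<in>XS. \<bar>X y \<bullet> w\<bar>\<^sup>2)" using pX by simp
    also have "\<dots> \<le> (\<Sum>X\<in>XS. \<bar>X y \<bullet> w\<bar>)\<^sup>2"
    proof -
      have "(\<Sum>X\<in>XS. \<bar>X y \<bullet> w\<bar>\<^sup>2) \<le> (\<Sum>X\<in>XS. \<bar>X y \<bullet> w\<bar> * (\<Sum>X\<in>XS. \<bar>X y \<bullet> w\<bar>))"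
        unfolding power2_eq_square using fin
        by (intro sum_mono mult_left_mono member_le_sum) auto
      then show ?thesis by (simp add: power2_eq_square sum_distrib_right)
    qed
    finally have "(norm p)\<^sup>2 \<le> 2 / \<beta> * (\<Sum>X\<in>XS. \<bar>X y \<bullet> w\<bar>)\<^sup>2"
      using \<beta> by (simp add: field_simps)
    then have "norm p \<le> sqrt (2 / \<beta> * (\<Sum>X\<in>XS. \<bar>X y \<bullet> w\<bar>)\<^sup>2)" by (rule real_le_rsqrt)
    also have "\<dots> = sqrt (2 / \<beta>) * (\<Sum>X\<in>XS. \<bar>X y \<bullet> w\<bar>)"
      unfolding real_sqrt_mult real_sqrt_abs by (simp add: sum_nonneg)
    finally have "norm p * norm v \<le> sqrt (2 / \<beta>) * (\<Sum>X\<in>XS. \<bar>X y \<bullet> w\<bar>) * norm v"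
      by (rule mult_right_mono) simp
    then show ?thesis using Cauchy_Schwarz_ineq2[of p v] wv by (simp add: mult_ac)
  qed
  ultimately show ?thesis using \<beta> by (intro that[of "r -` {..<\<beta>/2}" "sqrt (2/\<beta>)"]) auto
qed

text \<open>\<open>F\<close> straightens \<open>M\<close>: with \<open>u\<close> dual to the
  gradients at \<open>z\<close>, the product of \<open>F y\<close> with \<open>grad g z\<close> is
  \<open>g y\<close>, so \<open>M\<close> becomes a linear subspace and the path is the preimage of
  a segment. Where \<open>DF\<close> differs from the identity by at most 1/2, the segment has
  length at most 3/2 of \<open>norm (y' - y)\<close> and the inverse stretches by at most 2; this is
  the 3.\<close>

lemma stage_path:
  assumes st: "stage G XS Om M" and z: "z \<in> M" and "open W" "z \<in> W"
  obtains U where "open U" "z \<in> U"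
    "\<And>y y'. y \<in> M \<inter> U \<Longrightarrow> y' \<in> M \<inter> U \<Longrightarrow> \<exists>\<gamma> \<gamma>'. \<gamma> 0 = y \<and> \<gamma> 1 = y' \<and>
       (\<forall>t\<in>{0..1::real}. \<gamma> t \<in> M \<inter> W \<and> (\<gamma> has_vector_derivative \<gamma>' t) (at t) \<and>
          norm (\<gamma>' t) \<le> 3 * norm (y' - y) \<and> (\<forall>g\<in>G. \<gamma>' t \<bullet> grad g (\<gamma> t) = 0))"
proof -
  have fin: "finite G" "G \<subseteq> R" "open Om"
    and M: "M = {y \<in> Om. \<forall>g\<in>G. g y = 0}"
    and ind: "inj_on (\<lambda>g. grad g z) G" "independent ((\<lambda>g. grad g z) ` G)"
    using st z unfolding stage_def by blast+
  have "\<exists>u. \<forall>g'\<in>G. u \<bullet> grad g' z = (if g' = g then 1 else 0)" if "g \<in> G" for g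
  proof -
    obtain \<phi> :: "'a \<Rightarrow> real" where \<phi>: "linear \<phi>"
      "\<forall>v\<in>(\<lambda>g. grad g z) ` G. \<phi> v = (if v = grad g z then 1 else 0)"
      using linear_independent_extend[OF ind(2), where f="\<lambda>v. if v = grad g z then 1 else 0"] by auto
    have "adjoint \<phi> 1 \<bullet> v = \<phi> v" for v
      using adjoint_works[OF \<phi>(1), of v 1] by (simp add: inner_commute)
    then have "adjoint \<phi> 1 \<bullet> grad g' z = (if g' = g then 1 else 0)" if "g' \<in> G" for g'
      using \<phi>(2) inj_on_eq_iff[OF ind(1) that \<open>g \<in> G\<close>] that by simp
    then show ?thesis by blast
  qed
  then obtain u where u: "\<And>g g'. g \<in> G \<Longrightarrow> g' \<in> G \<Longrightarrow> u g \<bullet> grad g' z = (if g' = g then 1 else 0)"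
    by metis
  define F where "F y = (y - z) + (\<Sum>g\<in>G. (g y - (y - z) \<bullet> grad g z) *\<^sub>R u g)" for y
  define DF where "DF y h = h + (\<Sum>g\<in>G. (h \<bullet> (grad g y - grad g z)) *\<^sub>R u g)" for y h
  have gF: "F y \<bullet> grad g z = g y" if "g \<in> G" for y g
  proof -
    have "F y \<bullet> grad g z = (y - z) \<bullet> grad g z + (\<Sum>g'\<in>G. if g' = g then g y - (y - z) \<bullet> grad g z else 0)"
      unfolding F_def inner_add_left inner_sum_left using that
      by (intro arg_cong2[where f="(+)"] refl sum.cong) (auto simp: u)
    then show ?thesis using that fin by simp
  qed
  have gDF: "DF y h \<bullet> grad g z = h \<bullet> grad g y" if "g \<in> G" for y h g
  proof -
    have "DF y h \<bullet> grad g z = h \<bullet> grad g z + (\<Sum>g'\<in>G. if g' = g then h \<bullet> (grad g y - grad g z) else 0)"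
      unfolding DF_def inner_add_left inner_sum_left using that
      by (intro arg_cong2[where f="(+)"] refl sum.cong) (auto simp: u)
    then show ?thesis using that fin by (simp add: inner_diff_right)
  qed
  have DF: "(F has_derivative DF y) (at y)" for y
  proof -
    have "(F has_derivative (\<lambda>h. h + (\<Sum>g\<in>G. (h \<bullet> grad g y - h \<bullet> grad g z) *\<^sub>R u g))) (at y)"
      unfolding F_def using fin
      by (auto intro!: derivative_eq_intros deriv)
    moreover have "DF y = (\<lambda>h. h + (\<Sum>g\<in>G. (h \<bullet> grad g y - h \<bullet> grad g z) *\<^sub>R u g))"
      by (auto simp: DF_def inner_diff_right)
    ultimately show ?thesis by simp
  qed
  have bl: "bounded_linear (DF y)" for y using DF has_derivative_bounded_linear by blast
  define s where "s y = (\<Sum>g\<in>G. norm (grad g y - grad g z) * norm (u g))" for y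
  have DFs: "norm (DF y h - h) \<le> s y * norm h" for y h
  proof -
    have "norm (DF y h - h) \<le> (\<Sum>g\<in>G. norm ((h \<bullet> (grad g y - grad g z)) *\<^sub>R u g))"
      using norm_sum[of "\<lambda>g. (h \<bullet> (grad g y - grad g z)) *\<^sub>R u g" G] by (simp add: DF_def)
    also have "\<dots> \<le> (\<Sum>g\<in>G. norm (grad g y - grad g z) * norm (u g) * norm h)"
    proof (rule sum_mono)
      fix g
      show "norm ((h \<bullet> (grad g y - grad g z)) *\<^sub>R u g) \<le> norm (grad g y - grad g z) * norm (u g) * norm h"
        using mult_right_mono[OF Cauchy_Schwarz_ineq2[of h "grad g y - grad g z"], of "norm (u g)"]
        by (simp add: mult_ac)
    qed
    finally show ?thesis unfolding s_def sum_distrib_right .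
  qed
  have conts: "continuous_on UNIV s"
    unfolding s_def using fin by (intro continuous_intros continuous_field grad_field) auto
  have contDF: "continuous_on UNIV (\<lambda>y. Blinfun (DF y))"
  proof (rule continuous_on_blinfun_componentwise)
    fix i :: 'a assume "i \<in> Basis"
    have "continuous_on UNIV (\<lambda>y. DF y i)"
      unfolding DF_def using fin by (intro continuous_intros continuous_field grad_field) auto
    then show "continuous_on UNIV (\<lambda>y. blinfun_apply (Blinfun (DF y)) i)"
      by (simp add: bounded_linear_Blinfun_apply[OF bl])
  qed
  have id: "id_blinfun o\<^sub>L Blinfun (DF z) = id_blinfun"
    by (rule blinfun_eqI) (simp add: bounded_linear_Blinfun_apply[OF bl] DF_def)
  have "\<exists>U' V \<psi> \<psi>'. open U' \<and> z \<in> U' \<and> open V \<and> F z \<in> V \<and> homeomorphism U' V F \<psi> \<and>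
    (\<forall>y\<in>V. (\<psi> has_derivative \<psi>' y) (at y) \<and> \<psi>' y = inv (DF (\<psi> y)) \<and> bij (DF (\<psi> y)))"
  proof (rule inverse_function_theorem[OF open_UNIV _ contDF UNIV_I id])
    show "(F has_derivative blinfun_apply (Blinfun (DF y))) (at y)" for y
      using DF by (simp add: bounded_linear_Blinfun_apply[OF bl])
  next
    fix U' V g g'
    assume "open U'" "z \<in> U'" "open V" "F z \<in> V" "homeomorphism U' V F g"
      "\<And>y. y \<in> V \<Longrightarrow> (g has_derivative (g' y)) (at y)"
      "\<And>y. y \<in> V \<Longrightarrow> g' y = inv (blinfun_apply (Blinfun (DF (g y))))"
      "\<And>y. y \<in> V \<Longrightarrow> bij (blinfun_apply (Blinfun (DF (g y))))"
    then show ?thesis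
      by (intro exI[of _ U'] exI[of _ V] exI[of _ g] exI[of _ g'])
         (simp add: bounded_linear_Blinfun_apply[OF bl])
  qed
  then obtain U' V \<psi> \<psi>' where inv: "open U'" "z \<in> U'" "open V" "F z \<in> V" "homeomorphism U' V F \<psi>"
    "\<And>y. y \<in> V \<Longrightarrow> (\<psi> has_derivative \<psi>' y) (at y)"
    "\<And>y. y \<in> V \<Longrightarrow> \<psi>' y = inv (DF (\<psi> y))"
    "\<And>y. y \<in> V \<Longrightarrow> bij (DF (\<psi> y))"
    by metis
  have "open (U' \<inter> W \<inter> Om \<inter> s -` {..<1/2})"
    using inv(1) fin(3) \<open>open W\<close> conts by (intro open_Int open_vimage) auto
  moreover have "z \<in> U' \<inter> W \<inter> Om \<inter> s -` {..<1/2}" using z inv(2) \<open>z \<in> W\<close> by (auto simp: M s_def)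
  ultimately obtain e0 where e0: "e0 > 0" "ball z e0 \<subseteq> U' \<inter> W \<inter> Om \<inter> s -` {..<1/2}"
    using open_contains_ball by metis
  define B where "B = ball z e0"
  have Fz: "F z = 0" using z by (auto simp: F_def M intro!: sum.neutral)
  have "open (\<psi> -` B \<inter> V)"
    using continuous_open_preimage[OF homeomorphism_cont2[OF inv(5)] inv(3), of B]
    by (simp add: B_def Int_commute)
  moreover have "0 \<in> \<psi> -` B \<inter> V"
    using homeomorphism_apply1[OF inv(5,2)] inv(4) e0(1) Fz by (simp add: B_def)
  ultimately obtain e1 where e1: "e1 > 0" "ball 0 e1 \<subseteq> \<psi> -` B \<inter> V"
    using open_contains_ball by metis
  have contF: "continuous_on UNIV F"
    by (meson DF continuous_at_imp_continuous_on has_derivative_continuous)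
  define U where "U = B \<inter> F -` ball 0 e1"
  have "open U" unfolding U_def B_def using contF by (intro open_Int open_vimage) auto
  moreover have "z \<in> U" using e0 e1 Fz by (simp add: U_def B_def)
  moreover have "\<exists>\<gamma> \<gamma>'. \<gamma> 0 = y \<and> \<gamma> 1 = y' \<and>
       (\<forall>t\<in>{0..1::real}. \<gamma> t \<in> M \<inter> W \<and> (\<gamma> has_vector_derivative \<gamma>' t) (at t) \<and>
          norm (\<gamma>' t) \<le> 3 * norm (y' - y) \<and> (\<forall>g\<in>G. \<gamma>' t \<bullet> grad g (\<gamma> t) = 0))"
    if y: "y \<in> M \<inter> U" and y': "y' \<in> M \<inter> U" for y y'
  proof -
    define w where "w = F y' - F y"
    define \<sigma> where "\<sigma> t = F y + t *\<^sub>R w" for t :: real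
    define \<gamma> where "\<gamma> t = \<psi> (\<sigma> t)" for t
    define \<gamma>' where "\<gamma>' t = \<psi>' (\<sigma> t) w" for t
    have \<sigma>: "\<sigma> t \<in> ball 0 e1" if "t \<in> {0..1}" for t
    proof -
      have "\<sigma> t = (1 - t) *\<^sub>R F y + t *\<^sub>R F y'" by (simp add: \<sigma>_def w_def algebra_simps)
      then show ?thesis using convexD_alt[OF convex_ball, of "F y" 0 e1 "F y'" t] y y' that
        by (auto simp: U_def)
    qed
    have \<sigma>V: "\<sigma> t \<in> V" and \<gamma>B: "\<gamma> t \<in> B" if "t \<in> {0..1}" for t
      using \<sigma>[OF that] e1 by (auto simp: \<gamma>_def)
    have F\<gamma>: "F (\<gamma> t) = \<sigma> t" if "t \<in> {0..1}" for t
      using inv(5) \<sigma>V[OF that] by (simp add: \<gamma>_def homeomorphism_apply2)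
    have zero_on: "g y = 0" if "g \<in> G" "y \<in> M" for g y using that M by blast
    have wg: "w \<bullet> grad g z = 0" if "g \<in> G" for g
      using zero_on[OF that] y y' by (simp add: w_def inner_diff_left gF[OF that])
    have \<gamma>M: "\<gamma> t \<in> M" if "t \<in> {0..1}" for t
    proof -
      have "g (\<gamma> t) = 0" if g: "g \<in> G" for g
        using gF[OF g, of "\<gamma> t"] gF[OF g, of y] F\<gamma>[OF \<open>t \<in> {0..1}\<close>] wg[OF g] zero_on[OF g] y
        by (simp add: \<sigma>_def inner_add_left)
      then show ?thesis using \<gamma>B[OF that] e0 by (auto simp: M B_def)
    qed
    have DF\<gamma>: "DF (\<gamma> t) (\<gamma>' t) = w" if "t \<in> {0..1}" for t
      using inv(7,8)[OF \<sigma>V[OF that]]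
      by (simp add: \<gamma>'_def \<gamma>_def bij_is_surj surj_f_inv_f)
    have wb: "norm w \<le> 3/2 * norm (y' - y)"
      unfolding w_def
    proof (rule differentiable_bound[of B F DF])
      show "convex B" by (simp add: B_def)
      show "(F has_derivative DF x) (at x within B)" for x using DF has_derivative_at_withinI by blast
      show "onorm (DF x) \<le> 3/2" if "x \<in> B" for x
      proof (rule onorm_le)
        fix h :: 'a
        have "s x < 1/2" using that e0 by (auto simp: B_def)
        then have "s x * norm h \<le> 1/2 * norm h" by (intro mult_right_mono) auto
        then show "norm (DF x h) \<le> 3/2 * norm h"
          using DFs[of x h] norm_triangle_ineq[of "DF x h - h" h] by simp
      qed
    qed (use y y' in \<open>auto simp: U_def\<close>)
    show ?thesis
    proof (rule exI[of _ \<gamma>], rule exI[of _ \<gamma>'], intro conjI ballI IntI)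
      show "\<gamma> 0 = y" "\<gamma> 1 = y'"
        using homeomorphism_apply1[OF inv(5), of y] homeomorphism_apply1[OF inv(5), of y'] y y' e0(2)
        by (auto simp: \<gamma>_def \<sigma>_def w_def U_def B_def)
      fix t :: real assume t: "t \<in> {0..1}"
      show "\<gamma> t \<in> M" "\<gamma> t \<in> W" using \<gamma>M[OF t] \<gamma>B[OF t] e0 by (auto simp: B_def)
      have "(\<sigma> has_vector_derivative w) (at t)"
        unfolding \<sigma>_def by (auto intro!: derivative_eq_intros)
      then show "(\<gamma> has_vector_derivative \<gamma>' t) (at t)"
        using vector_derivative_diff_chain_within[of \<sigma> w t UNIV \<psi> "\<psi>' (\<sigma> t)"] inv(6)[OF \<sigma>V[OF t]]
        by (simp add: \<gamma>_def[abs_def] \<gamma>'_def o_def has_derivative_at_withinI)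
      have "s (\<gamma> t) < 1/2" using \<gamma>B[OF t] e0 by (auto simp: B_def)
      then have "s (\<gamma> t) * norm (\<gamma>' t) \<le> 1/2 * norm (\<gamma>' t)" by (intro mult_right_mono) auto
      then have "norm (w - \<gamma>' t) \<le> 1/2 * norm (\<gamma>' t)" using DFs[of "\<gamma> t" "\<gamma>' t"] DF\<gamma>[OF t] by simp
      then show "norm (\<gamma>' t) \<le> 3 * norm (y' - y)"
        using norm_triangle_ineq4[of w "w - \<gamma>' t"] wb by simp
      show "\<gamma>' t \<bullet> grad g (\<gamma> t) = 0" if "g \<in> G" for g
        using gDF[OF that, of "\<gamma> t" "\<gamma>' t"] DF\<gamma>[OF t] wg[OF that] by simp
    qed
  qed
  ultimately show ?thesis by (rule that)
qed

text \<open>A Taylor estimate inside \<open>M\<close>. Derivatives along words of length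
  \<open>m\<close> are bounded; a shorter nonempty word has derivative 0 at \<open>y\<close>, so
  integrating along the path gains a factor \<open>A * D\<close> each time the word is shortened,
  \<open>m\<close> factors in all.\<close>

lemma stage_flat:
  assumes st: "stage G XS Om M" and z: "z \<in> M" and f: "f \<in> R" and "m > 0"
  obtains U K where "open U" "z \<in> U"
    "\<And>y y'. y \<in> M \<inter> U \<Longrightarrow> y' \<in> M \<inter> U \<Longrightarrow>
       (\<And>w. w \<noteq> [] \<Longrightarrow> set w \<subseteq> XS \<Longrightarrow> length w < m \<Longrightarrow> dvs w f y = 0) \<Longrightarrow>
       \<bar>f y' - f y\<bar> \<le> K * norm (y' - y) ^ m"
proof -
  have fin: "finite XS" "XS \<subseteq> fields" using st unfolding stage_def by blast+
  obtain W0 c where W0: "open W0" "z \<in> W0" "c > 0"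
    and slope: "\<And>y w v. y \<in> M \<inter> W0 \<Longrightarrow> \<forall>g\<in>G. v \<bullet> grad g y = 0 \<Longrightarrow>
       \<bar>w \<bullet> v\<bar> \<le> c * norm v * (\<Sum>X\<in>XS. \<bar>X y \<bullet> w\<bar>)"
    using stage_slope[OF st z] by metis
  define ws where "ws = {w. set w \<subseteq> XS \<and> length w = m}"
  have finws: "finite ws" unfolding ws_def by (rule finite_lists_length_eq[OF fin(1)])
  have inR: "dvs w f \<in> R" if "set w \<subseteq> XS" for w using that fin f by (intro dvs_in) auto
  have "continuous_on (cball z 1) (\<lambda>y. \<Sum>w\<in>ws. \<bar>dvs w f y\<bar>)"
    by (intro continuous_on_sum continuous_on_rabs continuous_R inR) (simp add: ws_def)
  then have "bounded ((\<lambda>y. \<Sum>w\<in>ws. \<bar>dvs w f y\<bar>) ` cball z 1)"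
    by (intro compact_imp_bounded compact_continuous_image) auto
  then obtain K0 where "\<forall>v\<in>(\<lambda>y. \<Sum>w\<in>ws. \<bar>dvs w f y\<bar>) ` cball z 1. norm v \<le> K0"
    unfolding bounded_iff by blast
  then have K0: "\<bar>\<Sum>w\<in>ws. \<bar>dvs w f y\<bar>\<bar> \<le> K0" if "y \<in> cball z 1" for y
    using that by (metis (no_types, lifting) imageI real_norm_def)
  have K0w: "\<bar>dvs w f y\<bar> \<le> K0" if "w \<in> ws" "y \<in> cball z 1" for w y
  proof -
    have "\<bar>dvs w f y\<bar> \<le> (\<Sum>w\<in>ws. \<bar>dvs w f y\<bar>)" using that finws by (intro member_le_sum) auto
    then show ?thesis using K0[OF that(2)] by linarith
  qed
  have K00: "K0 \<ge> 0" using order_trans[OF abs_ge_zero K0[of z]] by simp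
  obtain U where U: "open U" "z \<in> U"
    and path: "\<And>y y'. y \<in> M \<inter> U \<Longrightarrow> y' \<in> M \<inter> U \<Longrightarrow> \<exists>\<gamma> \<gamma>'. \<gamma> 0 = y \<and> \<gamma> 1 = y' \<and>
       (\<forall>t\<in>{0..1::real}. \<gamma> t \<in> M \<inter> (W0 \<inter> ball z 1) \<and> (\<gamma> has_vector_derivative \<gamma>' t) (at t) \<and>
          norm (\<gamma>' t) \<le> 3 * norm (y' - y) \<and> (\<forall>g\<in>G. \<gamma>' t \<bullet> grad g (\<gamma> t) = 0))"
  proof (rule stage_path[OF st z])
    show "open (W0 \<inter> ball z 1)" "z \<in> W0 \<inter> ball z 1" using W0 by auto
  qed (rule that)
  \<comment> \<open>Speed at most \<open>3 * D\<close>, slope constant \<open>c\<close>, and one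
    term for each field.\<close>
  define A where "A = 3 * c * card XS"
  have A0: "A \<ge> 0" using W0 by (simp add: A_def)
  show ?thesis
  proof (rule that[OF U, of "K0 * A ^ m"])
    fix y y' assume y: "y \<in> M \<inter> U" and y': "y' \<in> M \<inter> U"
      and flat: "\<And>w. w \<noteq> [] \<Longrightarrow> set w \<subseteq> XS \<Longrightarrow> length w < m \<Longrightarrow> dvs w f y = 0"
    define D where "D = norm (y' - y)"
    obtain \<gamma> \<gamma>' where \<gamma>: "\<gamma> 0 = y" "\<gamma> 1 = y'"
      and \<gamma>t: "\<And>t. t \<in> {0..1::real} \<Longrightarrow> \<gamma> t \<in> M \<inter> (W0 \<inter> ball z 1) \<and> (\<gamma> has_vector_derivative \<gamma>' t) (at t) \<and>
          norm (\<gamma>' t) \<le> 3 * D \<and> (\<forall>g\<in>G. \<gamma>' t \<bullet> grad g (\<gamma> t) = 0)"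
      using path[OF y y'] unfolding D_def by blast
    have step: "\<bar>dvs w f (\<gamma> t) - dvs w f y\<bar> \<le> A * D * B"
      if w: "set w \<subseteq> XS" and B: "\<And>X s. X \<in> XS \<Longrightarrow> s \<in> {0..1} \<Longrightarrow> \<bar>dvs (X # w) f (\<gamma> s)\<bar> \<le> B"
        and t: "t \<in> {0..1}" for w B t
    proof -
      define \<phi> where "\<phi> s = dvs w f (\<gamma> s)" for s
      define \<phi>' where "\<phi>' s = \<gamma>' s \<bullet> grad (dvs w f) (\<gamma> s)" for s
      have d: "(\<phi> has_real_derivative \<phi>' s) (at s within {0..1})" if s: "s \<in> {0..1}" for s
      proof -
        have "((dvs w f \<circ> \<gamma>) has_vector_derivative \<phi>' s) (at s within {0..1})"
          unfolding \<phi>'_def using deriv[OF inR[OF w]] \<gamma>t[OF s]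
          by (intro vector_derivative_diff_chain_within)
             (auto intro: has_derivative_at_withinI has_vector_derivative_at_within)
        then show ?thesis
          by (simp add: \<phi>_def[abs_def] o_def has_real_derivative_iff_has_vector_derivative)
      qed
      have b: "\<bar>\<phi>' s\<bar> \<le> A * D * B" if s: "s \<in> {0..1}" for s
      proof -
        have "\<bar>\<phi>' s\<bar> \<le> c * norm (\<gamma>' s) * (\<Sum>X\<in>XS. \<bar>X (\<gamma> s) \<bullet> grad (dvs w f) (\<gamma> s)\<bar>)"
          unfolding \<phi>'_def using slope[of "\<gamma> s" "\<gamma>' s" "grad (dvs w f) (\<gamma> s)"] \<gamma>t[OF s]
          by (simp add: inner_commute)
        also have "\<dots> \<le> c * (3 * D) * (\<Sum>X\<in>XS. B)"
          using \<gamma>t[OF s] W0 B[OF _ s]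
          by (intro mult_mono sum_mono) (auto simp: dv_def D_def intro: sum_nonneg)
        finally show ?thesis by (simp add: A_def mult_ac)
      qed
      have "norm (\<phi> t - \<phi> 0) \<le> (A * D * B) * norm (t - 0)"
        by (rule field_differentiable_bound[of "{0..1}" \<phi> \<phi>']) (use d b t in auto)
      moreover have "0 \<le> A * D * B" using b[OF t] by linarith
      ultimately show ?thesis using \<gamma>(1) t mult_left_le[of "\<bar>t\<bar>" "A * D * B"] by (auto simp: \<phi>_def)
    qed
    have *: "\<bar>dvs w f (\<gamma> t)\<bar> \<le> K0 * (A * D) ^ k"
      if "set w \<subseteq> XS" "w \<noteq> []" "length w + k = m" "t \<in> {0..1}" for w k t
      using that
    proof (induction k arbitrary: w t)
      case 0
      then show ?case using K0w[of w "\<gamma> t"] \<gamma>t[of t] by (auto simp: ws_def)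
    next
      case (Suc k)
      have "\<bar>dvs w f (\<gamma> t) - dvs w f y\<bar> \<le> A * D * (K0 * (A * D) ^ k)"
        by (rule step) (use Suc.IH[of "_ # w"] Suc.prems in auto)
      then show ?case using flat[of w] Suc.prems by (simp add: mult_ac)
    qed
    show "\<bar>f y' - f y\<bar> \<le> K0 * A ^ m * norm (y' - y) ^ m"
    proof -
      obtain k where Suc: "m = Suc k" using \<open>m > 0\<close> gr0_conv_Suc by blast
      have "\<bar>dvs [] f (\<gamma> 1) - dvs [] f y\<bar> \<le> A * D * (K0 * (A * D) ^ k)"
        by (rule step) (use *[of "[_]" k] Suc in auto)
      then show ?thesis using \<gamma> Suc by (simp add: D_def power_mult_distrib mult_ac)
    qed
  qed
qed

text \<open>Either all iterated tangential derivatives of \<open>f\<close> up to order \<open>DIM('a)\<close> vanish, and then \<open>f\<close> is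
  Hoelder of exponent \<open>DIM('a) + 1\<close> there, or some vanishing iterated derivative cuts \<open>M\<close> down
  to a smaller submanifold.\<close>

lemma negligible_critical_values_stage:
  assumes "stage G XS Om M" and f: "f \<in> R" and "C \<subseteq> M"
    and "\<And>y X. y \<in> C \<Longrightarrow> X \<in> XS \<Longrightarrow> dv X f y = 0"
  shows "negligible (f ` C)"
  using assms
proof (induction "DIM('a) - card G" arbitrary: G XS Om M C rule: less_induct)
  case less
  note st = less.prems(1) and C = less.prems(3) and crit = less.prems(4)
  have fin: "finite G" "finite XS" "XS \<subseteq> fields" using st unfolding stage_def by blast+
  let ?m = "Suc DIM('a)"
  \<comment> \<open>The flat points. At any other point of \<open>C\<close> some derivative
    \<open>dvs w f\<close> vanishes while a further field derivative of it does not; these points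
    form the sets \<open>P w Y\<close>.\<close>
  define C0 where "C0 = {y \<in> C. \<forall>w. w \<noteq> [] \<longrightarrow> set w \<subseteq> XS \<longrightarrow> length w < ?m \<longrightarrow> dvs w f y = 0}"
  define ws where "ws = {w. set w \<subseteq> XS \<and> length w \<le> ?m}"
  define P where "P w Y = {y \<in> C. dvs w f y = 0 \<and> dv Y (dvs w f) y \<noteq> 0}" for w Y
  have finws: "finite ws" unfolding ws_def by (rule finite_lists_length_le[OF fin(2)])
  have negP: "negligible (f ` P w Y)" if w: "w \<in> ws" and Y: "Y \<in> XS" for w Y
  proof (cases "P w Y = {}")
    case False
    let ?h = "dvs w f"
    let ?M = "{y \<in> M. ?h y = 0 \<and> dv Y ?h y \<noteq> 0}"
    have h: "?h \<in> R" using w fin f by (intro dvs_in) (auto simp: ws_def)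
    have P: "P w Y \<subseteq> ?M" using C by (auto simp: P_def)
    have st': "stage (insert ?h G) (cut ?h Y ` XS) {y \<in> Om. dv Y ?h y \<noteq> 0} ?M"
      by (rule stage_step(1)[OF st h Y])
    have "?h \<notin> G" using stage_step(2)[OF st h Y] P False by blast
    then have "card (insert ?h G) = Suc (card G)" using fin by simp
    \<comment> \<open>Independent gradients number at most the dimension, so the induction measure
      really drops.\<close>
    moreover have "card (insert ?h G) \<le> DIM('a)"
    proof -
      obtain y where "y \<in> ?M" using P False by blast
      then have "inj_on (\<lambda>g. grad g y) (insert ?h G)" "independent ((\<lambda>g. grad g y) ` insert ?h G)"
        using st' unfolding stage_def by blast+
      then show ?thesis using independent_bound[of "(\<lambda>g. grad g y) ` insert ?h G"] card_image by metis
    qed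
    ultimately have less: "DIM('a) - card (insert ?h G) < DIM('a) - card G" by linarith
    \<comment> \<open>A cut field is pointwise a combination of two old fields, so points critical
      for the old fields stay critical.\<close>
    have "dv X f y = 0" if y: "y \<in> P w Y" and X: "X \<in> cut ?h Y ` XS" for y X
    proof -
      obtain X' where X': "X' \<in> XS" "X = cut ?h Y X'" using X by blast
      then show ?thesis
        using crit[of y X'] crit[of y Y] y Y
        by (simp add: dv_def cut_def inner_diff_left P_def)
    qed
    then show ?thesis using less.hyps[OF less st' f P] by blast
  qed simp
  have sub: "C \<subseteq> C0 \<union> (\<Union>w\<in>ws. \<Union>Y\<in>XS. P w Y)"
  proof
    fix y assume y: "y \<in> C"
    show "y \<in> C0 \<union> (\<Union>w\<in>ws. \<Union>Y\<in>XS. P w Y)"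
    proof (rule ccontr)
      assume neg: "y \<notin> C0 \<union> (\<Union>w\<in>ws. \<Union>Y\<in>XS. P w Y)"
      have "dvs w f y = 0" if "w \<noteq> []" "set w \<subseteq> XS" "length w < ?m" for w
        using that
      proof (induction w)
        case (Cons Y w)
        show ?case
        proof (cases "w = []")
          case True
          then show ?thesis using crit[OF y, of Y] Cons.prems by simp
        next
          case False
          then have "dvs w f y = 0" using Cons by auto
          moreover have "w \<in> ws" "Y \<in> XS" using Cons.prems by (auto simp: ws_def)
          ultimately show ?thesis using neg y by (auto simp: P_def)
        qed
      qed simp
      then show False using neg y by (auto simp: C0_def)
    qed
  qed
  have "\<exists>U. open U \<and> z \<in> U \<and> negligible (f ` (C0 \<inter> U))" if z: "z \<in> M" for z
  proof -
    obtain U K where U: "open U" "z \<in> U"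
      and hoel: "\<And>y y'. y \<in> M \<inter> U \<Longrightarrow> y' \<in> M \<inter> U \<Longrightarrow>
       (\<And>w. w \<noteq> [] \<Longrightarrow> set w \<subseteq> XS \<Longrightarrow> length w < ?m \<Longrightarrow> dvs w f y = 0) \<Longrightarrow>
       \<bar>f y' - f y\<bar> \<le> K * norm (y' - y) ^ ?m"
      using stage_flat[OF st z f, of ?m] by blast
    have "negligible (f ` (C0 \<inter> (U \<inter> ball z 1)))"
    proof (rule negligible_hoelder_image)
      show "bounded (C0 \<inter> (U \<inter> ball z 1))" by (meson bounded_ball bounded_subset inf_le2)
      fix y y' assume "y \<in> C0 \<inter> (U \<inter> ball z 1)" "y' \<in> C0 \<inter> (U \<inter> ball z 1)"
      then show "\<bar>f y' - f y\<bar> \<le> K * norm (y' - y) ^ Suc DIM('a)"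
        using C by (intro hoel) (auto simp: C0_def)
    qed
    then show ?thesis using U by (intro exI[of _ "U \<inter> ball z 1"]) auto
  qed
  \<comment> \<open>The flatness estimate is local; countably many of these neighbourhoods cover
    \<open>M\<close>.\<close>
  then obtain U where U: "\<And>z. z \<in> M \<Longrightarrow> open (U z) \<and> z \<in> U z \<and> negligible (f ` (C0 \<inter> U z))"
    by metis
  obtain \<F> where F: "\<F> \<subseteq> U ` M" "countable \<F>" "\<Union>\<F> = \<Union>(U ` M)"
    using Lindelof[of "U ` M"] U by blast
  have "f ` C0 \<subseteq> (\<Union>u\<in>\<F>. f ` (C0 \<inter> u))"
  proof clarify
    fix y assume "y \<in> C0"
    then have "y \<in> \<Union>\<F>" using U C F(3) by (auto simp: C0_def)
    then show "f y \<in> (\<Union>u\<in>\<F>. f ` (C0 \<inter> u))" using \<open>y \<in> C0\<close> by blast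
  qed
  moreover have "negligible (\<Union>u\<in>\<F>. f ` (C0 \<inter> u))"
  proof (intro negligible_countable_Union countable_image F(2))
    fix S assume "S \<in> (\<lambda>u. f ` (C0 \<inter> u)) ` \<F>"
    then show "negligible S" using F(1) U by blast
  qed
  ultimately have "negligible (f ` C0)" using negligible_subset by blast
  moreover have "negligible (\<Union>w\<in>ws. \<Union>Y\<in>XS. f ` P w Y)"
  proof (intro negligible_Union finite_imageI finws)
    fix S assume "S \<in> (\<lambda>w. \<Union>Y\<in>XS. f ` P w Y) ` ws"
    then obtain w where w: "w \<in> ws" "S = (\<Union>Y\<in>XS. f ` P w Y)" by blast
    show "negligible S"
      unfolding w(2) using negP[OF w(1)] by (intro negligible_Union finite_imageI fin) auto
  qed
  ultimately have "negligible (f ` C0 \<union> (\<Union>w\<in>ws. \<Union>Y\<in>XS. f ` P w Y))" by (rule negligible_Un)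
  moreover have "f ` C \<subseteq> f ` C0 \<union> (\<Union>w\<in>ws. \<Union>Y\<in>XS. f ` P w Y)" using image_mono[OF sub, of f] by (simp add: image_Un image_UN)
  ultimately show ?case by (rule negligible_subset)
qed

text \<open>The whole space is a stage with no equation and the coordinate fields, along which all
  derivatives of \<open>f\<close> vanish at its critical points.\<close>

theorem sard: assumes "f \<in> R" shows "negligible (f ` {y. grad f y = 0})"
proof (rule negligible_critical_values_stage[of "{}" "(\<lambda>b _. b) ` Basis" UNIV UNIV])
  show "stage {} ((\<lambda>b _. b) ` Basis) UNIV UNIV"
  proof -
    have "(\<lambda>X. X y) ` (\<lambda>b _. b) ` (Basis::'a set) = Basis" for y :: 'a by force
    then show ?thesis by (auto simp: stage_def fields_def basis span_Basis independent_empty)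
  qed
qed (use assms in \<open>auto simp: dv_def\<close>)

end

section \<open>Gaussian potentials\<close>

lemma gauss_eq: "gauss z = gauss (0 :: real ^ 'd) * exp (- (norm z)\<^sup>2 / 2)"
  for z :: "real ^ 'd"
  by (simp add: gauss_def)

lemma gauss_pos [simp]: "gauss z > 0" "gauss z \<ge> 0" "gauss z \<noteq> 0"
proof -
  show *: "gauss z > 0" by (simp add: gauss_def)
  then show "gauss z \<ge> 0" "gauss z \<noteq> 0" by auto
qed

lemma gauss_le_0: "gauss z \<le> gauss (0 :: real ^ 'd)" for z :: "real ^ 'd"
  unfolding gauss_eq[of z] by (rule mult_left_le) auto

lemma gauss_0_le_1: "gauss (0 :: real ^ 'd) \<le> 1"
proof -
  have "1 \<le> 2 * pi" using pi_ge_two by linarith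
  then have "(2 * pi) powr (- real CARD('d) / 2) \<le> (2 * pi) powr 0"
    by (intro powr_mono) auto
  then show ?thesis by (simp add: gauss_def)
qed

lemma gauss_le_1: "gauss z \<le> 1"
  using gauss_le_0 gauss_0_le_1 order_trans by blast

lemma gauss_minus_commute: "gauss (u - v) = gauss (v - u)"
  by (simp add: gauss_def norm_minus_commute)

lemma gauss_add: "gauss (z + v) = gauss z * exp (- (z \<bullet> v) - (norm v)\<^sup>2 / 2)"
proof -
  have "- (norm (z + v))\<^sup>2 / 2 = - (norm z)\<^sup>2 / 2 + (- (z \<bullet> v) - (norm v)\<^sup>2 / 2)"
    by (simp add: power2_norm_eq_inner inner_add_left inner_add_right inner_commute field_simps)
  then show ?thesis
    unfolding gauss_eq[of "z + v"] gauss_eq[of z] by (simp only: exp_add mult.assoc)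
qed

lemma continuous_gauss: "continuous_on S f \<Longrightarrow> continuous_on S (\<lambda>y. gauss (f y))"
  unfolding gauss_def by (intro continuous_intros) auto

text \<open>Crude decay that serves twice: it bounds the force everywhere, and it makes superlevel
  sets of potentials bounded.\<close>

lemma gauss_norm_le: "gauss z * norm z \<le> 1"
proof -
  have "norm z \<le> 1 + (norm z)\<^sup>2 / 2"
    using zero_le_power2[of "norm z - 1"] by (simp add: power2_eq_square algebra_simps)
  also have "\<dots> \<le> exp ((norm z)\<^sup>2 / 2)" by (rule exp_ge_add_one_self)
  finally have "gauss z * norm z \<le> gauss z * exp ((norm z)\<^sup>2 / 2)" by (intro mult_left_mono) auto
  also have "\<dots> = gauss (0 :: real ^ 'a)" unfolding gauss_eq[of z] by (simp add: exp_minus field_simps)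
  also have "\<dots> \<le> 1" by (rule gauss_0_le_1)
  finally show ?thesis .
qed

text \<open>The weights \<open>a\<close> are kept apart from the measure, because growth uses the
  likelihoods before the Fisher-Rao part and motion those after it, and both are compared with the
  likelihoods of the limit. For \<open>a = lik x \<rho>\<close> this is minus the first
  variation.\<close>

definition potential :: "nat \<Rightarrow> (nat \<Rightarrow> real ^ 'd) \<Rightarrow> (nat \<Rightarrow> real) \<Rightarrow> real ^ 'd \<Rightarrow> real" where
  "potential N x a y = (1 / real N) * (\<Sum>i=1..N. gauss (y - x i) / a i)"

definition force :: "nat \<Rightarrow> (nat \<Rightarrow> real ^ 'd) \<Rightarrow> (nat \<Rightarrow> real) \<Rightarrow> real ^ 'd \<Rightarrow> real ^ 'd" where
  "force N x a y = (1 / real N) *\<^sub>R (\<Sum>i=1..N. (gauss (y - x i) / a i) *\<^sub>R (x i - y))"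

lemma continuous_potential: "continuous_on S f \<Longrightarrow> continuous_on S (\<lambda>y. potential N x a (f y))"
  unfolding potential_def divide_inverse by (intro continuous_intros continuous_gauss)

lemma continuous_force: "continuous_on S f \<Longrightarrow> continuous_on S (\<lambda>y. force N x a (f y))"
  unfolding force_def divide_inverse by (intro continuous_intros continuous_gauss)

lemma potential_measurable [measurable]: "potential N x a \<in> borel_measurable borel"
  by (intro borel_measurable_continuous_onI continuous_potential continuous_intros)

lemma force_measurable [measurable]: "force N x a \<in> borel_measurable borel"
  by (intro borel_measurable_continuous_onI continuous_force continuous_intros)

lemma gauss_measurable [measurable]: "gauss \<in> borel_measurable borel"
  by (intro borel_measurable_continuous_onI continuous_gauss continuous_intros)

lemma GDERIV_gauss: "GDERIV (\<lambda>y. gauss (y - p)) y :> gauss (y - p) *\<^sub>R (p - y)"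
  for p :: "real ^ 'd"
proof -
  define c where "c = gauss (0 :: real ^ 'd)"
  have g: "gauss (y - p) = c * exp (- ((y - p) \<bullet> (y - p)) / 2)" for y
    unfolding c_def power2_norm_eq_inner[symmetric] by (rule gauss_eq)
  have "((\<lambda>y. c * exp (- ((y - p) \<bullet> (y - p)) / 2)) has_derivative
     (\<lambda>h. c * (exp (- ((y - p) \<bullet> (y - p)) / 2) * (- (2 * (h \<bullet> (y - p))) / 2)))) (at y)"
    by (auto intro!: derivative_eq_intros simp: inner_commute fun_eq_iff)
  moreover have "(\<lambda>h. c * (exp (- ((y - p) \<bullet> (y - p)) / 2) * (- (2 * (h \<bullet> (y - p))) / 2)))
      = (\<lambda>h. h \<bullet> (gauss (y - p) *\<^sub>R (p - y)))"
    unfolding g minus_diff_eq[of y p, symmetric] inner_scaleR_right inner_minus_right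
    by (simp add: fun_eq_iff)
  ultimately show ?thesis unfolding gderiv_def g by (simp only:)
qed

lemma GDERIV_unique: assumes "GDERIV f y :> D" "GDERIV f y :> D'" shows "D = D'"
proof -
  have "(\<lambda>h. h \<bullet> D) = (\<lambda>h. h \<bullet> D')"
    using assms unfolding gderiv_def by (rule has_derivative_unique)
  then show ?thesis by (metis vector_eq_ldot)
qed

lemma gradient_eqI: "GDERIV f y :> D \<Longrightarrow> gradient f y = D"
  unfolding gradient_def by (rule the_equality) (auto intro: GDERIV_unique)

lemma GDERIV_sum: "(\<And>i. i \<in> A \<Longrightarrow> GDERIV (f i) y :> D i) \<Longrightarrow>
    GDERIV (\<lambda>y. \<Sum>i\<in>A. f i y) y :> (\<Sum>i\<in>A. D i)"
  unfolding gderiv_def inner_sum_right by (rule has_derivative_sum)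

lemma GDERIV_cmult: assumes "GDERIV f y :> D" shows "GDERIV (\<lambda>y. c * f y) y :> c *\<^sub>R D"
  using GDERIV_mult[OF GDERIV_const assms, of c] by simp

lemma GDERIV_potential: "GDERIV (potential N x a) y :> force N x a y"
proof -
  have "GDERIV (\<lambda>y. (1 / real N) * (\<Sum>i=1..N. (1 / a i) * gauss (y - x i))) y :>
     (1 / real N) *\<^sub>R (\<Sum>i=1..N. (1 / a i) *\<^sub>R (gauss (y - x i) *\<^sub>R (x i - y)))"
    by (intro GDERIV_cmult GDERIV_sum GDERIV_gauss)
  then show ?thesis by (simp add: potential_def[abs_def] force_def)
qed

text \<open>Polynomials in the coordinates and in translated Gaussians. The coordinates come in
  because the gradient of \<open>gauss (y - p)\<close> carries the factor
  \<open>p - y\<close>.\<close>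

inductive_set gpoly :: "(real ^ 'd \<Rightarrow> real) set" where
  const: "(\<lambda>_. c) \<in> gpoly"
| coord: "(\<lambda>y. y \<bullet> b) \<in> gpoly"
| gauss: "(\<lambda>y. gauss (y - p)) \<in> gpoly"
| add: "f \<in> gpoly \<Longrightarrow> g \<in> gpoly \<Longrightarrow> (\<lambda>y. f y + g y) \<in> gpoly"
| mult: "f \<in> gpoly \<Longrightarrow> g \<in> gpoly \<Longrightarrow> (\<lambda>y. f y * g y) \<in> gpoly"

lemma gpoly_diff: assumes "f \<in> gpoly" "g \<in> gpoly" shows "(\<lambda>y. f y - g y) \<in> gpoly"
  using gpoly.add[OF assms(1) gpoly.mult[OF gpoly.const[of "-1"] assms(2)]] by simp

lemma gpoly_sum: "finite A \<Longrightarrow> (\<And>i. i \<in> A \<Longrightarrow> f i \<in> gpoly) \<Longrightarrow> (\<lambda>y. \<Sum>i\<in>A. f i y) \<in> gpoly"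
  by (induction A rule: finite_induct) (auto intro: gpoly.intros)

lemma gpoly_GDERIV:
  assumes "f \<in> gpoly"
  shows "\<exists>D. (\<forall>y. GDERIV f y :> D y) \<and> (\<forall>b. (\<lambda>y. D y \<bullet> b) \<in> gpoly)"
  using assms
proof induction
  case (const c)
  show ?case by (intro exI[of _ "\<lambda>_. 0"]) (auto simp: GDERIV_const gpoly.const)
next
  case (coord b)
  have "GDERIV (\<lambda>y. y \<bullet> b) y :> b" for y
    unfolding gderiv_def by (intro bounded_linear_imp_has_derivative bounded_linear_inner_left)
  then show ?case by (intro exI[of _ "\<lambda>_. b"]) (auto simp: gpoly.const)
next
  case (gauss p)
  have "(\<lambda>y. gauss (y - p) * (p \<bullet> b - y \<bullet> b)) \<in> gpoly" for b
    by (intro gpoly.mult gpoly_diff gpoly.intros)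
  then show ?case
    by (intro exI[of _ "\<lambda>y. gauss (y - p) *\<^sub>R (p - y)"]) (auto simp: GDERIV_gauss inner_diff_left)
next
  case (add f g)
  then obtain D E where "\<And>y. GDERIV f y :> D y" "\<And>b. (\<lambda>y. D y \<bullet> b) \<in> gpoly"
    "\<And>y. GDERIV g y :> E y" "\<And>b. (\<lambda>y. E y \<bullet> b) \<in> gpoly" by metis
  then show ?case
    by (intro exI[of _ "\<lambda>y. D y + E y"]) (auto simp: inner_add_left intro: GDERIV_add gpoly.add)
next
  case (mult f g)
  then obtain D E where "\<And>y. GDERIV f y :> D y" "\<And>b. (\<lambda>y. D y \<bullet> b) \<in> gpoly"
    "\<And>y. GDERIV g y :> E y" "\<And>b. (\<lambda>y. E y \<bullet> b) \<in> gpoly" by metis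
  then show ?case using mult.hyps
    by (intro exI[of _ "\<lambda>y. f y *\<^sub>R E y + g y *\<^sub>R D y"])
       (auto simp: inner_add_left intro!: GDERIV_mult gpoly.add gpoly.mult[of f] gpoly.mult[of g])
qed

interpretation gpoly_algebra: smooth_algebra gpoly gradient
proof
  fix f :: "real ^ 'd \<Rightarrow> real" and b y assume f: "f \<in> gpoly"
  obtain D where D: "\<And>y. GDERIV f y :> D y" "\<And>b. (\<lambda>y. D y \<bullet> b) \<in> gpoly"
    using gpoly_GDERIV[OF f] by blast
  have "gradient f = D" using D(1) by (auto intro: gradient_eqI)
  then show "(f has_derivative (\<lambda>h. h \<bullet> gradient f y)) (at y)" "(\<lambda>y. gradient f y \<bullet> b) \<in> gpoly"
    using D by (simp_all add: gderiv_def)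
qed (simp_all add: gpoly.intros gpoly_diff)

text \<open>Critical values form a null set by Sard's theorem and cannot fill an interval.\<close>

lemma potential_regular_value:
  assumes "c1 < c2"
  obtains c where "c1 < c" "c < c2" "\<And>y. potential N x a y = c \<Longrightarrow> force N x a y \<noteq> 0"
proof -
  have "(\<lambda>y. (1 / real N) * (\<Sum>i=1..N. gauss (y - x i) * (1 / a i))) \<in> gpoly"
    by (intro gpoly.mult gpoly_sum gpoly.const gpoly.gauss) auto
  then have "potential N x a \<in> gpoly" by (simp add: potential_def[abs_def])
  then have "negligible (potential N x a ` {y. gradient (potential N x a) y = 0})"
    by (rule gpoly_algebra.sard)
  moreover have "gradient (potential N x a) = force N x a"
    by (rule ext) (rule gradient_eqI[OF GDERIV_potential])
  ultimately have "negligible (potential N x a ` {y. force N x a y = 0})" by simp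
  moreover have "\<not> negligible {c1<..<c2}" using assms negligible_interval(2)[of c1 c2] by (simp add: box_real)
  ultimately have "\<not> {c1<..<c2} \<subseteq> potential N x a ` {y. force N x a y = 0}"
    using negligible_subset by blast
  then show ?thesis using that by (auto simp: subset_iff image_iff)
qed

text \<open>\<open>gauss (z + v) = gauss z * exp (- z \<bullet> v - |v|\<^sup>2/2)\<close> and \<open>exp t \<ge> 1 + t\<close> give a lower
  second-order bound whose curvature is the potential itself.\<close>

lemma potential_add_ge:
  assumes "\<And>i. i \<in> {1..N} \<Longrightarrow> a i > 0"
  shows "potential N x a (y + v) \<ge>
    potential N x a y + force N x a y \<bullet> v - potential N x a y * (norm v)\<^sup>2 / 2"
proof -
  have "(gauss (y - x i) / a i) * (1 + (x i - y) \<bullet> v - (norm v)\<^sup>2 / 2) \<le> gauss (y + v - x i) / a i"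
    if "i \<in> {1..N}" for i
  proof -
    have eq: "y + v - x i = (y - x i) + v" by simp
    have "1 + (x i - y) \<bullet> v - (norm v)\<^sup>2 / 2 \<le> exp (- ((y - x i) \<bullet> v) - (norm v)\<^sup>2 / 2)"
      using exp_ge_add_one_self[of "- ((y - x i) \<bullet> v) - (norm v)\<^sup>2 / 2"]
        inner_minus_left[of "y - x i" v] unfolding minus_diff_eq by linarith
    then have "gauss (y - x i) / a i * (1 + (x i - y) \<bullet> v - (norm v)\<^sup>2 / 2)
       \<le> gauss (y - x i) / a i * exp (- ((y - x i) \<bullet> v) - (norm v)\<^sup>2 / 2)"
      using assms[OF that] by (intro mult_left_mono) auto
    then show ?thesis by (simp add: eq gauss_add)
  qed
  then have "(1 / real N) * (\<Sum>i=1..N. (gauss (y - x i) / a i) * (1 + (x i - y) \<bullet> v - (norm v)\<^sup>2 / 2))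
     \<le> potential N x a (y + v)"
    unfolding potential_def by (intro mult_left_mono sum_mono) auto
  moreover have "(1 / real N) * (\<Sum>i=1..N. (gauss (y - x i) / a i) * (1 + (x i - y) \<bullet> v - (norm v)\<^sup>2 / 2))
    = potential N x a y + force N x a y \<bullet> v - potential N x a y * (norm v)\<^sup>2 / 2"
  proof -
    define S where "S = (\<Sum>i=1..N. gauss (y - x i) / a i)"
    define F where "F = (\<Sum>i=1..N. (gauss (y - x i) / a i) * ((x i - y) \<bullet> v))"
    have "(\<Sum>i=1..N. (gauss (y - x i) / a i) * (1 + (x i - y) \<bullet> v - (norm v)\<^sup>2 / 2))
        = S + F - S * ((norm v)\<^sup>2 / 2)"
      unfolding S_def F_def right_diff_distrib distrib_left sum.distrib sum_subtractf sum_distrib_right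
      by simp
    moreover have "force N x a y \<bullet> v = (1 / real N) * F"
      by (simp add: force_def F_def inner_sum_left)
    moreover have "potential N x a y = (1 / real N) * S" by (simp add: potential_def S_def)
    ultimately show ?thesis by (simp only: right_diff_distrib distrib_left times_divide_eq_right mult.assoc)
  qed
  ultimately show ?thesis by simp
qed

lemma potential_nonneg:
  assumes "\<And>i. i \<in> {1..N} \<Longrightarrow> a i > 0" shows "potential N x a y \<ge> 0"
proof -
  have "gauss (y - x i) / a i \<ge> 0" if "i \<in> {1..N}" for i using assms[OF that] by simp
  then show ?thesis unfolding potential_def by (intro mult_nonneg_nonneg sum_nonneg) auto
qed

lemma potential_le:
  fixes x :: "nat \<Rightarrow> real ^ 'd"
  assumes "N \<ge> 1" "\<And>i. i \<in> {1..N} \<Longrightarrow> a i \<ge> \<alpha>" "\<alpha> > 0"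
  shows "potential N x a y \<le> gauss (0 :: real ^ 'd) / \<alpha>"
proof -
  have "(\<Sum>i=1..N. gauss (y - x i) / a i) \<le> (\<Sum>i=1..N. gauss (0 :: real ^ 'd) / \<alpha>)"
    using assms gauss_le_0 by (intro sum_mono frac_le) auto
  then show ?thesis using assms by (simp add: potential_def field_simps)
qed

text \<open>Weights enter through their reciprocals. As \<open>gauss z\<close> and
  \<open>gauss z * norm z\<close> are at most 1, this one number bounds the difference of two
  potentials and of two forces at every point.\<close>

definition wdist :: "nat \<Rightarrow> (nat \<Rightarrow> real) \<Rightarrow> (nat \<Rightarrow> real) \<Rightarrow> real" where
  "wdist N a b = (1 / real N) * (\<Sum>i=1..N. \<bar>1 / a i - 1 / b i\<bar>)"

lemma potential_wdist: "\<bar>potential N x a y - potential N x b y\<bar> \<le> wdist N a b"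
proof -
  have "\<bar>\<Sum>i=1..N. gauss (y - x i) * (1 / a i - 1 / b i)\<bar> \<le> (\<Sum>i=1..N. \<bar>gauss (y - x i) * (1 / a i - 1 / b i)\<bar>)"
    by (rule sum_abs)
  also have "\<dots> \<le> (\<Sum>i=1..N. \<bar>1 / a i - 1 / b i\<bar>)"
    by (intro sum_mono) (simp add: abs_mult mult_left_le_one_le gauss_le_1)
  finally show ?thesis
    unfolding potential_def wdist_def right_diff_distrib[symmetric] sum_subtractf[symmetric] abs_mult
    by (intro mult_mono) (auto simp: algebra_simps)
qed

lemma force_wdist: "norm (force N x a y - force N x b y) \<le> wdist N a b"
proof -
  have "norm (\<Sum>i=1..N. (gauss (y - x i) * (1 / a i - 1 / b i)) *\<^sub>R (x i - y))
     \<le> (\<Sum>i=1..N. norm ((gauss (y - x i) * (1 / a i - 1 / b i)) *\<^sub>R (x i - y)))"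
    by (rule norm_sum)
  also have "\<dots> \<le> (\<Sum>i=1..N. \<bar>1 / a i - 1 / b i\<bar>)"
  proof (rule sum_mono)
    fix i
    show "norm ((gauss (y - x i) * (1 / a i - 1 / b i)) *\<^sub>R (x i - y)) \<le> \<bar>1 / a i - 1 / b i\<bar>"
      using mult_right_mono[OF gauss_norm_le[of "y - x i"], of "\<bar>1 / a i - 1 / b i\<bar>"]
      by (simp add: abs_mult norm_minus_commute mult_ac)
  qed
  finally show ?thesis
    unfolding force_def wdist_def scaleR_diff_right[symmetric] sum_subtractf[symmetric] norm_scaleR
    by (intro mult_mono) (auto simp: algebra_simps)
qed

lemma norm_force_le:
  assumes "\<And>i. i \<in> {1..N} \<Longrightarrow> a i > 0"
  shows "norm (force N x a y) \<le> (1 / real N) * (\<Sum>i=1..N. 1 / a i)"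
proof -
  have "norm (force N x a y) \<le> (1 / real N) * (\<Sum>i=1..N. norm ((gauss (y - x i) / a i) *\<^sub>R (x i - y)))"
  proof -
    have "norm (force N x a y) = (1 / real N) * norm (\<Sum>i=1..N. (gauss (y - x i) / a i) *\<^sub>R (x i - y))"
      by (simp add: force_def)
    then show ?thesis by (simp only: mult_left_mono[OF norm_sum] zero_le_divide_1_iff of_nat_0_le_iff)
  qed
  also have "\<dots> \<le> (1 / real N) * (\<Sum>i=1..N. 1 / a i)"
  proof (intro mult_left_mono sum_mono)
    fix i assume "i \<in> {1..N}"
    then show "norm ((gauss (y - x i) / a i) *\<^sub>R (x i - y)) \<le> 1 / a i"
      using divide_right_mono[OF gauss_norm_le[of "y - x i"], of "a i"] assms[of i]
      by (simp add: norm_minus_commute)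
  qed auto
  finally show ?thesis .
qed

section \<open>The descent steps\<close>

definition lik :: "(nat \<Rightarrow> real ^ 'd) \<Rightarrow> (real ^ 'd) measure \<Rightarrow> nat \<Rightarrow> real" where
  "lik x \<rho> i = gauss_conv \<rho> (x i)"

lemma prob_measuresD:
  assumes "\<rho> \<in> prob_measures"
  shows "prob_space \<rho>" "sets \<rho> = sets borel" "space \<rho> = UNIV"
  using assms by (auto simp: space_prob_algebra dest: sets_eq_imp_space_eq)

lemma prob_measuresI: "prob_space \<rho> \<Longrightarrow> sets \<rho> = sets borel \<Longrightarrow> \<rho> \<in> prob_measures"
  by (simp add: space_prob_algebra)

lemma measurable_prob_measures:
  assumes "\<rho> \<in> prob_measures"
  shows "borel_measurable \<rho> = borel_measurable borel"
  using prob_measuresD[OF assms] by (intro measurable_cong_sets) auto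

lemma integrable_bounded_prob:
  fixes f :: "'a::topological_space \<Rightarrow> real"
  assumes "\<rho> \<in> prob_measures" "f \<in> borel_measurable borel" "\<And>y. \<bar>f y\<bar> \<le> B"
  shows "integrable \<rho> f"
proof -
  interpret prob_space \<rho> using assms prob_measuresD by blast
  show ?thesis
    using assms by (intro integrable_const_bound[where B=B]) (auto simp: measurable_prob_measures)
qed

lemma integrable_gauss: 
  assumes "\<rho> \<in> prob_measures" shows "integrable \<rho> (\<lambda>y. gauss (y - p))"
  using assms by (rule integrable_bounded_prob[where B=1]) (auto simp: gauss_le_1)

lemma lik_eq: "lik x \<rho> i = (\<integral>y. gauss (y - x i) \<partial>\<rho>)"
  by (simp add: lik_def gauss_conv_def gauss_minus_commute[of "x i"])

lemma lik_pos: assumes "\<rho> \<in> prob_measures" shows "lik x \<rho> i > 0"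
proof -
  interpret prob_space \<rho> using assms prob_measuresD by blast
  have "lik x \<rho> i > (\<integral>y. 0 \<partial>\<rho>)"
    unfolding lik_eq using integrable_gauss[OF assms] assms
    by (intro integral_less_AE_space) (auto simp: emeasure_space_1)
  then show ?thesis by simp
qed

lemma integrable_potential:
  assumes "\<rho> \<in> prob_measures" shows "integrable \<rho> (potential N x a)"
  unfolding potential_def[abs_def] using integrable_gauss[OF assms]
  by (intro integrable_mult_right Bochner_Integration.integrable_sum integrable_divide) auto

lemma integral_potential:
  assumes "\<rho> \<in> prob_measures"
  shows "(\<integral>y. potential N x a y \<partial>\<rho>) = (1 / real N) * (\<Sum>i=1..N. lik x \<rho> i / a i)"
  unfolding potential_def lik_eq using integrable_gauss[OF assms]
  by (subst integral_mult_right_zero) (simp add: Bochner_Integration.integral_sum)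

lemma integral_potential_lik:
  assumes "\<rho> \<in> prob_measures" "N \<ge> 1"
  shows "(\<integral>y. potential N x (lik x \<rho>) y \<partial>\<rho>) = 1"
  using assms lik_pos[OF assms(1), of x] by (subst integral_potential) (auto simp: less_imp_neq[symmetric])

lemma first_variation_eq: "first_variation N x \<rho> y = - potential N x (lik x \<rho>) y"
  by (simp add: first_variation_def potential_def lik_def)

definition growth :: "nat \<Rightarrow> (nat \<Rightarrow> real ^ 'd) \<Rightarrow> real \<Rightarrow> (real ^ 'd) measure \<Rightarrow> real ^ 'd \<Rightarrow> real" where
  "growth N x \<eta> \<rho> y = 1 - \<eta> + \<eta> * potential N x (lik x \<rho>) y"

definition move :: "nat \<Rightarrow> (nat \<Rightarrow> real ^ 'd) \<Rightarrow> real \<Rightarrow> (real ^ 'd) measure \<Rightarrow> real ^ 'd \<Rightarrow> real ^ 'd" where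
  "move N x \<eta> \<rho> y = y + \<eta> *\<^sub>R force N x (lik x \<rho>) y"

lemma continuous_growth: "continuous_on S f \<Longrightarrow> continuous_on S (\<lambda>y. growth N x \<eta> \<rho> (f y))"
  unfolding growth_def by (intro continuous_intros continuous_potential)

lemma continuous_move: "continuous_on S f \<Longrightarrow> continuous_on S (\<lambda>y. move N x \<eta> \<rho> (f y))"
  unfolding move_def by (intro continuous_intros continuous_force)

lemma growth_measurable [measurable]: "growth N x \<eta> \<rho> \<in> borel_measurable borel"
  by (intro borel_measurable_continuous_onI continuous_growth continuous_intros)

lemma move_measurable [measurable]: "move N x \<eta> \<rho> \<in> borel_measurable borel"
  by (intro borel_measurable_continuous_onI continuous_move continuous_intros)

lemma fisher_rao_step_eq: "fisher_rao_step N x \<eta> \<rho> = density \<rho> (\<lambda>y. ennreal (growth N x \<eta> \<rho> y))"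
  by (simp add: fisher_rao_step_def first_variation_eq growth_def algebra_simps)

lemma wasserstein_step_eq: "wasserstein_step N x \<eta> \<rho> = distr \<rho> borel (move N x \<eta> \<rho>)"
proof -
  have "first_variation N x \<rho> = (\<lambda>y. - potential N x (lik x \<rho>) y)"
    by (auto simp: first_variation_eq)
  then have "gradient (first_variation N x \<rho>) y = - force N x (lik x \<rho>) y" for y
    by (simp only: gradient_eqI[OF GDERIV_minus[OF GDERIV_potential]])
  then show ?thesis by (simp add: wasserstein_step_def move_def[abs_def])
qed

lemma growth_ge:
  assumes "\<rho> \<in> prob_measures" "0 \<le> \<eta>" shows "growth N x \<eta> \<rho> y \<ge> 1 - \<eta>"
  using potential_nonneg[of N "lik x \<rho>" x y] lik_pos[OF assms(1)] assms(2) by (simp add: growth_def)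

lemma growth_bounded:
  assumes "\<rho> \<in> prob_measures" "0 \<le> \<eta>" "\<eta> \<le> 1"
  shows "\<exists>B. \<forall>y. \<bar>growth N x \<eta> \<rho> y\<bar> \<le> B"
proof -
  have p: "potential N x (lik x \<rho>) y \<le> (1 / real N) * (\<Sum>i=1..N. 1 / lik x \<rho> i)" for y
    unfolding potential_def using lik_pos[OF assms(1)] gauss_le_1
    by (intro mult_left_mono sum_mono divide_right_mono) (auto intro: less_imp_le)
  then have "\<bar>growth N x \<eta> \<rho> y\<bar> \<le> 1 - \<eta> + \<eta> * ((1 / real N) * (\<Sum>i=1..N. 1 / lik x \<rho> i))" for y
    using growth_ge[OF assms(1,2), of N x y] assms(3) mult_left_mono[OF p[of y] assms(2)]
    by (simp add: growth_def)
  then show ?thesis by blast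
qed

lemma integral_fisher_rao_step:
  fixes f :: "real ^ 'd \<Rightarrow> real"
  assumes "\<rho> \<in> prob_measures" "0 \<le> \<eta>" "\<eta> \<le> 1" and [measurable]: "f \<in> borel_measurable borel"
  shows "(\<integral>y. f y \<partial>fisher_rao_step N x \<eta> \<rho>) = (\<integral>y. growth N x \<eta> \<rho> y * f y \<partial>\<rho>)"
proof -
  have "growth N x \<eta> \<rho> y \<ge> 0" for y using growth_ge[OF assms(1,2), of N x y] assms by simp
  then show ?thesis
    unfolding fisher_rao_step_eq
    using assms(1) by (subst integral_density) (auto simp: measurable_prob_measures)
qed

lemma fisher_rao_step_prob:
  assumes "\<rho> \<in> prob_measures" "0 \<le> \<eta>" "\<eta> \<le> 1" "N \<ge> 1"
  shows "fisher_rao_step N x \<eta> \<rho> \<in> prob_measures"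
proof (rule prob_measuresI)
  interpret prob_space \<rho> using assms prob_measuresD by blast
  have pos: "growth N x \<eta> \<rho> y \<ge> 0" for y using growth_ge[OF assms(1,2), of N x y] assms by simp
  obtain B where B: "\<And>y. \<bar>growth N x \<eta> \<rho> y\<bar> \<le> B" using growth_bounded[OF assms(1-3)] by blast
  have "emeasure (fisher_rao_step N x \<eta> \<rho>) (space (fisher_rao_step N x \<eta> \<rho>))
      = (\<integral>\<^sup>+y. ennreal (growth N x \<eta> \<rho> y) \<partial>\<rho>)"
    unfolding fisher_rao_step_eq using assms(1)
    by (subst emeasure_density) (auto simp: measurable_prob_measures intro!: nn_integral_cong)
  also have "\<dots> = ennreal (\<integral>y. growth N x \<eta> \<rho> y \<partial>\<rho>)"
    using pos by (intro nn_integral_eq_integral integrable_bounded_prob[OF assms(1) _ B]) auto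
  also have "(\<integral>y. growth N x \<eta> \<rho> y \<partial>\<rho>) = 1"
    unfolding growth_def
    using integral_potential_lik[OF assms(1,4), of x] integrable_potential[OF assms(1)]
    by (simp add: prob_space)
  finally show "prob_space (fisher_rao_step N x \<eta> \<rho>)" by (intro prob_spaceI) simp
  show "sets (fisher_rao_step N x \<eta> \<rho>) = sets borel"
    using prob_measuresD[OF assms(1)] by (simp add: fisher_rao_step_eq)
qed

lemma wasserstein_step_prob:
  assumes "\<rho> \<in> prob_measures" shows "wasserstein_step N x \<eta> \<rho> \<in> prob_measures"
  unfolding wasserstein_step_eq using prob_measuresD[OF assms]
  by (intro prob_measuresI prob_space.prob_space_distr) (auto cong: measurable_cong_sets)

lemma integral_wasserstein_step:
  fixes f :: "real ^ 'd \<Rightarrow> real"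
  assumes "\<rho> \<in> prob_measures" and [measurable]: "f \<in> borel_measurable borel"
  shows "(\<integral>y. f y \<partial>wasserstein_step N x \<eta> \<rho>) = (\<integral>y. f (move N x \<eta> \<rho> y) \<partial>\<rho>)"
  unfolding wasserstein_step_eq using prob_measuresD[OF assms(1)]
  by (subst integral_distr) (auto cong: measurable_cong_sets)

abbreviation wfr_step :: "nat \<Rightarrow> (nat \<Rightarrow> real ^ 'd) \<Rightarrow> real \<Rightarrow> (real ^ 'd) measure \<Rightarrow> (real ^ 'd) measure" where
  "wfr_step N x \<eta> \<rho> \<equiv> wasserstein_step N x \<eta> (fisher_rao_step N x \<eta> \<rho>)"

lemma integral_wfr_step:
  fixes f :: "real ^ 'd \<Rightarrow> real"
  assumes "\<rho> \<in> prob_measures" "0 \<le> \<eta>" "\<eta> \<le> 1" "N \<ge> 1" and [measurable]: "f \<in> borel_measurable borel"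
  shows "(\<integral>y. f y \<partial>wfr_step N x \<eta> \<rho>) =
    (\<integral>y. growth N x \<eta> \<rho> y * f (move N x \<eta> (fisher_rao_step N x \<eta> \<rho>) y) \<partial>\<rho>)"
  using assms by (simp add: integral_wasserstein_step fisher_rao_step_prob integral_fisher_rao_step)

lemma wfr_gd_prob:
  assumes "\<rho>0 \<in> prob_measures" "0 \<le> \<eta>" "\<eta> \<le> 1" "N \<ge> 1"
  shows "wfr_gd N x \<eta> \<rho>0 n \<in> prob_measures"
  by (induction n) (auto intro: assms fisher_rao_step_prob wasserstein_step_prob)

text \<open>Expands into integrals of one or two Gaussians, whose integrands are bounded, continuous
  and independent of \<rho>; so the likelihoods after the Fisher-Rao part converge along a weakly
  convergent sequence too.\<close>

lemma lik_fisher_rao_step: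
  assumes "\<rho> \<in> prob_measures" "0 \<le> \<eta>" "\<eta> \<le> 1"
  shows "lik x (fisher_rao_step N x \<eta> \<rho>) i =
    (1 - \<eta>) * lik x \<rho> i +
    \<eta> * ((1 / real N) * (\<Sum>j=1..N. (\<integral>y. gauss (y - x j) * gauss (y - x i) \<partial>\<rho>) / lik x \<rho> j))"
proof -
  have int: "integrable \<rho> (\<lambda>y. gauss (y - x j) * gauss (y - x i))" for j
    using assms(1) by (rule integrable_bounded_prob[where B=1]) (auto simp: gauss_le_1 mult_le_one abs_mult)
  have "lik x (fisher_rao_step N x \<eta> \<rho>) i = (\<integral>y. growth N x \<eta> \<rho> y * gauss (y - x i) \<partial>\<rho>)"
    unfolding lik_eq using assms by (subst integral_fisher_rao_step) auto
  also have "\<dots> = (\<integral>y. (1 - \<eta>) * gauss (y - x i) +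
      \<eta> * ((1 / real N) * (\<Sum>j=1..N. gauss (y - x j) * gauss (y - x i) / lik x \<rho> j)) \<partial>\<rho>)"
    by (intro Bochner_Integration.integral_cong)
       (auto simp: growth_def potential_def algebra_simps sum_distrib_left)
  also have "\<dots> = (1 - \<eta>) * lik x \<rho> i + \<eta> * ((1 / real N) *
      (\<Sum>j=1..N. (\<integral>y. gauss (y - x j) * gauss (y - x i) \<partial>\<rho>) / lik x \<rho> j))"
    unfolding lik_eq
    using int integrable_gauss[OF assms(1), of "x i"]
    by (subst Bochner_Integration.integral_add)
       (auto simp: Bochner_Integration.integral_sum intro!: integrable_mult_right Bochner_Integration.integrable_sum integrable_divide)
  finally show ?thesis .
qed

lemma lik_fisher_rao_step_ge:
  assumes "\<rho> \<in> prob_measures" "0 \<le> \<eta>" "\<eta> \<le> 1"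
  shows "lik x (fisher_rao_step N x \<eta> \<rho>) i \<ge> (1 - \<eta>) * lik x \<rho> i"
proof -
  have "(\<integral>y. gauss (y - x j) * gauss (y - x i) \<partial>\<rho>) / lik x \<rho> j \<ge> 0" for j
    using lik_pos[OF assms(1), of x j] by (intro divide_nonneg_pos integral_nonneg) auto
  then have "0 \<le> \<eta> * ((1 / real N) * (\<Sum>j=1..N. (\<integral>y. gauss (y - x j) * gauss (y - x i) \<partial>\<rho>) / lik x \<rho> j))"
    using assms(2) by (intro mult_nonneg_nonneg sum_nonneg) auto
  then show ?thesis by (simp add: lik_fisher_rao_step[OF assms])
qed

section \<open>Stationarity of weak limits\<close>

lemma weakly_convergesD:
  fixes f :: "'a::topological_space \<Rightarrow> real"
  assumes "weakly_converges \<rho> \<rho>'" "continuous_on UNIV f" "\<And>y. \<bar>f y\<bar> \<le> B"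
  shows "(\<lambda>n. \<integral>y. f y \<partial>\<rho> n) \<longlonglongrightarrow> (\<integral>y. f y \<partial>\<rho>')"
proof -
  have "bounded (range f)" using assms(3) by (intro boundedI[of _ B]) auto
  then show ?thesis using assms(1,2) unfolding weakly_converges_def by blast
qed

lemma weakly_converges_gauss:
  assumes "weakly_converges \<rho> \<rho>'"
  shows "(\<lambda>n. lik x (\<rho> n) i) \<longlonglongrightarrow> lik x \<rho>' i"
    and "(\<lambda>n. \<integral>y. gauss (y - x j) * gauss (y - x i) \<partial>\<rho> n) \<longlonglongrightarrow> (\<integral>y. gauss (y - x j) * gauss (y - x i) \<partial>\<rho>')"
proof -
  show "(\<lambda>n. lik x (\<rho> n) i) \<longlonglongrightarrow> lik x \<rho>' i"
    unfolding lik_eq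
    by (rule weakly_convergesD[OF assms, where B=1])
       (auto simp: gauss_le_1 intro!: continuous_gauss continuous_intros)
  show "(\<lambda>n. \<integral>y. gauss (y - x j) * gauss (y - x i) \<partial>\<rho> n) \<longlonglongrightarrow> (\<integral>y. gauss (y - x j) * gauss (y - x i) \<partial>\<rho>')"
    by (rule weakly_convergesD[OF assms, where B=1])
       (auto simp: gauss_le_1 abs_mult mult_le_one intro!: continuous_gauss continuous_intros)
qed

lemma lik_fisher_rao_step_tendsto:
  assumes "weakly_converges \<rho> \<rho>'" "\<And>n. \<rho> n \<in> prob_measures" "\<rho>' \<in> prob_measures" "0 \<le> \<eta>" "\<eta> \<le> 1"
  shows "(\<lambda>n. lik x (fisher_rao_step N x \<eta> (\<rho> n)) i) \<longlonglongrightarrow> lik x (fisher_rao_step N x \<eta> \<rho>') i"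
  using assms lik_pos[OF assms(3)] unfolding lik_fisher_rao_step[OF assms(2,4,5)] lik_fisher_rao_step[OF assms(3-5)]
  by (intro tendsto_intros weakly_converges_gauss) (auto simp: less_imp_neq[symmetric])

lemma wdist_tendsto:
  assumes "\<And>i. (\<lambda>n. a n i) \<longlonglongrightarrow> b i" "\<And>i. b i > 0"
  shows "(\<lambda>n. wdist N (a n) b) \<longlonglongrightarrow> 0"
proof -
  have "(\<lambda>n. wdist N (a n) b) \<longlonglongrightarrow> (1 / real N) * (\<Sum>i=1..N. \<bar>1 / b i - 1 / b i\<bar>)"
    unfolding wdist_def using assms
    by (intro tendsto_intros) (auto simp: less_imp_neq[symmetric])
  then show ?thesis by simp
qed

text \<open>Indicators of closed sets are limits of the Lipschitz functions
  \<open>max 0 (1 - real n * infdist y C)\<close>. Lipschitz test functions are wanted in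
  \<open>weak_limit_stationary\<close>, where they are composed with maps that vary with the
  iterate.\<close>

lemma measure_eqI_lipschitz:
  fixes \<mu> \<nu> :: "'a::metric_space measure"
  assumes "\<mu> \<in> prob_measures" "\<nu> \<in> prob_measures"
    and eq: "\<And>f :: 'a \<Rightarrow> real. (\<And>y. 0 \<le> f y \<and> f y \<le> 1) \<Longrightarrow>
      (\<exists>L. \<forall>y z. \<bar>f y - f z\<bar> \<le> L * dist y z) \<Longrightarrow> (\<integral>y. f y \<partial>\<mu>) = (\<integral>y. f y \<partial>\<nu>)"
  shows "\<mu> = \<nu>"
proof -
  interpret \<mu>: prob_space \<mu> using assms prob_measuresD by blast
  interpret \<nu>: prob_space \<nu> using assms prob_measuresD by blast
  have closed: "measure \<mu> C = measure \<nu> C" if "closed C" for C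
  \<comment> \<open>The distance to the empty set is 0 by convention, so \<open>f n\<close> would
    not tend to its indicator.\<close>
  proof (cases "C = {}")
    case False
    define f where "f n y = max 0 (1 - real n * infdist y C)" for n y
    have cont: "continuous_on UNIV (f n)" for n unfolding f_def by (intro continuous_intros)
    then have [measurable]: "f n \<in> borel_measurable borel" for n by (rule borel_measurable_continuous_onI)
    have b: "0 \<le> f n y" "f n y \<le> 1" for n y by (auto simp: f_def infdist_nonneg)
    have "\<bar>f n y - f n z\<bar> \<le> real n * dist y z" for n y z
    proof -
      have "\<bar>infdist y C - infdist z C\<bar> \<le> dist y z"
        using infdist_triangle_abs[of y C z] by simp
      then have "\<bar>real n * infdist y C - real n * infdist z C\<bar> \<le> real n * dist y z"
        by (simp add: mult_left_mono flip: right_diff_distrib add: abs_mult)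
      then show ?thesis unfolding f_def by linarith
    qed
    then have e: "(\<integral>y. f n y \<partial>\<mu>) = (\<integral>y. f n y \<partial>\<nu>)" for n using b by (intro eq) auto
    have lim: "(\<lambda>n. f n y) \<longlonglongrightarrow> indicator C y" for y
    proof (cases "y \<in> C")
      case False
      then have d: "infdist y C > 0"
        using \<open>closed C\<close> \<open>C \<noteq> {}\<close> in_closed_iff_infdist_zero infdist_nonneg by (metis order_less_le)
      have "eventually (\<lambda>n. f n y = 0) sequentially"
        using eventually_ge_at_top[of "nat \<lceil>1 / infdist y C\<rceil>"]
      proof eventually_elim
        case (elim n)
        then have "1 / infdist y C \<le> real n" by linarith
        then have "1 \<le> real n * infdist y C" using d by (simp add: field_simps)
        then show ?case by (simp add: f_def)
      qed
      then show ?thesis using False by (simp add: tendsto_eventually)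
    qed (simp add: f_def)
    have "(\<lambda>n. \<integral>y. f n y \<partial>M) \<longlonglongrightarrow> measure M C" if M: "M \<in> prob_measures" for M
    proof -
      interpret prob_space M using M prob_measuresD by blast
      have "(\<lambda>n. \<integral>y. f n y \<partial>M) \<longlonglongrightarrow> (\<integral>y. indicator C y \<partial>M)"
        using M \<open>closed C\<close> lim b
        by (intro integral_dominated_convergence[where w="\<lambda>_. 1"])
           (auto simp: measurable_prob_measures borel_closed)
      then show ?thesis using M prob_measuresD[OF M] by simp
    qed
    from this[OF assms(1)] this[OF assms(2)] show ?thesis
      unfolding e by (rule LIMSEQ_unique)
  qed simp
  have borel: "sets (borel :: 'a measure) = sigma_sets UNIV (Collect closed)"
    by (subst borel_eq_closed) (simp add: sets_measure_of)
  show ?thesis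
  proof (rule measure_eqI_generator_eq[where E="Collect closed" and \<Omega>=UNIV and A="\<lambda>_. UNIV"])
    show "Int_stable (Collect (closed :: 'a set \<Rightarrow> bool))" by (auto simp: Int_stable_def)
    show "sets \<mu> = sigma_sets UNIV (Collect closed)" "sets \<nu> = sigma_sets UNIV (Collect closed)"
      using prob_measuresD(2)[OF assms(1)] prob_measuresD(2)[OF assms(2)] borel by simp_all
    show "emeasure \<mu> X = emeasure \<nu> X" if "X \<in> Collect closed" for X
      using closed that by (auto simp: \<mu>.emeasure_eq_measure \<nu>.emeasure_eq_measure)
  qed (auto simp: \<mu>.emeasure_eq_measure)
qed

text \<open>An integral against the next iterate is the integral of \<open>F r\<close>, growth times
  the test function after the move, against the current one. \<open>F\<close> at the iterates
  converges uniformly to \<open>F \<rho>\<close>, which is bounded and continuous, so the varying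
  integrand and the varying measure can be treated one after the other.\<close>

lemma weak_limit_stationary:
  assumes conv: "weakly_converges (wfr_gd N x \<eta> \<rho>0) \<rho>" and "\<rho>0 \<in> prob_measures" and \<rho>: "\<rho> \<in> prob_measures"
    and \<eta>: "0 \<le> \<eta>" "\<eta> \<le> 1" and N: "N \<ge> 1"
  shows "wfr_step N x \<eta> \<rho> = \<rho>"
proof (rule measure_eqI_lipschitz)
  let ?r = "wfr_gd N x \<eta> \<rho>0"
  have r: "?r n \<in> prob_measures" for n using assms by (intro wfr_gd_prob)
  show "wfr_step N x \<eta> \<rho> \<in> prob_measures"
    using assms by (intro wasserstein_step_prob fisher_rao_step_prob)
  show "\<rho> \<in> prob_measures" by fact
  fix f :: "real ^ 'a \<Rightarrow> real"
  assume b: "\<And>y. 0 \<le> f y \<and> f y \<le> 1" and "\<exists>L. \<forall>y z. \<bar>f y - f z\<bar> \<le> L * dist y z"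
  then obtain L0 where L0: "\<And>y z. \<bar>f y - f z\<bar> \<le> L0 * dist y z" by blast
  define L where "L = max L0 0"
  have L: "\<bar>f y - f z\<bar> \<le> L * dist y z" "L \<ge> 0" for y z
    using L0[of y z] mult_right_mono[of L0 L "dist y z"] by (auto simp: L_def)
  have contf: "continuous_on S f" for S
  proof (rule continuous_on_subset[OF lipschitz_on_continuous_on[of L]])
    show "L-lipschitz_on UNIV f" using L by (auto simp: lipschitz_on_def dist_real_def)
  qed simp
  have [measurable]: "f \<in> borel_measurable borel" by (rule borel_measurable_continuous_onI[OF contf])
  define T where "T r = move N x \<eta> (fisher_rao_step N x \<eta> r)" for r
  define F where "F r y = growth N x \<eta> r y * f (T r y)" for r y
  have F[measurable]: "F r \<in> borel_measurable borel" for r unfolding F_def[abs_def] T_def by measurable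
  have Fb: "\<exists>B. \<forall>y. \<bar>F r y\<bar> \<le> B" if r: "r \<in> prob_measures" for r
  proof -
    obtain B where B: "\<And>y. \<bar>growth N x \<eta> r y\<bar> \<le> B" using growth_bounded[OF r \<eta>] by blast
    have "\<bar>F r y\<bar> \<le> B * 1" for y
      unfolding F_def abs_mult using B b by (intro mult_mono) (auto intro: order_trans[OF abs_ge_zero])
    then show ?thesis by blast
  qed
  have intF: "integrable r' (F r)" if "r \<in> prob_measures" "r' \<in> prob_measures" for r r'
    using Fb[OF that(1)] integrable_bounded_prob[OF that(2) F] by blast
  obtain B where B: "\<And>y. \<bar>growth N x \<eta> \<rho> y\<bar> \<le> B" using growth_bounded[OF \<rho> \<eta>] by blast
  have B0: "B \<ge> 0" using B[of 0] by linarith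
  define e where "e n = wdist N (lik x (?r n)) (lik x \<rho>)
     + B * (L * wdist N (lik x (fisher_rao_step N x \<eta> (?r n))) (lik x (fisher_rao_step N x \<eta> \<rho>)))" for n
  have "(\<lambda>n. e n) \<longlonglongrightarrow> 0 + B * (L * 0)"
    unfolding e_def using lik_pos[OF \<rho>, of x] lik_pos[OF fisher_rao_step_prob[OF \<rho> \<eta> N], of x]
    by (intro tendsto_intros wdist_tendsto weakly_converges_gauss(1)[OF conv]
        lik_fisher_rao_step_tendsto[OF conv r \<rho> \<eta>]) auto
  then have e: "e \<longlonglongrightarrow> 0" by simp
  have close: "\<bar>F (?r n) y - F \<rho> y\<bar> \<le> e n" for n y
  proof -
    have "F (?r n) y - F \<rho> y = (growth N x \<eta> (?r n) y - growth N x \<eta> \<rho> y) * f (T (?r n) y)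
       + growth N x \<eta> \<rho> y * (f (T (?r n) y) - f (T \<rho> y))"
      by (simp add: F_def algebra_simps)
    also have "\<bar>\<dots>\<bar> \<le> \<bar>growth N x \<eta> (?r n) y - growth N x \<eta> \<rho> y\<bar> * 1
       + B * (L * dist (T (?r n) y) (T \<rho> y))"
      using b L B B0
      by (intro order_trans[OF abs_triangle_ineq] add_mono) (auto simp: abs_mult mult_left_le intro!: mult_mono)
    also have "\<dots> \<le> e n"
    proof -
      have "\<bar>growth N x \<eta> (?r n) y - growth N x \<eta> \<rho> y\<bar>
          = \<eta> * \<bar>potential N x (lik x (?r n)) y - potential N x (lik x \<rho>) y\<bar>"
        using \<eta> by (simp add: growth_def abs_mult flip: right_diff_distrib)
      also have "\<dots> \<le> 1 * wdist N (lik x (?r n)) (lik x \<rho>)"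
        using \<eta> by (intro mult_mono potential_wdist) auto
      finally have 1: "\<bar>growth N x \<eta> (?r n) y - growth N x \<eta> \<rho> y\<bar> * 1 \<le> wdist N (lik x (?r n)) (lik x \<rho>)"
        by simp
      have "dist (T (?r n) y) (T \<rho> y) = \<eta> * norm (force N x (lik x (fisher_rao_step N x \<eta> (?r n))) y
          - force N x (lik x (fisher_rao_step N x \<eta> \<rho>)) y)"
        using \<eta> by (simp add: T_def move_def dist_norm flip: scaleR_diff_right)
      also have "\<dots> \<le> 1 * wdist N (lik x (fisher_rao_step N x \<eta> (?r n))) (lik x (fisher_rao_step N x \<eta> \<rho>))"
        using \<eta> by (intro mult_mono force_wdist) auto
      finally show ?thesis unfolding e_def using 1 L B0 by (intro add_mono mult_left_mono) auto
    qed
    finally show ?thesis .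
  qed
  have diff: "\<bar>(\<integral>y. F (?r n) y \<partial>?r n) - (\<integral>y. F \<rho> y \<partial>?r n)\<bar> \<le> e n" for n
  proof -
    interpret prob_space "?r n" using r prob_measuresD by blast
    have "\<bar>\<integral>y. F (?r n) y - F \<rho> y \<partial>?r n\<bar> \<le> (\<integral>y. \<bar>F (?r n) y - F \<rho> y\<bar> \<partial>?r n)"
      by (rule integral_abs_bound)
    also have "\<dots> \<le> (\<integral>y. e n \<partial>?r n)"
      using intF[OF r r] intF[OF \<rho> r] close by (intro integral_mono) auto
    also have "\<dots> = e n" by (simp add: prob_space)
    finally show ?thesis using intF[OF r r] intF[OF \<rho> r] by simp
  qed
  have "(\<lambda>n. \<integral>y. F \<rho> y \<partial>?r n) \<longlonglongrightarrow> (\<integral>y. F \<rho> y \<partial>\<rho>)"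
  proof -
    have "continuous_on UNIV (F \<rho>)"
      unfolding F_def[abs_def] T_def
      by (intro continuous_intros continuous_growth continuous_on_compose2[OF contf[of UNIV]] continuous_move) auto
    moreover obtain B' where "\<And>y. \<bar>F \<rho> y\<bar> \<le> B'" using Fb[OF \<rho>] by blast
    ultimately show ?thesis by (rule weakly_convergesD[OF conv])
  qed
  moreover have "(\<lambda>n. (\<integral>y. F (?r n) y \<partial>?r n) - (\<integral>y. F \<rho> y \<partial>?r n)) \<longlonglongrightarrow> 0"
    by (rule tendsto_0_le[OF e, of _ 1]) (use diff in \<open>auto intro!: always_eventually order_trans[OF _ abs_ge_self]\<close>)
  ultimately have "(\<lambda>n. ((\<integral>y. F (?r n) y \<partial>?r n) - (\<integral>y. F \<rho> y \<partial>?r n)) + (\<integral>y. F \<rho> y \<partial>?r n)) \<longlonglongrightarrow> 0 + (\<integral>y. F \<rho> y \<partial>\<rho>)"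
    by (intro tendsto_add)
  moreover have "(\<integral>y. F (?r n) y \<partial>?r n) = (\<integral>y. f y \<partial>?r (Suc n))" for n
    using integral_wfr_step[OF r \<eta> N, of f x n] by (simp add: F_def T_def)
  ultimately have "(\<lambda>n. \<integral>y. f y \<partial>?r (Suc n)) \<longlonglongrightarrow> (\<integral>y. F \<rho> y \<partial>\<rho>)" by simp
  moreover have "(\<lambda>n. \<integral>y. f y \<partial>?r (Suc n)) \<longlonglongrightarrow> (\<integral>y. f y \<partial>\<rho>)"
  proof (rule LIMSEQ_Suc)
    show "(\<lambda>n. \<integral>y. f y \<partial>?r n) \<longlonglongrightarrow> (\<integral>y. f y \<partial>\<rho>)"
      using b by (intro weakly_convergesD[OF conv contf, of 1]) auto
  qed
  ultimately have "(\<integral>y. F \<rho> y \<partial>\<rho>) = (\<integral>y. f y \<partial>\<rho>)" by (rule LIMSEQ_unique)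
  then show "(\<integral>y. f y \<partial>wfr_step N x \<eta> \<rho>) = (\<integral>y. f y \<partial>\<rho>)"
    using integral_wfr_step[OF \<rho> \<eta> N, of f x] by (simp add: F_def T_def)
qed

section \<open>Fixed points of the step\<close>

locale wfr_fixpoint =
  fixes N :: nat and x :: "nat \<Rightarrow> real ^ 'd" and \<eta> :: real and \<rho> :: "(real ^ 'd) measure" and M :: real
  assumes N: "N \<ge> 1" and \<rho>: "\<rho> \<in> prob_measures" and \<eta>: "0 < \<eta>" "\<eta> \<le> 1/2"
    and fixpoint: "wfr_step N x \<eta> \<rho> = \<rho>"
    and M: "M \<ge> 1" "\<And>i. i \<in> {1..N} \<Longrightarrow> norm (x i) \<le> M"
begin

sublocale prob_space \<rho> using \<rho> prob_measuresD by blast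

text \<open>\<open>a\<close> governs the growth and \<open>b\<close> the motion within one step;
  that they agree at a fixed point has to be proved.\<close>

definition a :: "nat \<Rightarrow> real" where "a = lik x \<rho>"
definition b :: "nat \<Rightarrow> real" where "b = lik x (fisher_rao_step N x \<eta> \<rho>)"

abbreviation f :: "real ^ 'd \<Rightarrow> real" where "f \<equiv> growth N x \<eta> \<rho>"
abbreviation T :: "real ^ 'd \<Rightarrow> real ^ 'd" where "T \<equiv> move N x \<eta> (fisher_rao_step N x \<eta> \<rho>)"

lemma fr_prob: "fisher_rao_step N x \<eta> \<rho> \<in> prob_measures"
  using \<rho> \<eta> N by (intro fisher_rao_step_prob) auto

lemma a_pos: "a i > 0" and b_pos: "b i > 0"
  by (simp_all add: a_def b_def lik_pos \<rho> fr_prob)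

lemma T_eq: "T y = y + \<eta> *\<^sub>R force N x b y" by (simp add: move_def b_def)

lemma f_eq: "f y = 1 - \<eta> + \<eta> * potential N x a y" by (simp add: growth_def a_def)

lemma f_ge: "f y \<ge> 1 - \<eta>" and f_pos: "f y > 0"
  using growth_ge[OF \<rho>, of \<eta> N x y] \<eta> by auto

lemma f_bounded: "\<exists>B. \<forall>y. \<bar>f y\<bar> \<le> B"
  using \<eta> by (intro growth_bounded[OF \<rho>]) auto

lemma measurable_\<rho>: "borel_measurable \<rho> = borel_measurable borel"
  by (rule measurable_prob_measures[OF \<rho>])

lemma integrable_f_mult:
  assumes "V \<in> borel_measurable borel" "\<And>y. \<bar>V y\<bar> \<le> C"
  shows "integrable \<rho> (\<lambda>y. f y * V y)"
proof -
  obtain B where B: "\<And>y. \<bar>f y\<bar> \<le> B" using f_bounded by blast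
  have "\<bar>f y * V y\<bar> \<le> B * C" for y
    unfolding abs_mult using B[of y] assms(2)[of y] by (intro mult_mono) auto
  then show ?thesis using assms(1) by (intro integrable_bounded_prob[OF \<rho>]) auto
qed

lemma integral_fixpoint:
  fixes V :: "real ^ 'd \<Rightarrow> real"
  assumes "V \<in> borel_measurable borel"
  shows "(\<integral>y. V y \<partial>\<rho>) = (\<integral>y. f y * V (T y) \<partial>\<rho>)"
  using integral_wfr_step[OF \<rho>, of \<eta> N V x] \<eta> N assms by (simp add: fixpoint)

lemma integral_f: "(\<integral>y. f y \<partial>\<rho>) = 1"
  using integral_fixpoint[of "\<lambda>_. 1"] by (simp add: prob_space)

lemma b_eq: "b i = (\<integral>y. f y * gauss (y - x i) \<partial>\<rho>)"
  unfolding b_def lik_eq using \<eta> by (subst integral_fisher_rao_step[OF \<rho>]) auto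

lemma a_eq: "a i = (\<integral>y. gauss (y - x i) \<partial>\<rho>)"
  by (simp add: a_def lik_eq)

lemma integrable_f_gauss: "integrable \<rho> (\<lambda>y. f y * gauss (y - x i))"
  by (rule integrable_f_mult[of _ 1]) (auto simp: gauss_le_1)

lemma potential_bounded:
  assumes "\<And>i. w i > 0"
  shows "\<bar>potential N x w y\<bar> \<le> (1 / real N) * (\<Sum>i=1..N. 1 / w i)"
proof -
  have "potential N x w y \<le> (1 / real N) * (\<Sum>i=1..N. 1 / w i)"
    unfolding potential_def using assms gauss_le_1
    by (intro mult_left_mono sum_mono divide_right_mono) (auto intro: less_imp_le)
  then show ?thesis using potential_nonneg[of N w x y] assms by simp
qed

lemma integral_f_potential: "(\<integral>y. f y * potential N x b y \<partial>\<rho>) = 1"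
proof -
  have "(\<integral>y. f y * potential N x b y \<partial>\<rho>) = (\<integral>y. potential N x b y \<partial>fisher_rao_step N x \<eta> \<rho>)"
    using \<eta> by (subst integral_fisher_rao_step[OF \<rho>]) auto
  also have "\<dots> = 1"
    unfolding b_def by (rule integral_potential_lik[OF fr_prob N])
  finally show ?thesis .
qed

text \<open>The potential frozen between the two parts has mean \<open>1\<close> after the Fisher-Rao part, at most \<open>1\<close>
  before it and at least \<open>1\<close> after the Wasserstein part; at a fixed point all three agree.\<close>

lemma fixpoint_critical:
  assumes b_ge: "\<And>i. i \<in> {1..N} \<Longrightarrow> b i \<ge> \<eta> * gauss (0 :: real ^ 'd)"
  shows "AE y in \<rho>. f y = 1 \<and> force N x b y = 0"
proof -
  let ?P = "potential N x b" and ?F = "force N x b"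
  define k where "k y = \<eta> * (norm (?F y))\<^sup>2 * (1 - \<eta> * ?P y / 2)" for y
  define t where "t y = (f y - 1)\<^sup>2 / f y" for y
  \<comment> \<open>The reason for the threshold: the curvature term of
    \<open>potential_add_ge\<close> then costs at most half of the first-order gain.\<close>
  have Ple: "\<eta> * ?P y \<le> 1" for y
  proof -
    have "?P y \<le> gauss (0 :: real ^ 'd) / (\<eta> * gauss (0 :: real ^ 'd))"
      using b_ge \<eta> by (intro potential_le[OF N]) auto
    then show ?thesis using \<eta> by (simp add: field_simps)
  qed
  have P0: "?P y \<ge> 0" for y using b_pos by (intro potential_nonneg) auto
  have k0: "k y \<ge> 0" for y
    unfolding k_def using Ple[of y] \<eta> by (intro mult_nonneg_nonneg) auto
  have t0: "t y \<ge> 0" for y unfolding t_def using f_pos[of y] by simp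
  obtain B where B: "\<And>y. \<bar>f y\<bar> \<le> B" using f_bounded by blast
  define C where "C = (1 / real N) * (\<Sum>i=1..N. 1 / b i)"
  have PC: "\<bar>?P y\<bar> \<le> C" for y unfolding C_def using b_pos by (rule potential_bounded)
  have FC: "norm (?F y) \<le> C" for y unfolding C_def using b_pos by (intro norm_force_le) auto
  have [measurable]: "k \<in> borel_measurable borel" "t \<in> borel_measurable borel"
    unfolding k_def[abs_def] t_def[abs_def] by measurable
  have kC: "\<bar>k y\<bar> \<le> \<eta> * C\<^sup>2 * 1" for y
  proof -
    have "k y \<le> \<eta> * C\<^sup>2 * 1"
      unfolding k_def using FC[of y] P0[of y] Ple[of y] \<eta>
      by (intro mult_mono power_mono mult_nonneg_nonneg) auto
    then show ?thesis using k0[of y] by simp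
  qed
  have tC: "\<bar>t y\<bar> \<le> (B + 1)\<^sup>2 * 2" for y
  proof -
    have "t y \<le> (B + 1)\<^sup>2 / (1/2)"
      unfolding t_def using B[of y] f_ge[of y] \<eta>
      by (intro frac_le) (auto intro!: power2_le_iff_abs_le[THEN iffD2])
    then show ?thesis using t0[of y] by simp
  qed
  have int_fk: "integrable \<rho> (\<lambda>y. f y * k y)" by (rule integrable_f_mult[OF _ kC]) simp
  have int_t: "integrable \<rho> t" by (rule integrable_bounded_prob[OF \<rho> _ tC]) simp
  have int_fP: "integrable \<rho> (\<lambda>y. f y * ?P y)" by (rule integrable_f_mult[OF _ PC]) simp
  have upper: "(\<integral>y. ?P y \<partial>\<rho>) \<ge> 1 + (\<integral>y. f y * k y \<partial>\<rho>)"
  proof -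
    have "?P (T y) \<ge> ?P y + k y" for y
    proof -
      have "?P (T y) \<ge> ?P y + ?F y \<bullet> (\<eta> *\<^sub>R ?F y) - ?P y * (norm (\<eta> *\<^sub>R ?F y))\<^sup>2 / 2"
        unfolding T_eq using b_pos by (intro potential_add_ge) auto
      also have "?P y + ?F y \<bullet> (\<eta> *\<^sub>R ?F y) - ?P y * (norm (\<eta> *\<^sub>R ?F y))\<^sup>2 / 2 = ?P y + k y"
        by (simp add: k_def power_mult_distrib dot_square_norm power2_eq_square[of \<eta>] algebra_simps)
      finally show ?thesis .
    qed
    then have "f y * (?P y + k y) \<le> f y * ?P (T y)" for y using f_pos[of y] by (intro mult_left_mono) auto
    then have "(\<integral>y. f y * ?P y + f y * k y \<partial>\<rho>) \<le> (\<integral>y. f y * ?P (T y) \<partial>\<rho>)"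
      using int_fP int_fk integrable_f_mult[of "\<lambda>y. ?P (T y)" C] PC
      by (intro integral_mono Bochner_Integration.integrable_add) (auto simp: distrib_left)
    also have "\<dots> = (\<integral>y. ?P y \<partial>\<rho>)" by (rule integral_fixpoint[symmetric]) simp
    finally show ?thesis using int_fP int_fk integral_f_potential by simp
  qed
  have lower: "(\<integral>y. ?P y \<partial>\<rho>) \<le> 1 - (1 - \<eta>) / \<eta> * (\<integral>y. t y \<partial>\<rho>)"
  proof -
    have int_gf: "integrable \<rho> (\<lambda>y. gauss (y - x i) / f y)" for i
    proof (rule integrable_bounded_prob[OF \<rho>, where B=2])
      show "\<bar>gauss (y - x i) / f y\<bar> \<le> 2" for y
        using f_ge[of y] \<eta> gauss_le_1[of "y - x i"] f_pos[of y] by (simp add: field_simps)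
    qed simp
    have i: "a i / b i \<le> (\<integral>y. gauss (y - x i) / f y \<partial>\<rho>) / a i" for i
    proof -
      \<comment> \<open>\<open>2 / s - f y / s\<^sup>2\<close> is the tangent of
        \<open>1 / f y\<close> at \<open>s\<close> and lies below it. Taking for \<open>s\<close>
        the mean of \<open>f\<close> under the weight \<open>gauss (y - x i)\<close> turns this into
        Jensen's inequality.\<close>
      define s where "s = b i / a i"
      have s: "s > 0" using a_pos b_pos by (simp add: s_def)
      have "gauss (y - x i) * (2 / s) - f y * gauss (y - x i) * (1 / s\<^sup>2) \<le> gauss (y - x i) / f y" for y
      proof -
        have "0 \<le> (f y - s)\<^sup>2 / (f y * s\<^sup>2)" using f_pos[of y] s by simp
        also have "\<dots> = 1 / f y - (2 / s - f y / s\<^sup>2)"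
          using f_pos[of y] s by (simp add: field_simps power2_eq_square)
        finally have "2 / s - f y / s\<^sup>2 \<le> 1 / f y" by simp
        then have "gauss (y - x i) * (2 / s - f y / s\<^sup>2) \<le> gauss (y - x i) * (1 / f y)"
          by (intro mult_left_mono) auto
        then show ?thesis by (simp add: algebra_simps)
      qed
      then have "(\<integral>y. gauss (y - x i) * (2 / s) - f y * gauss (y - x i) * (1 / s\<^sup>2) \<partial>\<rho>)
         \<le> (\<integral>y. gauss (y - x i) / f y \<partial>\<rho>)"
        using int_gf integrable_gauss[OF \<rho>] integrable_f_gauss
        by (intro integral_mono Bochner_Integration.integrable_diff integrable_mult_left) auto
      moreover have "(\<integral>y. gauss (y - x i) * (2 / s) - f y * gauss (y - x i) * (1 / s\<^sup>2) \<partial>\<rho>)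
         = a i * (2 / s) - b i * (1 / s\<^sup>2)"
        using integrable_gauss[OF \<rho>, of "x i"] integrable_f_gauss[of i]
        by (subst Bochner_Integration.integral_diff) (auto simp: a_eq b_eq)
      moreover have "a i * (2 / s) - b i * (1 / s\<^sup>2) = a i / s"
        using a_pos[of i] b_pos[of i] by (simp add: s_def field_simps power2_eq_square)
      ultimately have "a i / s / a i \<le> (\<integral>y. gauss (y - x i) / f y \<partial>\<rho>) / a i"
        using a_pos[of i] by (intro divide_right_mono) auto
      then show ?thesis using a_pos[of i] by (simp add: s_def)
    qed
    have "(\<integral>y. ?P y \<partial>\<rho>) = (1 / real N) * (\<Sum>i=1..N. a i / b i)"
      unfolding a_def by (rule integral_potential[OF \<rho>])
    also have "\<dots> \<le> (1 / real N) * (\<Sum>i=1..N. (\<integral>y. gauss (y - x i) / f y \<partial>\<rho>) / a i)"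
      using i by (intro mult_left_mono sum_mono) auto
    also have "\<dots> = (\<integral>y. (1 / real N) * (\<Sum>i=1..N. gauss (y - x i) / f y / a i) \<partial>\<rho>)"
      using int_gf by (simp add: Bochner_Integration.integral_sum del: divide_divide_eq_left)
    \<comment> \<open>The mean of \<open>f - 1\<close> is 0, so after this algebraic split only
      \<open>t\<close> contributes.\<close>
    also have "\<dots> = (\<integral>y. 1 + (1 - \<eta>) / \<eta> * (f y - 1) - (1 - \<eta>) / \<eta> * t y \<partial>\<rho>)"
    proof (intro Bochner_Integration.integral_cong refl)
      fix y
      have "(1 / real N) * (\<Sum>i=1..N. gauss (y - x i) / f y / a i) = potential N x a y / f y"
        unfolding potential_def by (simp add: sum_divide_distrib mult_ac)
      also have "potential N x a y = 1 + (f y - 1) / \<eta>"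
        using \<eta> by (simp add: f_eq field_simps)
      also have "(1 + (f y - 1) / \<eta>) / f y = 1 + (1 - \<eta>) / \<eta> * (f y - 1) - (1 - \<eta>) / \<eta> * t y"
        unfolding t_def using \<eta> f_pos[of y] by (simp add: field_simps power2_eq_square)
      finally show "(1 / real N) * (\<Sum>i=1..N. gauss (y - x i) / f y / a i)
        = 1 + (1 - \<eta>) / \<eta> * (f y - 1) - (1 - \<eta>) / \<eta> * t y" .
    qed
    also have "\<dots> = 1 - (1 - \<eta>) / \<eta> * (\<integral>y. t y \<partial>\<rho>)"
    proof -
      have "integrable \<rho> f" by (rule integrable_bounded_prob[OF \<rho> _ B]) simp
      then show ?thesis using int_t integral_f by (simp add: prob_space)
    qed
    finally show ?thesis .
  qed
  have nn: "(\<integral>y. f y * k y \<partial>\<rho>) \<ge> 0" "(\<integral>y. t y \<partial>\<rho>) \<ge> 0"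
    using k0 t0 f_pos by (auto intro!: integral_nonneg mult_nonneg_nonneg simp: less_imp_le)
  have e: "(1 - \<eta>) / \<eta> > 0" using \<eta> by simp
  have "(1 - \<eta>) / \<eta> * (\<integral>y. t y \<partial>\<rho>) \<ge> 0"
    using mult_nonneg_nonneg[OF less_imp_le[OF e] nn(2)] .
  then have z: "(\<integral>y. f y * k y \<partial>\<rho>) = 0" "(1 - \<eta>) / \<eta> * (\<integral>y. t y \<partial>\<rho>) = 0"
    using upper lower nn by linarith+
  then have "(\<integral>y. t y \<partial>\<rho>) = 0" using e by (metis less_irrefl mult_eq_0_iff)
  then have "AE y in \<rho>. t y = 0" using integral_nonneg_eq_0_iff_AE[OF int_t] t0 by simp
  moreover have "AE y in \<rho>. f y * k y = 0"
    using z(1) integral_nonneg_eq_0_iff_AE[OF int_fk] k0 f_pos by (simp add: less_imp_le)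
  ultimately show ?thesis
  proof eventually_elim
    case (elim y)
    have "\<eta> * ?P y / 2 < 1" using Ple[of y] by simp
    then show ?case using elim f_pos[of y] \<eta> by (auto simp: t_def k_def)
  qed
qed

text \<open>Vanishing force makes \<open>y\<close> a weighted mean of the samples with positive
  weights.\<close>

lemma force_eq_0_norm_le:
  assumes "force N x w y = 0" "\<And>i. w i > 0"
  shows "norm y \<le> M"
proof -
  define u where "u i = gauss (y - x i) / w i" for i
  have u: "u i > 0" for i using assms(2)[of i] by (simp add: u_def)
  have "(\<Sum>i=1..N. u i *\<^sub>R (x i - y)) = 0" using assms(1) N by (simp add: force_def u_def)
  then have "(\<Sum>i=1..N. u i) *\<^sub>R y = (\<Sum>i=1..N. u i *\<^sub>R x i)"
    by (simp add: scaleR_diff_right sum_subtractf scaleR_sum_left)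
  then have "(\<Sum>i=1..N. u i) * norm y = norm (\<Sum>i=1..N. u i *\<^sub>R x i)"
    using u by (metis abs_of_nonneg less_imp_le norm_scaleR sum_nonneg)
  also have "\<dots> \<le> (\<Sum>i=1..N. u i * M)"
    using u M(2) by (intro order_trans[OF norm_sum] sum_mono) (auto simp: less_imp_le)
  finally have "(\<Sum>i=1..N. u i) * norm y \<le> (\<Sum>i=1..N. u i) * M" by (simp add: sum_distrib_right)
  moreover have "(\<Sum>i=1..N. u i) > 0" using u N by (intro sum_pos) auto
  ultimately show ?thesis by simp
qed

text \<open>\<open>f = 1\<close> almost everywhere makes the Fisher-Rao part trivial. Almost every
  point is within \<open>2 * M\<close> of each sample, whence the exponent
  \<open>- (2 * M)\<^sup>2 / 2\<close>.\<close>

lemma fixpoint_lik_ge: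
  assumes b_ge: "\<And>i. i \<in> {1..N} \<Longrightarrow> b i \<ge> \<eta> * gauss (0 :: real ^ 'd)"
  shows "b = a" and "i \<in> {1..N} \<Longrightarrow> a i \<ge> gauss (0 :: real ^ 'd) * exp (- 2 * M\<^sup>2)"
proof -
  have AE: "AE y in \<rho>. f y = 1 \<and> force N x b y = 0" by (rule fixpoint_critical[OF b_ge])
  show "b = a"
  proof
    fix i
    have "(\<integral>y. f y * gauss (y - x i) \<partial>\<rho>) = (\<integral>y. gauss (y - x i) \<partial>\<rho>)"
      using AE by (intro integral_cong_AE) (auto simp: measurable_\<rho> elim: eventually_mono)
    then show "b i = a i" by (simp add: a_eq b_eq)
  qed
  assume i: "i \<in> {1..N}"
  have "AE y in \<rho>. gauss (0 :: real ^ 'd) * exp (- 2 * M\<^sup>2) \<le> gauss (y - x i)"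
    using AE
  proof eventually_elim
    case (elim y)
    then have "norm y \<le> M" using force_eq_0_norm_le b_pos by blast
    then have "norm (y - x i) \<le> 2 * M" using M(2)[OF i] norm_triangle_ineq4[of y "x i"] by linarith
    then have "(norm (y - x i))\<^sup>2 \<le> (2 * M)\<^sup>2" by (intro power_mono) auto
    then show ?case unfolding gauss_eq[of "y - x i"] by (simp add: power_mult_distrib)
  qed
  then have "(\<integral>y. gauss (0 :: real ^ 'd) * exp (- 2 * M\<^sup>2) \<partial>\<rho>) \<le> (\<integral>y. gauss (y - x i) \<partial>\<rho>)"
    using integrable_gauss[OF \<rho>] by (intro integral_mono_AE) auto
  then show "a i \<ge> gauss (0 :: real ^ 'd) * exp (- 2 * M\<^sup>2)" by (simp add: a_eq prob_space)
qed

end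

section \<open>Excluding mass far away from the samples\<close>

lemma exp_half_le: "0 \<le> t \<Longrightarrow> t \<le> 1 \<Longrightarrow> exp (t / 2) \<le> 1 + (9/10) * (t::real)"
  using exp_bound[of "t/2"] mult_left_le[of t t] by (simp add: power2_eq_square)

lemma exp_neg_double_le: "0 \<le> t \<Longrightarrow> t \<le> 1/2 \<Longrightarrow> exp (- 2 * t) \<le> 1 - (t::real)"
proof -
  assume t: "0 \<le> t" "t \<le> 1/2"
  have "1 \<le> (1 - t) * (1 + 2 * t)" using t mult_left_le[of "2 * t" t] by (simp add: algebra_simps)
  also have "\<dots> \<le> (1 - t) * exp (2 * t)" using t exp_ge_add_one_self[of "2 * t"] by (intro mult_left_mono) auto
  finally show ?thesis by (simp add: exp_minus field_simps)
qed

text \<open>A trajectory along which \<open>ln g\<close> increases at rate comparable to \<open>\<tau> g\<close>, carrying a mass that is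
  multiplied by \<open>1 - \<eta> + g\<close>. If \<open>\<tau>\<close> is large, the trajectory crosses the region \<open>g < 10 \<eta>\<close> quickly;
  if \<open>\<tau>\<close> is bounded, the mass gained between \<open>10 \<eta>\<close> and \<open>\<Gamma> \<eta>\<close> outweighs the time spent there.\<close>

lemma growth_path:
  fixes g :: "nat \<Rightarrow> real" and \<kappa> \<eta> \<tau> \<Gamma> :: real
  defines "m \<equiv> \<lambda>j. \<Prod>i<j. 1 - \<eta> + g i"
  assumes \<kappa>: "0 < \<kappa>" "\<kappa> \<le> 1/100" and \<eta>: "0 < \<eta>" "\<eta> \<le> \<kappa> / 40" and \<Gamma>: "\<Gamma> > 10" "\<Gamma> * \<eta> \<le> 1"
    and \<Gamma>_large: "ln (\<Gamma> / 10) \<ge> 600 * (26 + (40 / \<kappa>) * (ln (10 / \<kappa>) + 1))"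
    and \<tau>: "\<tau> > 0"
    and band: "\<And>j. j < k \<Longrightarrow> \<eta> / 4 \<le> g j \<and> g j < \<Gamma> * \<eta>" and exit: "g k \<ge> \<Gamma> * \<eta>"
    and step: "\<And>j. j < k \<Longrightarrow> g j * exp (\<tau> * g j / 5) \<le> g (Suc j) \<and> g (Suc j) \<le> g j * exp (3 * \<tau> * g j)"
  shows "(\<Sum>j<k. if g j < 10 * \<eta> then m j else 0) \<le> \<kappa> / (10 * \<eta>) * m k"
proof -
  have gpos: "g j > 0" if "j \<le> k" for j
    using band[of j] exit \<eta> \<Gamma> that by (cases "j = k") (auto intro: less_le_trans[of 0 "\<Gamma> * \<eta>"] less_le_trans[of 0 "\<eta>/4"])
  have incr: "g j \<le> g (Suc j)" if "j < k" for j
  proof -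
    have "g j * 1 \<le> g j * exp (\<tau> * g j / 5)" using gpos[of j] \<tau> that by (intro mult_left_mono) auto
    then show ?thesis using step[OF that] by simp
  qed
  have mono: "g i \<le> g j" if "i \<le> j" "j \<le> k" for i j
    using that(1) that(2)
  proof (induction rule: dec_induct)
    case (step j) then show ?case using incr[of j] by simp
  qed simp
  have factor: "1 - \<eta> + g i > 0" if "i < k" for i using gpos[of i] that \<eta> \<kappa> by simp
  have mpos: "m j > 0" if "j \<le> k" for j unfolding m_def using that factor by (intro prod_pos) auto
  have E0: "\<kappa> / (10 * \<eta>) * m k \<ge> 0" using mpos[of k] \<kappa> \<eta> by simp
  show ?thesis
  proof (cases "k > 0 \<and> g 0 < 10 * \<eta>")
    case False
    have "(\<Sum>j<k. if g j < 10 * \<eta> then m j else 0) = 0"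
    proof (rule sum.neutral, rule ballI)
      fix j assume "j \<in> {..<k}"
      then show "(if g j < 10 * \<eta> then m j else 0) = 0" using False mono[of 0 j] by auto
    qed
    then show ?thesis using E0 by simp
  next
    case True
    \<comment> \<open>First exit from the shell; as \<open>g\<close> is nondecreasing, exactly the
      first \<open>n\<close> steps are spent there.\<close>
    define n where "n = (LEAST j. g j \<ge> 10 * \<eta>)"
    have gk: "g k \<ge> 10 * \<eta>" using exit \<Gamma> \<eta> mult_right_mono[of 10 \<Gamma> \<eta>] by linarith
    have gn: "g n \<ge> 10 * \<eta>" unfolding n_def using gk by (rule LeastI)
    have nk: "n \<le> k" unfolding n_def using gk by (rule Least_le)
    have low: "g j < 10 * \<eta>" if "j < n" for j using not_less_Least[of j] that unfolding n_def by force
    have high: "g j \<ge> 10 * \<eta>" if "n \<le> j" "j \<le> k" for j using gn mono[OF that] by simp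
    have n0: "n > 0" using True gn by (cases n) auto
    \<comment> \<open>As \<open>g\<close> is at least \<open>\<eta> / 4\<close>, each step
      multiplies it by at least \<open>exp (\<tau> * \<eta> / 20)\<close>. A total factor 40, which
      is below \<open>exp 5\<close>, leads from \<open>\<eta> / 4\<close> to
      \<open>10 * \<eta>\<close>; so \<open>z\<close> bounds the rescaled time \<open>u\<close> up
      to one step.\<close>
    define z where "z = 100 / \<tau>"
    have z0: "z > 0" using \<tau> by (simp add: z_def)
    define u where "u = \<eta> * real n"
    have u0: "u > 0" using \<eta> n0 by (simp add: u_def)
    have uz: "u \<le> \<eta> + z"
    proof -
      have "\<eta> / 4 * exp (\<tau> * \<eta> / 20 * real j) \<le> g j" if "j < n" for j
        using that
      proof (induction j)
        case 0 then show ?case using band[of 0] True by simp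
      next
        case (Suc j)
        then have j: "j < k" "j < n" using nk by auto
        have "\<eta> / 4 * exp (\<tau> * \<eta> / 20 * real (Suc j)) = \<eta> / 4 * exp (\<tau> * \<eta> / 20 * real j) * exp (\<tau> * \<eta> / 20)"
          by (simp add: distrib_left exp_add[symmetric] mult.assoc)
        also have "\<dots> \<le> g j * exp (\<tau> * g j / 5)"
          using Suc.IH[OF j(2)] band[OF j(1)] \<tau> gpos[of j] j(1)
          by (intro mult_mono) (auto intro!: mult_left_mono simp: divide_simps)
        also have "\<dots> \<le> g (Suc j)" using step[OF j(1)] by simp
        finally show ?case .
      qed
      from this[of "n - 1"] have "\<eta> / 4 * exp (\<tau> * \<eta> / 20 * real (n - 1)) < 10 * \<eta>"
        using low[of "n - 1"] n0 by (metis diff_less less_numeral_extra(1) order_le_less_trans)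
      then have "exp (\<tau> * \<eta> / 20 * real (n - 1)) < 40" using \<eta> by simp
      also have "(40::real) \<le> exp 5"
      proof -
        have "(5/2::real) \<le> exp 1" using exp_lower_Taylor_quadratic[of 1] by simp
        then have "(5/2::real) ^ 5 \<le> exp 1 ^ 5" by (intro power_mono) auto
        also have "exp (1::real) ^ 5 = exp 5" by (simp flip: exp_of_nat_mult)
        finally show ?thesis by (simp add: power_divide)
      qed
      finally have "\<tau> * \<eta> / 20 * real (n - 1) < 5" by simp
      then have "\<eta> * real (n - 1) < z" using \<tau> by (simp add: z_def field_simps)
      moreover have "real (n - 1) = real n - 1" using n0 by simp
      ultimately show ?thesis by (simp add: u_def right_diff_distrib)
    qed
    have sum: "(\<Sum>j<k. if g j < 10 * \<eta> then m j else 0) \<le> real n * exp (10 * u)"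
    proof -
      have "(\<Sum>j<k. if g j < 10 * \<eta> then m j else 0) = (\<Sum>j<n. m j)"
      proof (rule sum.mono_neutral_cong_right)
        show "\<forall>i\<in>{..<k} - {..<n}. (if g i < 10 * \<eta> then m i else 0) = 0"
        proof
          fix i assume "i \<in> {..<k} - {..<n}"
          then show "(if g i < 10 * \<eta> then m i else 0) = 0" using high[of i] by auto
        qed
      qed (use nk low in auto)
      also have "\<dots> \<le> (\<Sum>j<n. exp (10 * u))"
      proof (rule sum_mono)
        fix j assume j: "j \<in> {..<n}"
        have "m j \<le> (\<Prod>i<j. exp (10 * \<eta>))"
          unfolding m_def
        proof (rule prod_mono, rule conjI)
          fix i assume i: "i \<in> {..<j}"
          show "0 \<le> 1 - \<eta> + g i" using factor[of i] i j nk by auto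
          have "1 - \<eta> + g i \<le> 1 + 10 * \<eta>" using low[of i] i j \<eta> by auto
          then show "1 - \<eta> + g i \<le> exp (10 * \<eta>)" using exp_ge_add_one_self[of "10 * \<eta>"] by linarith
        qed
        also have "\<dots> = exp (10 * \<eta> * real j)" by (simp add: exp_of_nat_mult mult.commute)
        also have "\<dots> \<le> exp (10 * u)" using j \<eta> by (simp add: u_def)
        finally show "m j \<le> exp (10 * u)" .
      qed
      finally show ?thesis by simp
    qed
    have mn: "m n \<ge> exp (- 2 * u)"
    proof -
      have "exp (- 2 * u) = (\<Prod>i<n. exp (- 2 * \<eta>))" by (simp add: u_def flip: exp_of_nat_mult)
      also have "\<dots> \<le> m n"
        unfolding m_def
      proof (rule prod_mono, rule conjI)
        fix i assume i: "i \<in> {..<n}"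
        have "exp (- 2 * \<eta>) \<le> 1 - \<eta>" using \<eta> \<kappa> by (intro exp_neg_double_le) auto
        then show "exp (- 2 * \<eta>) \<le> 1 - \<eta> + g i" using gpos[of i] i nk by auto
      qed simp
      finally show ?thesis .
    qed
    define L where "L = ln (\<Gamma> / 10)"
    \<comment> \<open>Beyond the shell the mass gains a factor \<open>exp (g j / 2)\<close> per step
      while \<open>ln (g j)\<close> rises by at most \<open>3 * \<tau> * g j\<close>; so the sum of
      the \<open>g j\<close> is at least the range of \<open>ln g\<close> divided by
      \<open>3 * \<tau>\<close>. The first point beyond the shell may overshoot
      \<open>10 * \<eta>\<close> by a factor \<open>exp (30 * \<tau> * \<eta>)\<close>, which costs
      the \<open>5 * \<eta>\<close>.\<close>
    have mk: "m k \<ge> m n * exp (z * L / 600 - 5 * \<eta>)"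
    proof -
      have *: "m n * exp ((\<Sum>i=n..<j. g i) / 2) \<le> m j \<and> (ln (g j) - ln (g n)) / (3 * \<tau>) \<le> (\<Sum>i=n..<j. g i)"
        if "n \<le> j" "j \<le> k" for j
        using that
      proof (induction rule: dec_induct)
        case base then show ?case by simp
      next
        case (step j)
        then have j: "j < k" "n \<le> j" by auto
        \<comment> \<open>The remaining tenth of \<open>g j\<close> pays for the decay, as
          \<open>g j\<close> is at least \<open>10 * \<eta>\<close>.\<close>
        have "exp (g j / 2) \<le> 1 + (9/10) * g j"
          using gpos[of j] band[OF j(1)] \<Gamma>(2) j(1) by (intro exp_half_le) auto
        also have "\<dots> \<le> 1 - \<eta> + g j" using high[of j] j by auto
        finally have "m n * exp ((\<Sum>i=n..<j. g i) / 2) * exp (g j / 2) \<le> m j * (1 - \<eta> + g j)"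
          using step.IH j mpos[of j] by (intro mult_mono) auto
        moreover have "m (Suc j) = m j * (1 - \<eta> + g j)" by (simp add: m_def)
        moreover have "(\<Sum>i=n..<Suc j. g i) = (\<Sum>i=n..<j. g i) + g j" using j by simp
        ultimately have 1: "m n * exp ((\<Sum>i=n..<Suc j. g i) / 2) \<le> m (Suc j)"
          by (simp add: add_divide_distrib exp_add mult.assoc)
        have "ln (g (Suc j)) \<le> ln (g j * exp (3 * \<tau> * g j))"
          using assms(12)[OF j(1)] gpos[of "Suc j"] gpos[of j] j by (subst ln_le_cancel_iff) auto
        also have "\<dots> = ln (g j) + 3 * \<tau> * g j" using gpos[of j] j by (simp add: ln_mult)
        finally have "(ln (g (Suc j)) - ln (g n)) / (3 * \<tau>) \<le> (ln (g j) - ln (g n)) / (3 * \<tau>) + g j"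
          using \<tau> by (simp add: field_simps)
        then show ?case using 1 step.IH j by simp
      qed
      have "ln (g n) \<le> ln (10 * \<eta>) + 30 * \<tau> * \<eta>"
      proof -
        have n1: "n - 1 < k" "Suc (n - 1) = n" "n - 1 < n" using n0 nk by auto
        have "g n \<le> g (n - 1) * exp (3 * \<tau> * g (n - 1))" using assms(12)[OF n1(1)] n1 by simp
        also have "\<dots> \<le> 10 * \<eta> * exp (30 * \<tau> * \<eta>)"
          using low[OF n1(3)] \<tau> \<eta> gpos[of "n - 1"] n1 by (intro mult_mono) auto
        finally have "ln (g n) \<le> ln (10 * \<eta> * exp (30 * \<tau> * \<eta>))"
          using gpos[OF nk] \<eta> by (subst ln_le_cancel_iff) auto
        also have "\<dots> = ln (10 * \<eta>) + 30 * \<tau> * \<eta>" using \<eta> by (subst ln_mult) auto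
        finally show ?thesis .
      qed
      moreover have "ln (g k) \<ge> ln (10 * \<eta>) + L"
      proof -
        have "ln (10 * \<eta>) + L = ln (10 * \<eta> * (\<Gamma> / 10))" unfolding L_def using \<eta> \<Gamma> by (subst ln_mult) auto
        also have "\<dots> \<le> ln (g k)" using exit \<eta> \<Gamma> gpos[of k] by (subst ln_le_cancel_iff) (auto simp: mult.commute)
        finally show ?thesis .
      qed
      ultimately have "(L - 30 * \<tau> * \<eta>) / (3 * \<tau>) \<le> (ln (g k) - ln (g n)) / (3 * \<tau>)"
        using \<tau> by (intro divide_right_mono) auto
      then have "(L - 30 * \<tau> * \<eta>) / (3 * \<tau>) \<le> (\<Sum>i=n..<k. g i)" using *[OF nk] by simp
      moreover have "(L - 30 * \<tau> * \<eta>) / (3 * \<tau>) = 2 * (z * L / 600 - 5 * \<eta>)"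
        using \<tau> by (simp add: z_def field_simps)
      ultimately have "z * L / 600 - 5 * \<eta> \<le> (\<Sum>i=n..<k. g i) / 2" by simp
      then have "m n * exp (z * L / 600 - 5 * \<eta>) \<le> m n * exp ((\<Sum>i=n..<k. g i) / 2)"
        using mpos[OF nk] by (intro mult_left_mono) auto
      then show ?thesis using *[OF nk] by simp
    qed
    have key: "u * exp (12 * u) \<le> \<kappa> / 10 * exp (z * L / 600 - 5 * \<eta>)"
    proof (cases "z \<le> \<kappa> / 40")
      case True
      have u: "u \<le> \<kappa> / 20" using uz \<eta> True by simp
      have L0: "L \<ge> 0" unfolding L_def using \<Gamma> by (intro ln_ge_zero) auto
      have "exp (12 * u) \<le> 1 + 12 * u + (12 * u)\<^sup>2" using u u0 \<kappa> by (intro exp_bound) auto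
      also have "\<dots> \<le> 1 + 12 * u + 12 * u * 1" using u u0 \<kappa> unfolding power2_eq_square by (intro add_mono mult_left_mono) auto
      also have "\<dots> \<le> 3/2" using u \<kappa> by simp
      finally have "u * exp (12 * u) \<le> \<kappa> / 20 * (3/2)" using u u0 by (intro mult_mono) auto
      also have "\<dots> \<le> \<kappa> / 10 * (1 - 5 * \<eta>)" using \<kappa> \<eta> by (simp add: field_simps)
      also have "\<dots> \<le> \<kappa> / 10 * exp (z * L / 600 - 5 * \<eta>)"
      proof (intro mult_left_mono)
        have "z * L / 600 \<ge> 0" using z0 L0 by simp
        then show "1 - 5 * \<eta> \<le> exp (z * L / 600 - 5 * \<eta>)"
          using exp_ge_add_one_self[of "z * L / 600 - 5 * \<eta>"] by linarith
      qed (use \<kappa> in auto)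
      finally show ?thesis .
    next
      case False
      then have z: "z > \<kappa> / 40" by simp
      have "u \<le> 2 * z" using uz \<eta> z by simp
      have "u \<le> exp u" using exp_ge_add_one_self[of u] by linarith
      then have "u * exp (12 * u) \<le> exp u * exp (12 * u)" by (intro mult_right_mono) auto
      also have "\<dots> = exp (13 * u)" by (simp flip: exp_add)
      also have "\<dots> \<le> exp (26 * z)" using \<open>u \<le> 2 * z\<close> by simp
      also have "\<dots> \<le> exp (z * L / 600 - 5 * \<eta> - ln (10 / \<kappa>))"
      proof -
        have l: "ln (10 / \<kappa>) \<ge> 0" using \<kappa> by (intro ln_ge_zero) (auto simp: field_simps)
        have "1 \<le> z * (40 / \<kappa>)" using z \<kappa> by (simp add: field_simps)
        then have "1 * (ln (10 / \<kappa>) + 1) \<le> z * (40 / \<kappa>) * (ln (10 / \<kappa>) + 1)"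
          using l by (intro mult_right_mono) auto
        moreover define w where "w = (40 / \<kappa>) * (ln (10 / \<kappa>) + 1)"
        ultimately have "ln (10 / \<kappa>) + 1 \<le> z * w" by (simp only: mult_1 mult.assoc)
        then have "26 * z + (ln (10 / \<kappa>) + 1) \<le> z * (26 + (40 / \<kappa>) * (ln (10 / \<kappa>) + 1))"
          unfolding w_def[symmetric] distrib_left[of z 26] by linarith
        also have "\<dots> \<le> z * (L / 600)"
          using \<Gamma>_large z0 unfolding L_def by (intro mult_left_mono) auto
        finally have "26 * z \<le> z * L / 600 - 5 * \<eta> - ln (10 / \<kappa>)" using \<eta> \<kappa> by simp
        then show ?thesis by simp
      qed
      also have "\<dots> = \<kappa> / 10 * exp (z * L / 600 - 5 * \<eta>)"
        using \<kappa> by (simp add: exp_diff[of _ "ln (10 / \<kappa>)"])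
      finally show ?thesis .
    qed
    have "real n * exp (10 * u) = (u * exp (12 * u)) * exp (- 2 * u) / \<eta>"
      using \<eta> by (simp add: u_def flip: exp_add)
    also have "\<dots> \<le> (\<kappa> / 10 * exp (z * L / 600 - 5 * \<eta>)) * m n / \<eta>"
      using mult_mono[OF key mn] \<eta> \<kappa> by (intro divide_right_mono) auto
    also have "\<dots> = \<kappa> / (10 * \<eta>) * (m n * exp (z * L / 600 - 5 * \<eta>))" by simp
    also have "\<dots> \<le> \<kappa> / (10 * \<eta>) * m k" using mk \<kappa> \<eta> by (intro mult_left_mono) auto
    finally show ?thesis using sum by simp
  qed
qed

section \<open>Motion of the particles far from the samples\<close>

context wfr_fixpoint
begin

text \<open>Far out, \<open>T y\<close> is about \<open>(1 - c y) *\<^sub>R y\<close>, while mass is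
  multiplied by \<open>1 - \<eta> + g y\<close>. Both means are \<eta>: that of \<open>g\<close>
  under \<rho>, that of \<open>c\<close> after reweighting by \<open>f\<close>.\<close>

abbreviation c :: "real ^ 'd \<Rightarrow> real" where "c y \<equiv> \<eta> * potential N x b y"
abbreviation g :: "real ^ 'd \<Rightarrow> real" where "g y \<equiv> \<eta> * potential N x a y"

lemma f_g: "f y = 1 - \<eta> + g y" by (rule f_eq)

lemma potential_pos: assumes "\<And>i. w i > 0" shows "potential N x w y > 0"
proof -
  have "(\<Sum>i=1..N. gauss (y - x i) / w i) > 0" using N assms by (intro sum_pos) auto
  then show ?thesis using N by (simp add: potential_def)
qed

lemma c_pos: "c y > 0" and g_pos: "g y > 0"
  using \<eta> potential_pos[of b y] potential_pos[of a y] b_pos a_pos by auto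

lemma b_ge: "b i \<ge> (1 - \<eta>) * a i"
  unfolding a_def b_def using \<eta> by (intro lik_fisher_rao_step_ge[OF \<rho>]) auto

lemma c_le: "c y \<le> 2 * g y"
proof -
  have "gauss (y - x i) / b i \<le> 2 * (gauss (y - x i) / a i)" for i
  proof -
    have "a i / 2 \<le> (1 - \<eta>) * a i" using \<eta> a_pos[of i] by (simp add: field_simps)
    then have "a i / 2 \<le> b i" using b_ge[of i] by linarith
    then have "gauss (y - x i) / b i \<le> gauss (y - x i) / (a i / 2)"
      using a_pos[of i] by (intro divide_left_mono) (auto simp: b_pos)
    then show ?thesis by (simp add: mult.commute)
  qed
  then have "(\<Sum>i=1..N. gauss (y - x i) / b i) \<le> (\<Sum>i=1..N. 2 * (gauss (y - x i) / a i))"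
    by (rule sum_mono)
  then have "potential N x b y \<le> 2 * potential N x a y"
    unfolding potential_def sum_distrib_left[symmetric] by (simp add: divide_right_mono)
  then show ?thesis using \<eta> by simp
qed

lemma g_measurable [measurable]: "g \<in> borel_measurable borel" by measurable

lemma g_bounded: "\<exists>B. \<forall>y. \<bar>g y\<bar> \<le> B"
proof -
  obtain B where B: "\<And>y. \<bar>f y\<bar> \<le> B" using f_bounded by blast
  have "\<bar>g y\<bar> \<le> B + 1" for y using B[of y] f_g[of y] g_pos[of y] \<eta> by simp
  then show ?thesis by blast
qed

lemma integrable_g: "integrable \<rho> g"
  using g_bounded integrable_bounded_prob[OF \<rho> g_measurable] by blast

lemma integral_g: "(\<integral>y. g y \<partial>\<rho>) = \<eta>"
proof -
  have "(\<integral>y. f y \<partial>\<rho>) = (1 - \<eta>) + (\<integral>y. g y \<partial>\<rho>)"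
    unfolding f_g using integrable_g by (simp add: prob_space)
  then show ?thesis using integral_f by simp
qed

lemma integrable_fc: "integrable \<rho> (\<lambda>y. f y * c y)"
proof (rule integrable_f_mult)
  show "\<bar>c y\<bar> \<le> \<eta> * ((1 / real N) * (\<Sum>i=1..N. 1 / b i))" for y
    unfolding abs_mult using \<eta> potential_bounded[of b y] b_pos by (intro mult_mono) auto
qed simp

lemma integral_fc: "(\<integral>y. f y * c y \<partial>\<rho>) = \<eta>"
proof -
  have "(\<integral>y. f y * c y \<partial>\<rho>) = \<eta> * (\<integral>y. f y * potential N x b y \<partial>\<rho>)"
    by (simp add: mult.left_commute)
  then show ?thesis using integral_f_potential by simp
qed

text \<open>Up to a relative error \<open>2 M / |y|\<close> this is also half the decrease of the squared distance to each
  sample, so all ratios \<open>gauss (T y - x i) / gauss (y - x i)\<close> nearly agree.\<close>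

definition sqdrop :: "real ^ 'd \<Rightarrow> real" where "sqdrop y = ((norm y)\<^sup>2 - (norm (T y))\<^sup>2) / 2"

text \<open>The pull towards the origin is exactly \<open>c y\<close>; what remains is a combination
  of the samples with total weight \<open>c y\<close>.\<close>

lemma T_drift: "norm (T y - y + c y *\<^sub>R y) \<le> c y * M"
proof -
  have "T y - y + c y *\<^sub>R y = (\<eta> / real N) *\<^sub>R (\<Sum>i=1..N. (gauss (y - x i) / b i) *\<^sub>R x i)"
    by (simp add: T_eq force_def potential_def scaleR_diff_right sum_subtractf scaleR_sum_left[symmetric])
  also have "norm \<dots> \<le> (\<eta> / real N) * (\<Sum>i=1..N. gauss (y - x i) / b i * M)"
  proof -
    have "norm ((gauss (y - x i) / b i) *\<^sub>R x i) \<le> gauss (y - x i) / b i * M" if "i \<in> {1..N}" for i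
      using mult_left_mono[OF M(2)[OF that], of "gauss (y - x i) / b i"] b_pos[of i] by simp
    then show ?thesis
      unfolding norm_scaleR using \<eta> by (intro mult_mono order_trans[OF norm_sum] sum_mono) auto
  qed
  also have "\<dots> = c y * M" by (simp add: potential_def sum_distrib_right)
  finally show ?thesis .
qed

text \<open>To first order \<open>sqdrop y\<close> is \<open>c y * (norm y)\<^sup>2\<close>; the
  drift and the quadratic term of the displacement cost at most one percent each. Measuring from a
  sample instead of the origin adds the product of the displacement with \<open>x i\<close>, smaller
  by a factor of order \<open>M / norm y\<close>.\<close>

lemma sqdrop_bounds:
  assumes r: "norm y \<ge> 100 * M" and c: "c y \<le> 1 / 100"
  shows "sqdrop y \<ge> 98/100 * c y * (norm y)\<^sup>2" "sqdrop y \<le> 102/100 * c y * (norm y)\<^sup>2"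
    and "i \<in> {1..N} \<Longrightarrow>
      \<bar>((norm (y - x i))\<^sup>2 - (norm (T y - x i))\<^sup>2) / 2 - sqdrop y\<bar> \<le> 2 * M / norm y * sqdrop y"
proof -
  obtain q where q: "q = c y" by blast
  define r where "r = norm y"
  define s where "s = T y - y + q *\<^sub>R y"
  note c = c[folded q]
  define v where "v = T y - y"
  have v: "v = s - q *\<^sub>R y" by (simp add: v_def s_def)
  have s: "norm s \<le> q * M" using T_drift[of y] unfolding s_def q .
  have r100: "M \<le> r / 100" "r > 0" using r M(1) by (auto simp: r_def)
  have c0: "q > 0" by (simp only: q c_pos)
  have nv: "norm v \<le> q * (101/100) * r"
  proof -
    have "norm v \<le> norm s + q * r"
      unfolding v using norm_triangle_ineq4[of s "q *\<^sub>R y"] c0 by (simp add: r_def)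
    also have "\<dots> \<le> q * (r / 100) + q * r" using s mult_left_mono[OF r100(1), of q] c0 by linarith
    finally show ?thesis by (simp add: algebra_simps)
  qed
  have sy: "\<bar>s \<bullet> y\<bar> \<le> q * r\<^sup>2 / 100"
  proof -
    have "\<bar>s \<bullet> y\<bar> \<le> norm s * norm y" by (rule Cauchy_Schwarz_ineq2)
    also have "\<dots> \<le> q * (r / 100) * r"
      using s r100 c0 M(1) by (intro mult_mono order_trans[OF s]) (auto simp: r_def intro!: mult_left_mono)
    finally show ?thesis by (simp add: power2_eq_square)
  qed
  have nv2: "(norm v)\<^sup>2 \<le> q * r\<^sup>2 / 90"
  proof -
    have "(norm v)\<^sup>2 \<le> (q * (101/100) * r)\<^sup>2" using nv by (intro power_mono) auto
    also have "\<dots> = q * (q * r\<^sup>2 * (101/100)\<^sup>2)" by (simp add: power2_eq_square algebra_simps)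
    also have "\<dots> \<le> 1/100 * (q * r\<^sup>2 * (101/100)\<^sup>2)" using c c0 by (intro mult_right_mono) auto
    also have "\<dots> \<le> q * r\<^sup>2 / 90" using c0 r100 by (simp add: power2_eq_square)
    finally show ?thesis .
  qed
  have sqdrop: "sqdrop y = q * r\<^sup>2 - s \<bullet> y - (norm v)\<^sup>2 / 2"
  proof -
    have "T y = y + v" by (simp add: v_def)
    then have "sqdrop y = - (v \<bullet> y) - (norm v)\<^sup>2 / 2"
      unfolding sqdrop_def power2_norm_eq_inner by (simp add: inner_add_left inner_add_right inner_commute field_simps)
    also have "v \<bullet> y = s \<bullet> y - q * r\<^sup>2"
      unfolding v by (simp add: inner_diff_left r_def power2_norm_eq_inner)
    finally show ?thesis by simp
  qed
  have cr0: "q * r\<^sup>2 > 0" using c0 r100 by simp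
  show 1: "sqdrop y \<ge> 98/100 * c y * (norm y)\<^sup>2"
    unfolding sqdrop r_def[symmetric] q[symmetric] using sy nv2 cr0 by linarith
  show "sqdrop y \<le> 102/100 * c y * (norm y)\<^sup>2"
    unfolding sqdrop r_def[symmetric] q[symmetric] using sy cr0 zero_le_power2[of "norm v"] by linarith
  assume i: "i \<in> {1..N}"
  have "((norm (y - x i))\<^sup>2 - (norm (T y - x i))\<^sup>2) / 2 - sqdrop y = v \<bullet> x i"
    unfolding sqdrop_def v_def power2_norm_eq_inner
    by (simp add: inner_diff_left inner_diff_right inner_commute field_simps)
  moreover have "\<bar>v \<bullet> x i\<bar> \<le> q * (101/100) * r * M"
    using nv M i c0 r100 by (intro order_trans[OF Cauchy_Schwarz_ineq2] mult_mono) auto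
  moreover have "q * (101/100) * r * M \<le> 2 * M / norm y * sqdrop y"
  proof -
    have "q * (101/100) * r * M = 2 * M / r * ((101/200) * (q * r\<^sup>2))"
      using r100 by (simp add: power2_eq_square field_simps)
    also have "\<dots> \<le> 2 * M / r * sqdrop y"
      using 1 cr0 r100 M(1) unfolding r_def[symmetric] q[symmetric] by (intro mult_left_mono) auto
    finally show ?thesis by (simp add: r_def)
  qed
  ultimately show "\<bar>((norm (y - x i))\<^sup>2 - (norm (T y - x i))\<^sup>2) / 2 - sqdrop y\<bar> \<le> 2 * M / norm y * sqdrop y"
    by linarith
qed

text \<open>Every Gaussian in the sum is multiplied by nearly \<open>exp (sqdrop y)\<close>,
  whatever its weight. Hence \<open>c\<close> and \<open>g\<close> grow by almost the same factor
  and their ratio changes slowly.\<close>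

lemma potential_T_bounds:
  assumes r: "norm y \<ge> 100 * M" and c: "c y \<le> 1 / 100" and w: "\<And>i. w i > 0" and e: "2 * M / norm y \<le> \<epsilon>"
  shows "potential N x w y * exp ((1 - \<epsilon>) * sqdrop y) \<le> potential N x w (T y)"
    and "potential N x w (T y) \<le> potential N x w y * exp ((1 + \<epsilon>) * sqdrop y)"
proof -
  define D where "D i = ((norm (y - x i))\<^sup>2 - (norm (T y - x i))\<^sup>2) / 2" for i
  have "0 \<le> c y * (norm y)\<^sup>2" by (rule mult_nonneg_nonneg[OF less_imp_le[OF c_pos] zero_le_power2])
  then have d0: "sqdrop y \<ge> 0" using sqdrop_bounds(1)[OF r c] by linarith
  have gT: "gauss (T y - x i) = gauss (y - x i) * exp (D i)" for i
  proof -
    have "- (norm (T y - x i))\<^sup>2 / 2 = - (norm (y - x i))\<^sup>2 / 2 + D i" by (simp add: D_def field_simps)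
    then show ?thesis unfolding gauss_eq[of "T y - x i"] gauss_eq[of "y - x i"] by (simp only: exp_add mult.assoc)
  qed
  have D: "(1 - \<epsilon>) * sqdrop y \<le> D i \<and> D i \<le> (1 + \<epsilon>) * sqdrop y" if "i \<in> {1..N}" for i
  proof -
    have "2 * M / norm y * sqdrop y \<le> \<epsilon> * sqdrop y" using e d0 by (rule mult_right_mono)
    then show ?thesis using sqdrop_bounds(3)[OF r c that]
      unfolding D_def[symmetric] left_diff_distrib distrib_right mult_1 abs_le_iff by linarith
  qed
  have "gauss (y - x i) / w i * exp ((1 - \<epsilon>) * sqdrop y) \<le> gauss (T y - x i) / w i \<and>
      gauss (T y - x i) / w i \<le> gauss (y - x i) / w i * exp ((1 + \<epsilon>) * sqdrop y)" if "i \<in> {1..N}" for i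
    using D[OF that] w[of i] by (auto simp: gT intro!: divide_right_mono mult_left_mono)
  then have "(\<Sum>i=1..N. gauss (y - x i) / w i * exp ((1 - \<epsilon>) * sqdrop y)) \<le> (\<Sum>i=1..N. gauss (T y - x i) / w i)"
    "(\<Sum>i=1..N. gauss (T y - x i) / w i) \<le> (\<Sum>i=1..N. gauss (y - x i) / w i * exp ((1 + \<epsilon>) * sqdrop y))"
    by (auto intro!: sum_mono)
  then show "potential N x w y * exp ((1 - \<epsilon>) * sqdrop y) \<le> potential N x w (T y)"
    "potential N x w (T y) \<le> potential N x w y * exp ((1 + \<epsilon>) * sqdrop y)"
    unfolding potential_def sum_distrib_right[symmetric] by (simp_all add: divide_right_mono)
qed

lemma potential_T_ge:
  assumes r: "norm y \<ge> 100 * M" and c: "c y \<le> 1 / 100" and w: "\<And>i. w i > 0"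
  shows "potential N x w y \<le> potential N x w (T y)"
proof -
  have "0 \<le> c y * (norm y)\<^sup>2" by (rule mult_nonneg_nonneg[OF less_imp_le[OF c_pos] zero_le_power2])
  then have d0: "sqdrop y \<ge> 0" using sqdrop_bounds(1)[OF r c] by linarith
  have n0: "norm y > 0" using r M(1) by linarith
  then have e: "2 * M / norm y \<le> 1/50" using r by (simp add: field_simps)
  have "potential N x w y * 1 \<le> potential N x w y * exp ((1 - 1/50) * sqdrop y)"
    using d0 potential_pos[OF w] by (intro mult_left_mono) (auto simp: less_imp_le)
  then show ?thesis using order_trans[OF _ potential_T_bounds(1)[where w=w, OF r c w e]] by simp
qed

end

text \<open>If some likelihood is below \<open>\<eta> * gauss 0\<close>, the set \<open>c < near N M\<close> lies at distance \<open>> 100 M\<close> from the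
  origin, and \<open>g < range_factor N M * \<eta>\<close> beyond \<open>band_radius N M\<close>, where the relative error above is so
  small that \<open>c / g\<close> changes by at most a factor \<open>2\<close> along a trajectory through that band.\<close>

definition near :: "nat \<Rightarrow> real \<Rightarrow> real" where
  "near N M = exp (- (100 * M + M)\<^sup>2 / 2) / real N"

text \<open>The exponent makes hypothesis \<open>\<Gamma>_large\<close> of
  \<open>growth_path\<close> an equality.\<close>

definition range_factor :: "nat \<Rightarrow> real \<Rightarrow> real" where
  "range_factor N M = 10 * exp (600 * (26 + (40 / near N M) * (ln (10 / near N M) + 1)))"

text \<open>Bounds the total \<open>sqdrop\<close> along the band: \<open>ln g\<close> increases
  there by at most \<open>ln (4 * range_factor N M)\<close>, and at least half as fast as the
  accumulated \<open>sqdrop\<close>.\<close>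

definition band_log :: "nat \<Rightarrow> real \<Rightarrow> real" where
  "band_log N M = 2 * ln (4 * range_factor N M)"

text \<open>The three terms give in turn the distance required by \<open>sqdrop_bounds\<close>, a
  relative error too small to matter when accumulated over the band, and a squared norm that at most
  halves in crossing it.\<close>

definition band_radius :: "nat \<Rightarrow> real \<Rightarrow> real" where
  "band_radius N M = 100 * M + 8 * M * band_log N M + 4 * band_log N M"

text \<open>In order: the smallness asked for by \<open>growth_path\<close>; \<open>g\<close> at
  most 1 throughout the band; the band lying beyond \<open>band_radius\<close>; the Gaussian lower
  bound used in \<open>landing\<close>.\<close>

definition far_bound :: "nat \<Rightarrow> real \<Rightarrow> real" where
  "far_bound N M = Min {near N M / 40, 1 / range_factor N M,
     exp (- (band_radius N M + M)\<^sup>2 / 2) / (2 * real N * range_factor N M),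
     2 * exp (- (4 * M / near N M + 6 * M)\<^sup>2 / 2) / real N}"

text \<open>Assumes what is to be refuted: the threshold of \<open>fixpoint_critical\<close> fails
  at some sample \<open>k0\<close>.\<close>

locale wfr_far = wfr_fixpoint N x \<eta> \<rho> M
  for N :: nat and x :: "nat \<Rightarrow> real ^ 'd" and \<eta> :: real and \<rho> :: "(real ^ 'd) measure" and M :: real +
  fixes k0 :: nat
  assumes k0: "k0 \<in> {1..N}" and b_small: "b k0 < \<eta> * gauss (0 :: real ^ 'd)" and \<eta>_far: "\<eta> \<le> far_bound N M"
begin

abbreviation \<kappa> :: real where "\<kappa> \<equiv> near N M"
abbreviation \<Gamma> :: real where "\<Gamma> \<equiv> range_factor N M"
abbreviation Q :: real where "Q \<equiv> band_log N M"
abbreviation r0 :: real where "r0 \<equiv> band_radius N M"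

lemma \<kappa>: "0 < \<kappa>" "\<kappa> \<le> 1/100"
proof -
  show "0 < \<kappa>" using N by (simp add: near_def)
  have "(101::real)\<^sup>2 \<le> (100 * M + M)\<^sup>2" using M(1) by (intro power_mono) auto
  then have "(100::real) \<le> (100 * M + M)\<^sup>2 / 2" by simp
  then have "100 \<le> exp ((100 * M + M)\<^sup>2 / 2)"
    using exp_ge_add_one_self[of "(100 * M + M)\<^sup>2 / 2"] by linarith
  then have "exp (- ((100 * M + M)\<^sup>2 / 2)) \<le> 1/100"
    by (simp add: exp_minus field_simps)
  moreover have "\<kappa> \<le> exp (- ((100 * M + M)\<^sup>2 / 2))"
    unfolding near_def using N by (simp add: field_simps)
  ultimately show "\<kappa> \<le> 1/100" by linarith
qed

lemma \<Gamma>_ln: "ln (\<Gamma> / 10) = 600 * (26 + (40 / \<kappa>) * (ln (10 / \<kappa>) + 1))"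
  by (simp add: range_factor_def)

lemma \<Gamma>: "\<Gamma> > 10"
proof -
  have "ln (10 / \<kappa>) \<ge> 0" using \<kappa> by (intro ln_ge_zero) (auto simp: field_simps)
  then have "(40 / \<kappa>) * (ln (10 / \<kappa>) + 1) \<ge> 0" using \<kappa> by (intro mult_nonneg_nonneg) auto
  then have "0 < 26 + (40 / \<kappa>) * (ln (10 / \<kappa>) + 1)" by (rule add_pos_nonneg[OF zero_less_numeral])
  then have "0 < 600 * (26 + (40 / \<kappa>) * (ln (10 / \<kappa>) + 1))" by (rule mult_pos_pos[OF zero_less_numeral])
  then have "1 < exp (600 * (26 + (40 / \<kappa>) * (ln (10 / \<kappa>) + 1)))" by (simp only: one_less_exp_iff)
  then show ?thesis unfolding range_factor_def by linarith
qed

lemma Q: "Q \<ge> 2"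
proof -
  have "exp 1 \<le> 4 * \<Gamma>" using \<Gamma> exp_le by linarith
  then have "ln (exp 1) \<le> ln (4 * \<Gamma>)" using \<Gamma> by (subst ln_le_cancel_iff) auto
  then show ?thesis by (simp add: band_log_def)
qed

lemma r0: "r0 \<ge> 100 * M" "r0 \<ge> 8 * M * Q" "r0 \<ge> 4 * Q" "r0 > 0"
proof -
  have "M * Q \<ge> 0" using M(1) Q by (intro mult_nonneg_nonneg) auto
  then show "r0 \<ge> 100 * M" "r0 \<ge> 8 * M * Q" "r0 \<ge> 4 * Q" "r0 > 0"
    unfolding band_radius_def using M(1) Q by linarith+
qed

lemma \<eta>_le: "\<eta> \<le> \<kappa> / 40" "\<Gamma> * \<eta> \<le> 1" "2 * \<Gamma> * \<eta> \<le> exp (- (r0 + M)\<^sup>2 / 2) / real N"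
  "\<eta> / 2 \<le> exp (- (4 * M / \<kappa> + 6 * M)\<^sup>2 / 2) / real N"
proof -
  have "\<eta> \<le> \<kappa> / 40" "\<eta> \<le> 1 / \<Gamma>" "\<eta> \<le> exp (- (r0 + M)\<^sup>2 / 2) / (2 * real N * \<Gamma>)"
    "\<eta> \<le> 2 * exp (- (4 * M / \<kappa> + 6 * M)\<^sup>2 / 2) / real N"
    using \<eta>_far by (simp_all add: far_bound_def)
  then show "\<eta> \<le> \<kappa> / 40" "\<Gamma> * \<eta> \<le> 1" "2 * \<Gamma> * \<eta> \<le> exp (- (r0 + M)\<^sup>2 / 2) / real N"
    "\<eta> / 2 \<le> exp (- (4 * M / \<kappa> + 6 * M)\<^sup>2 / 2) / real N"
    using \<Gamma> N by (auto simp: field_simps)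
qed

text \<open>Small likelihood means large potential: the term of \<open>k0\<close> alone gives a
  bound free of \<eta>. Hence \<open>c\<close> is small only far away, and \<open>norm_gt\<close>
  turns this into explicit distances.\<close>

lemma c_ge: "c y \<ge> exp (- (norm (y - x k0))\<^sup>2 / 2) / real N"
proof -
  let ?t = "\<lambda>i. gauss (y - x i) / b i"
  have "exp (- (norm (y - x k0))\<^sup>2 / 2) \<le> \<eta> * ?t k0"
  proof -
    have "exp (- (norm (y - x k0))\<^sup>2 / 2) * b k0 \<le> exp (- (norm (y - x k0))\<^sup>2 / 2) * (\<eta> * gauss (0 :: real ^ 'd))"
      using b_small by (intro mult_left_mono) auto
    also have "\<dots> = \<eta> * gauss (y - x k0)" unfolding gauss_eq[of "y - x k0"] by simp
    finally show ?thesis using b_pos[of k0] by (simp add: field_simps)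
  qed
  also have "\<dots> \<le> \<eta> * (\<Sum>i=1..N. ?t i)"
    using k0 \<eta> b_pos by (intro mult_left_mono member_le_sum) (auto simp: less_imp_le)
  finally show ?thesis using N by (simp add: potential_def field_simps)
qed

lemma norm_gt:
  assumes "c y < exp (- (r + M)\<^sup>2 / 2) / real N" "r \<ge> 0"
  shows "norm y > r"
proof -
  have "exp (- (norm (y - x k0))\<^sup>2 / 2) / real N < exp (- (r + M)\<^sup>2 / 2) / real N"
    using c_ge[of y] assms(1) by linarith
  then have "(r + M)\<^sup>2 < (norm (y - x k0))\<^sup>2" using N by (simp add: divide_less_cancel)
  then have "r + M < norm (y - x k0)" by (rule power2_less_imp_less) simp
  then show ?thesis using M(2)[OF k0] norm_triangle_ineq4[of y "x k0"] by linarith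
qed

lemma far_norm: "c y < \<kappa> \<Longrightarrow> norm y > 100 * M"
  using norm_gt[of y "100 * M"] M(1) by (simp add: near_def)

lemma band:
  assumes "g y < \<Gamma> * \<eta>"
  shows "norm y > r0" "c y < \<kappa>"
proof -
  have c: "c y < exp (- (r0 + M)\<^sup>2 / 2) / real N" using c_le[of y] assms \<eta>_le(3) by linarith
  then show "norm y > r0" using r0(4) by (intro norm_gt) auto
  have "(100 * M + M)\<^sup>2 \<le> (r0 + M)\<^sup>2" using r0 M(1) by (intro power_mono) auto
  then have "exp (- (r0 + M)\<^sup>2 / 2) / real N \<le> \<kappa>" unfolding near_def by (intro divide_right_mono) auto
  then show "c y < \<kappa>" using c by linarith
qed

lemma far_inward:
  assumes "c y < \<kappa>"
  shows "g y \<le> g (T y)"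
  using potential_T_ge[of y a] far_norm[OF assms] assms \<kappa> a_pos \<eta> by (intro mult_left_mono) auto

text \<open>A core particle reaches the outer region only by overshooting, with
  \<open>c y > 19/10\<close>. Otherwise \<open>T\<close> contracts the distances to the samples by
  \<open>1 - \<kappa>\<close>, up to \<open>4 * M\<close>: either none of them grows and
  \<open>c\<close> does not decrease, or \<open>y\<close> is within \<open>4 * M / \<kappa>\<close>
  of a sample and \<open>c_ge\<close> applies at \<open>T y\<close>.\<close>

lemma landing:
  assumes "\<kappa> \<le> c y" "c y \<le> 19/10"
  shows "\<eta> / 4 \<le> g (T y)"
proof -
  have *: "norm (T y - x i) \<le> (1 - \<kappa>) * norm (y - x i) + 4 * M" if "i \<in> {1..N}" for i
  proof -
    let ?s = "T y - y + c y *\<^sub>R y"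
    have "T y - x i = (1 - c y) *\<^sub>R (y - x i) + (?s - c y *\<^sub>R x i)" by (simp add: algebra_simps)
    then have "norm (T y - x i) = norm ((1 - c y) *\<^sub>R (y - x i) + (?s - c y *\<^sub>R x i))" by (rule arg_cong)
    also have "\<dots> \<le> norm ((1 - c y) *\<^sub>R (y - x i)) + norm (?s - c y *\<^sub>R x i)" by (rule norm_triangle_ineq)
    also have "\<dots> \<le> \<bar>1 - c y\<bar> * norm (y - x i) + (norm ?s + norm (c y *\<^sub>R x i))"
      unfolding norm_scaleR[of "1 - c y"] by (rule add_left_mono) (rule norm_triangle_ineq4)
    also have "\<dots> \<le> (1 - \<kappa>) * norm (y - x i) + (c y * M + c y * M)"
    proof (intro add_mono mult_right_mono)
      show "\<bar>1 - c y\<bar> \<le> 1 - \<kappa>" using assms \<kappa> by (simp add: abs_le_iff)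
      show "norm (c y *\<^sub>R x i) \<le> c y * M"
        using M(2)[OF that] c_pos[of y] unfolding norm_scaleR by (simp only: abs_of_pos mult_left_mono less_imp_le)
    qed (use T_drift in auto)
    also have "c y * M + c y * M \<le> 4 * M"
      using mult_right_mono[OF assms(2), of M] M(1) by linarith
    finally show ?thesis by simp
  qed
  have "\<eta> / 2 \<le> c (T y)"
  proof (cases "\<forall>i\<in>{1..N}. 4 * M \<le> \<kappa> * norm (y - x i)")
    case True
    have "gauss (y - x i) / b i \<le> gauss (T y - x i) / b i" if i: "i \<in> {1..N}" for i
    proof -
      have "norm (T y - x i) \<le> norm (y - x i)" using *[OF i] True i by (fastforce simp: left_diff_distrib)
      then have "(norm (T y - x i))\<^sup>2 \<le> (norm (y - x i))\<^sup>2" by (intro power_mono) auto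
      then have "gauss (y - x i) \<le> gauss (T y - x i)"
        unfolding gauss_eq[of "y - x i"] gauss_eq[of "T y - x i"] by (intro mult_left_mono) auto
      then show ?thesis using b_pos[of i] by (simp add: divide_right_mono)
    qed
    then have "potential N x b y \<le> potential N x b (T y)"
      unfolding potential_def by (intro mult_left_mono sum_mono) auto
    then have "c y \<le> c (T y)" using \<eta> by simp
    then show ?thesis using assms(1) \<eta>_le(1) \<kappa> by linarith
  next
    case False
    then obtain i where i: "i \<in> {1..N}" "\<kappa> * norm (y - x i) < 4 * M" by force
    then have "norm (y - x i) < 4 * M / \<kappa>" using \<kappa> by (simp add: field_simps)
    then have "norm (y - x k0) \<le> 4 * M / \<kappa> + 2 * M"
      using norm_triangle_ineq[of "y - x i" "x i - x k0"] norm_triangle_ineq4[of "x i" "x k0"] M(2)[OF i(1)] M(2)[OF k0]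
      by simp
    moreover have "(1 - \<kappa>) * norm (y - x k0) \<le> norm (y - x k0)" using \<kappa> by (simp add: left_diff_distrib)
    ultimately have "norm (T y - x k0) \<le> 4 * M / \<kappa> + 6 * M" using *[OF k0] by linarith
    then have "(norm (T y - x k0))\<^sup>2 \<le> (4 * M / \<kappa> + 6 * M)\<^sup>2" by (intro power_mono) auto
    then have "exp (- (4 * M / \<kappa> + 6 * M)\<^sup>2 / 2) / real N \<le> exp (- (norm (T y - x k0))\<^sup>2 / 2) / real N"
      by (intro divide_right_mono) auto
    then show ?thesis using c_ge[of "T y"] \<eta>_le(4) by linarith
  qed
  then show ?thesis using c_le[of "T y"] by linarith
qed

section \<open>Mass balance between the outer region, the shell and the core\<close>

lemma fc_nonneg: "f y * c y \<ge> 0"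
  by (rule mult_nonneg_nonneg[OF less_imp_le[OF f_pos] less_imp_le[OF c_pos]])

text \<open>Two sources feed this region: its own mass, multiplied by at most
  \<open>1 - 3 * \<eta> / 4\<close>, and overshooting particles with \<open>c \<ge> 19/10\<close>,
  whose mass is at most \<open>10/19\<close> of the mean \<eta> of \<open>f * c\<close>.
  Stationarity then gives \<open>(10/19) / (3/4) = 40/57\<close>.\<close>

lemma prob_outer: "measure \<rho> {y. g y < \<eta> / 4} \<le> 40 / 57"
proof -
  let ?O = "{y. g y < \<eta> / 4}"
  have meas: "?O \<in> sets borel" by measurable
  have [measurable]: "(indicator ?O :: _ \<Rightarrow> real) \<in> borel_measurable borel" using meas by simp
  have mO: "(\<integral>y. indicator ?O y \<partial>\<rho>) = measure \<rho> ?O"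
    using prob_measuresD[OF \<rho>] by simp
  have i1: "integrable \<rho> (indicator ?O :: _ \<Rightarrow> real)"
    by (rule integrable_bounded_prob[OF \<rho>, where B=1]) (auto simp: indicator_def)
  have i2: "integrable \<rho> (\<lambda>y. f y * (indicator ?O (T y) :: real))"
    by (rule integrable_f_mult[where C=1]) (auto simp: indicator_def)
  have i3: "integrable \<rho> (\<lambda>y. (1 - 3 * \<eta> / 4) * indicator ?O y + f y * c y * (10/19))"
    by (intro Bochner_Integration.integrable_add integrable_mult_right integrable_mult_left i1 integrable_fc)
  have "f y * indicator ?O (T y) \<le> (1 - 3 * \<eta> / 4) * indicator ?O y + f y * c y * (10/19)" for y
  proof (cases "T y \<in> ?O")
    case True
    then have nl: "\<not> (\<kappa> \<le> c y \<and> c y \<le> 19/10)" using landing[of y] by auto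
    have c0: "f y * c y \<ge> 0" by (rule fc_nonneg)
    show ?thesis
    proof (cases "c y < \<kappa>")
      case c: True
      then have "y \<in> ?O" using far_inward[OF c] True by auto
      then show ?thesis using True c0 by (simp add: f_g)
    next
      case False
      then have "19/10 \<le> c y" using nl by linarith
      then have "f y * 1 \<le> f y * (c y * (10/19))" using f_pos[of y] by (intro mult_left_mono) auto
      moreover have "0 \<le> (1 - 3 * \<eta> / 4) * (indicator ?O y :: real)" using \<eta> by (intro mult_nonneg_nonneg) auto
      ultimately show ?thesis using True by (simp add: mult.assoc)
    qed
  next
    case False
    have "f y * c y \<ge> 0" by (rule fc_nonneg)
    moreover have "0 \<le> (1 - 3 * \<eta> / 4) * (indicator ?O y :: real)" using \<eta> by (intro mult_nonneg_nonneg) auto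
    ultimately show ?thesis using False by simp
  qed
  then have "(\<integral>y. f y * indicator ?O (T y) \<partial>\<rho>) \<le> (\<integral>y. (1 - 3 * \<eta> / 4) * indicator ?O y + f y * c y * (10/19) \<partial>\<rho>)"
    by (rule integral_mono[OF i2 i3])
  also have "\<dots> = (1 - 3 * \<eta> / 4) * measure \<rho> ?O + \<eta> * (10/19)"
    using i1 integrable_fc integral_fc mO by (subst Bochner_Integration.integral_add) auto
  also have "(\<integral>y. f y * indicator ?O (T y) \<partial>\<rho>) = measure \<rho> ?O"
    using integral_fixpoint[of "indicator ?O"] mO by simp
  finally have "\<eta> * (3/4 * measure \<rho> ?O) \<le> \<eta> * (10/19)" by (simp add: algebra_simps)
  then show ?thesis using \<eta> by simp
qed

text \<open>As \<open>g\<close> has mean \<eta>, Markov's inequality leaves at most 1/10 above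
  \<open>10 * \<eta>\<close>, and \<open>1 - 40/57 - 1/10\<close> still exceeds 1/10.\<close>

lemma prob_shell: "measure \<rho> {y. \<eta> / 4 \<le> g y \<and> g y < 10 * \<eta>} > 1/10"
proof -
  let ?O = "{y. g y < \<eta> / 4}" and ?H = "{y. 10 * \<eta> \<le> g y}"
  have sp: "space \<rho> = UNIV" and sets: "sets \<rho> = sets borel" using prob_measuresD[OF \<rho>] by auto
  have O: "?O \<in> sets \<rho>" and H: "?H \<in> sets \<rho>" unfolding sets by measurable
  have "{y. \<eta> / 4 \<le> g y \<and> g y < 10 * \<eta>} = space \<rho> - (?O \<union> ?H)" unfolding sp
    by (rule set_eqI) (simp only: mem_Collect_eq Un_iff Diff_iff UNIV_I de_Morgan_disj not_less not_le simp_thms)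
  then have "measure \<rho> {y. \<eta> / 4 \<le> g y \<and> g y < 10 * \<eta>} = 1 - measure \<rho> (?O \<union> ?H)"
    using prob_compl[OF sets.Un[OF O H]] by (simp only:)
  moreover have "measure \<rho> (?O \<union> ?H) \<le> measure \<rho> ?O + measure \<rho> ?H"
    by (rule measure_Un_le[OF O H])
  moreover have "measure \<rho> ?H \<le> 1/10"
  proof -
    have "measure \<rho> {y\<in>space \<rho>. 10 * \<eta> \<le> g y} \<le> (\<integral>y. g y \<partial>\<rho>) / (10 * \<eta>)"
      using integrable_g less_imp_le[OF g_pos] \<eta>
      by (intro integral_Markov_inequality_measure[where A="{}"]) auto
    moreover have "(\<integral>y. g y \<partial>\<rho>) / (10 * \<eta>) = 1/10" unfolding integral_g using \<eta> by simp
    ultimately show ?thesis unfolding sp by (simp only: UNIV_I simp_thms)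
  qed
  ultimately show ?thesis using prob_outer by linarith
qed

text \<open>On the core \<open>c \<le> 2 * g\<close> puts \<open>g\<close> above \<eta>, so
  \<open>f \<ge> 1\<close> there, and Markov's inequality applies to \<open>f * c\<close>, whose
  mean is \<eta>.\<close>

lemma prob_core: "measure \<rho> {y. \<kappa> \<le> c y} \<le> \<eta> / \<kappa>"
proof -
  let ?C = "{y. \<kappa> \<le> c y}"
  have [measurable]: "?C \<in> sets borel" by measurable
  have ineq: "\<kappa> * indicator ?C y \<le> f y * c y" for y
  proof (cases "y \<in> ?C")
    case True
    then have "f y \<ge> 1" using c_le[of y] \<eta>_le(1) \<kappa> f_g[of y] by auto
    then have "1 * \<kappa> \<le> f y * c y" using True \<kappa> by (intro mult_mono) auto
    then show ?thesis using True by simp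
  next
    case False
    then show ?thesis using f_pos[of y] c_pos[of y] by (simp add: less_imp_le)
  qed
  have "integrable \<rho> (\<lambda>y. \<kappa> * indicator ?C y)"
    by (rule integrable_bounded_prob[OF \<rho>, where B=\<kappa>]) (use \<kappa> in \<open>auto simp: indicator_def\<close>)
  then have "(\<integral>y. \<kappa> * indicator ?C y \<partial>\<rho>) \<le> (\<integral>y. f y * c y \<partial>\<rho>)"
    by (rule integral_mono[OF _ integrable_fc ineq])
  then have "\<kappa> * measure \<rho> ?C \<le> \<eta>" using prob_measuresD[OF \<rho>] by (simp add: integral_fc)
  then show ?thesis using \<kappa> by (simp add: field_simps)
qed

text \<open>The rate \<tau> is frozen at the starting point. This is legitimate in the band: the
  accumulated \<open>sqdrop\<close>, called \<open>S j\<close>, stays below \<open>Q\<close>, so the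
  ratio of \<open>c\<close> to \<open>g\<close> changes by at most a factor 2 and the squared norm
  at most halves. Hence the increments of \<open>ln g\<close> agree with \<open>\<tau> * g\<close>
  up to constants between 1/5 and 3.\<close>

lemma orbit_step:
  assumes band_j: "\<And>j. j < k \<Longrightarrow> \<eta> / 4 \<le> g ((T ^^ j) y) \<and> g ((T ^^ j) y) < \<Gamma> * \<eta>" and "j < k"
  defines "\<tau> \<equiv> (norm y)\<^sup>2 * c y / g y"
  shows "g ((T ^^ j) y) * exp (\<tau> * g ((T ^^ j) y) / 5) \<le> g ((T ^^ Suc j) y)"
    and "g ((T ^^ Suc j) y) \<le> g ((T ^^ j) y) * exp (3 * \<tau> * g ((T ^^ j) y))"
proof -
  define z where "z j = (T ^^ j) y" for j
  define G where "G j = g (z j)" for j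
  define C where "C j = c (z j)" for j
  define S where "S j = (\<Sum>i<j. sqdrop (z i))" for j
  define \<epsilon> where "\<epsilon> = 2 * M / r0"
  have z: "z 0 = y" "z (Suc j) = T (z j)" for j by (simp_all add: z_def)
  have G0: "G j > 0" and C0: "C j > 0" for j unfolding G_def C_def by (rule g_pos, rule c_pos)
  have in_band: "norm (z i) > r0" "C i < \<kappa>" "\<eta> / 4 \<le> G i" "G i < \<Gamma> * \<eta>" if "i < k" for i
    using band_j[OF that] band[of "z i"] unfolding z_def G_def C_def by auto
  have \<epsilon>: "0 < \<epsilon>" "\<epsilon> \<le> 1/50" "2 * \<epsilon> * Q \<le> 1/2"
    using r0 M(1) by (auto simp: \<epsilon>_def field_simps)
  have e: "2 * M / norm (z i) \<le> \<epsilon>" if "i < k" for i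
    unfolding \<epsilon>_def using in_band(1)[OF that] r0(4) M(1) by (intro divide_left_mono mult_pos_pos) auto
  have pre: "norm (z i) \<ge> 100 * M" "c (z i) \<le> 1/100" if "i < k" for i
    using in_band(1,2)[OF that] r0(1) \<kappa> unfolding C_def by auto
  have d: "98/100 * C i * (norm (z i))\<^sup>2 \<le> sqdrop (z i)" "sqdrop (z i) \<le> 102/100 * C i * (norm (z i))\<^sup>2" if "i < k" for i
    using sqdrop_bounds(1,2)[OF pre[OF that]] unfolding C_def by auto
  have d0: "sqdrop (z i) \<ge> 0" if "i < k" for i
  proof -
    have "0 \<le> C i * (norm (z i))\<^sup>2" by (rule mult_nonneg_nonneg[OF less_imp_le[OF C0] zero_le_power2])
    then show ?thesis using d(1)[OF that] by linarith
  qed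
  have Gstep: "G i * exp ((1 - \<epsilon>) * sqdrop (z i)) \<le> G (Suc i)" "G (Suc i) \<le> G i * exp ((1 + \<epsilon>) * sqdrop (z i))" if "i < k" for i
    using potential_T_bounds[OF pre[OF that] a_pos e[OF that]] \<eta> unfolding G_def z by (simp_all add: mult.assoc)
  have Cstep: "C i * exp ((1 - \<epsilon>) * sqdrop (z i)) \<le> C (Suc i)" "C (Suc i) \<le> C i * exp ((1 + \<epsilon>) * sqdrop (z i))" if "i < k" for i
    using potential_T_bounds[OF pre[OF that] b_pos e[OF that]] \<eta> unfolding C_def z by (simp_all add: mult.assoc)
  have acc: "(norm (z j))\<^sup>2 = (norm y)\<^sup>2 - 2 * S j \<and> S j \<ge> 0 \<and>
      G 0 * exp ((1 - \<epsilon>) * S j) \<le> G j \<and> G j \<le> G 0 * exp ((1 + \<epsilon>) * S j) \<and>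
      C 0 * exp ((1 - \<epsilon>) * S j) \<le> C j \<and> C j \<le> C 0 * exp ((1 + \<epsilon>) * S j)" if "j \<le> k" for j
    using that
  proof (induction j)
    case 0 then show ?case by (simp add: S_def z)
  next
    case (Suc j)
    then have j: "j < k" by simp
    note IH = Suc.IH[OF less_imp_le[OF j]]
    have S: "S (Suc j) = S j + sqdrop (z j)" by (simp add: S_def)
    have ex: "exp (t * S (Suc j)) = exp (t * S j) * exp (t * sqdrop (z j))" for t
      by (simp add: S distrib_left exp_add)
    have "(norm (z (Suc j)))\<^sup>2 = (norm (z j))\<^sup>2 - 2 * sqdrop (z j)" by (simp add: sqdrop_def z field_simps)
    moreover have "G 0 * exp ((1 - \<epsilon>) * S (Suc j)) \<le> G (Suc j)"
      unfolding ex mult.assoc[symmetric] using IH by (intro order_trans[OF mult_right_mono Gstep(1)[OF j]]) auto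
    moreover have "G (Suc j) \<le> G 0 * exp ((1 + \<epsilon>) * S (Suc j))"
      unfolding ex mult.assoc[symmetric] using IH by (intro order_trans[OF Gstep(2)[OF j] mult_right_mono]) auto
    moreover have "C 0 * exp ((1 - \<epsilon>) * S (Suc j)) \<le> C (Suc j)"
      unfolding ex mult.assoc[symmetric] using IH by (intro order_trans[OF mult_right_mono Cstep(1)[OF j]]) auto
    moreover have "C (Suc j) \<le> C 0 * exp ((1 + \<epsilon>) * S (Suc j))"
      unfolding ex mult.assoc[symmetric] using IH by (intro order_trans[OF Cstep(2)[OF j] mult_right_mono]) auto
    ultimately show ?case using IH d0[OF j] by (simp add: S)
  qed
  have jk: "j < k" "0 < k" using \<open>j < k\<close> by auto
  note A = acc[OF less_imp_le[OF jk(1)]]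
  have SQ: "S j \<le> Q"
  proof -
    have "exp ((1 - \<epsilon>) * S j) * (\<eta> / 4) \<le> exp ((1 - \<epsilon>) * S j) * G 0"
      using in_band(3)[OF jk(2)] by (intro mult_left_mono) auto
    also have "\<dots> \<le> G j" using A by (simp add: mult.commute)
    also have "\<dots> < \<Gamma> * \<eta>" by (rule in_band(4)[OF jk(1)])
    finally have "exp ((1 - \<epsilon>) * S j) < 4 * \<Gamma>" using \<eta> by (simp add: field_simps)
    then have "(1 - \<epsilon>) * S j < ln (4 * \<Gamma>)" using \<Gamma> by (subst exp_less_cancel_iff[symmetric]) simp
    moreover have "1/2 * S j \<le> (1 - \<epsilon>) * S j" using \<epsilon> A by (intro mult_right_mono) auto
    ultimately show ?thesis by (simp add: band_log_def)
  qed
  have n2: "(norm y)\<^sup>2 / 2 \<le> (norm (z j))\<^sup>2" "(norm (z j))\<^sup>2 \<le> (norm y)\<^sup>2"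
  proof -
    have "norm y > r0" using in_band(1)[OF jk(2)] by (simp add: z)
    then have "norm y \<ge> 4 * Q" "norm y \<ge> 1" using r0 Q by auto
    then have "4 * Q * 1 \<le> norm y * norm y" using Q by (intro mult_mono) auto
    then show "(norm y)\<^sup>2 / 2 \<le> (norm (z j))\<^sup>2" "(norm (z j))\<^sup>2 \<le> (norm y)\<^sup>2"
      using A SQ by (auto simp: power2_eq_square)
  qed
  have ex2: "exp (2 * \<epsilon> * S j) \<le> 2"
  proof -
    have "2 * \<epsilon> * S j \<le> 2 * \<epsilon> * Q" using SQ \<epsilon> by (intro mult_left_mono) auto
    then have "2 * \<epsilon> * S j \<le> 1/2" using \<epsilon>(3) by linarith
    then have "exp (2 * \<epsilon> * S j) \<le> exp (1/2)" by (simp only: exp_le_cancel_iff)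
    also have "\<dots> \<le> 2" using exp_bound[of "1/2"] by (simp add: power2_eq_square)
    finally show ?thesis .
  qed
  have ratio: "C 0 * G j \<le> 2 * (G 0 * C j)" "G 0 * C j \<le> 2 * (C 0 * G j)"
  proof -
    have s: "exp ((1 + \<epsilon>) * S j) = exp (2 * \<epsilon> * S j) * exp ((1 - \<epsilon>) * S j)"
      by (simp add: algebra_simps flip: exp_add)
    have "C 0 * G j \<le> C 0 * (G 0 * exp ((1 + \<epsilon>) * S j))" using A C0[of 0] by (intro mult_left_mono) auto
    also have "\<dots> = exp (2 * \<epsilon> * S j) * (G 0 * (C 0 * exp ((1 - \<epsilon>) * S j)))" by (simp add: s)
    also have "\<dots> \<le> 2 * (G 0 * C j)"
      using A ex2 G0[of 0] C0[of 0] by (intro mult_mono mult_left_mono) auto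
    finally show "C 0 * G j \<le> 2 * (G 0 * C j)" .
    have "G 0 * C j \<le> G 0 * (C 0 * exp ((1 + \<epsilon>) * S j))" using A G0[of 0] by (intro mult_left_mono) auto
    also have "\<dots> = exp (2 * \<epsilon> * S j) * (C 0 * (G 0 * exp ((1 - \<epsilon>) * S j)))" by (simp add: s)
    also have "\<dots> \<le> 2 * (C 0 * G j)"
      using A ex2 G0[of 0] C0[of 0] by (intro mult_mono mult_left_mono) auto
    finally show "G 0 * C j \<le> 2 * (C 0 * G j)" .
  qed
  have \<tau>G: "\<tau> * G j = (norm y)\<^sup>2 * (C 0 * G j / G 0)" by (simp add: \<tau>_def C_def G_def z)
  have lowd: "49/200 * (\<tau> * G j) \<le> sqdrop (z j)"
  proof -
    have "C 0 * G j / G 0 \<le> 2 * C j" using ratio(1) G0[of 0] by (simp add: field_simps)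
    then have "\<tau> * G j \<le> (norm y)\<^sup>2 * (2 * C j)" unfolding \<tau>G by (intro mult_left_mono) auto
    also have "\<dots> \<le> (2 * (norm (z j))\<^sup>2) * (2 * C j)"
      using n2(1) C0[of j] by (intro mult_right_mono) auto
    finally have "49/200 * (\<tau> * G j) \<le> 98/100 * C j * (norm (z j))\<^sup>2" by (simp add: mult_ac)
    then show ?thesis using d(1)[OF jk(1)] by linarith
  qed
  have upd: "sqdrop (z j) \<le> 204/100 * (\<tau> * G j)"
  proof -
    have "C j \<le> 2 * (C 0 * G j / G 0)" using ratio(2) G0[of 0] by (simp add: field_simps)
    then have "(norm (z j))\<^sup>2 * C j \<le> (norm y)\<^sup>2 * (2 * (C 0 * G j / G 0))"
      using n2(2) C0[of j] by (intro mult_mono) auto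
    also have "\<dots> = 2 * (\<tau> * G j)" unfolding \<tau>G by simp
    finally have "102/100 * C j * (norm (z j))\<^sup>2 \<le> 204/100 * (\<tau> * G j)" by (simp add: mult_ac)
    then show ?thesis using d(2)[OF jk(1)] by linarith
  qed
  have tg0: "\<tau> * G j \<ge> 0" unfolding \<tau>G using C0[of 0] G0[of 0] G0[of j] by (intro mult_nonneg_nonneg) auto
  have "\<tau> * G j / 5 \<le> 49/50 * (49/200 * (\<tau> * G j))" using tg0 by simp
  also have "\<dots> \<le> (1 - \<epsilon>) * sqdrop (z j)" using lowd tg0 \<epsilon> by (intro mult_mono) auto
  finally have "G j * exp (\<tau> * G j / 5) \<le> G j * exp ((1 - \<epsilon>) * sqdrop (z j))"
    using G0[of j] by (intro mult_left_mono) auto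
  then show "g ((T ^^ j) y) * exp (\<tau> * g ((T ^^ j) y) / 5) \<le> g ((T ^^ Suc j) y)"
    using Gstep(1)[OF jk(1)] unfolding G_def z_def[symmetric] by linarith
  have "(1 + \<epsilon>) * sqdrop (z j) \<le> 51/50 * (204/100 * (\<tau> * G j))"
    using upd d0[OF jk(1)] \<epsilon> by (intro mult_mono) auto
  also have "\<dots> \<le> 3 * \<tau> * G j" using tg0 by simp
  finally have "G j * exp ((1 + \<epsilon>) * sqdrop (z j)) \<le> G j * exp (3 * \<tau> * G j)"
    using G0[of j] by (intro mult_left_mono) auto
  then show "g ((T ^^ Suc j) y) \<le> g ((T ^^ j) y) * exp (3 * \<tau> * g ((T ^^ j) y))"
    using Gstep(2)[OF jk(1)] unfolding G_def z_def[symmetric] by linarith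
qed

text \<open>The ratios \<open>a i / b i\<close> of finitely many samples bound \<open>c / g\<close>
  below, so \<open>g\<close> grows geometrically at a uniform rate. \<open>K\<close> depends on the
  fixed point; it is there so that one truncation of \<open>val\<close> serves all starting
  points.\<close>

lemma orbit_exit: "\<exists>K. \<forall>y. \<eta> / 4 \<le> g y \<longrightarrow> (\<exists>k\<le>K. g ((T ^^ k) y) \<ge> \<Gamma> * \<eta>)"
proof -
  define \<theta> where "\<theta> = Min ((\<lambda>i. a i / b i) ` {1..N})"
  have \<theta>0: "\<theta> > 0" unfolding \<theta>_def using N a_pos b_pos by (subst Min_gr_iff) auto
  have cg: "c y \<ge> \<theta> * g y" for y
  proof -
    have "\<theta> * (gauss (y - x i) / a i) \<le> gauss (y - x i) / b i" if i: "i \<in> {1..N}" for i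
    proof -
      have "\<theta> \<le> a i / b i" unfolding \<theta>_def using i by (intro Min_le) auto
      then have "\<theta> * (gauss (y - x i) / a i) \<le> a i / b i * (gauss (y - x i) / a i)"
        using a_pos[of i] by (intro mult_right_mono) auto
      then show ?thesis using a_pos[of i] by simp
    qed
    then have "(\<Sum>i=1..N. \<theta> * (gauss (y - x i) / a i)) \<le> (\<Sum>i=1..N. gauss (y - x i) / b i)"
      by (rule sum_mono)
    then have "\<theta> * potential N x a y \<le> potential N x b y"
      unfolding potential_def sum_distrib_left[symmetric] by (simp add: divide_right_mono)
    then show ?thesis using \<eta> by (simp add: mult.left_commute)
  qed
  define \<beta> where "\<beta> = r0\<^sup>2 * \<theta> * \<eta> / 20"
  have \<beta>0: "\<beta> > 0" using r0 \<theta>0 \<eta> by (simp add: \<beta>_def)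
  obtain K :: nat where K: "4 * \<Gamma> < real K * \<beta>" using \<beta>0 reals_Archimedean3 by blast
  show ?thesis
  proof (rule exI[of _ K], intro allI impI, rule ccontr)
    fix y assume y: "\<eta> / 4 \<le> g y" and "\<not> (\<exists>k\<le>K. g ((T ^^ k) y) \<ge> \<Gamma> * \<eta>)"
    then have no: "g ((T ^^ j) y) < \<Gamma> * \<eta>" if "j \<le> K" for j using that by (metis not_le)
    have ge: "\<eta> / 4 \<le> g ((T ^^ j) y)" if "j \<le> K" for j
      using that
    proof (induction j)
      case (Suc j)
      then have "j \<le> K" by simp
      then show ?case using Suc.IH far_inward[OF band(2)[OF no[of j]]] by simp
    qed (use y in simp)
    obtain t where t: "t = (norm y)\<^sup>2 * c y / g y" by blast
    have \<tau>: "r0\<^sup>2 * \<theta> \<le> t"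
    proof -
      have "norm y > r0" using band(1)[OF no[of 0]] by simp
      note y_far = this
      have "r0\<^sup>2 * \<theta> \<le> (norm y)\<^sup>2 * (c y / g y)"
      proof (rule mult_mono)
        show "\<theta> \<le> c y / g y" using cg[of y] by (simp only: pos_le_divide_eq[OF g_pos])
        show "r0\<^sup>2 \<le> (norm y)\<^sup>2" using y_far r0(4) by (intro power_mono) auto
      qed (use \<theta>0 in simp_all)
      then show ?thesis unfolding t by (simp only: times_divide_eq_right)
    qed
    have "\<eta> / 4 * exp (real j * \<beta>) \<le> g ((T ^^ j) y)" if "j \<le> K" for j
      using that
    proof (induction j)
      case (Suc j)
      then have j: "j < K" by simp
      have "r0\<^sup>2 * \<theta> \<ge> 0" using \<theta>0 by simp
      then have "r0\<^sup>2 * \<theta> * (\<eta> / 4) \<le> t * g ((T ^^ j) y)"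
        using \<tau> ge[of j] j \<eta>(1) by (intro mult_mono) linarith+
      then have "\<beta> \<le> t * g ((T ^^ j) y) / 5" unfolding \<beta>_def by linarith
      then have e: "exp \<beta> \<le> exp (t * g ((T ^^ j) y) / 5)" by (simp only: exp_le_cancel_iff)
      have "\<eta> / 4 * exp (real (Suc j) * \<beta>) = \<eta> / 4 * exp (real j * \<beta>) * exp \<beta>"
        by (simp add: distrib_right exp_add)
      also have "\<dots> \<le> g ((T ^^ j) y) * exp (t * g ((T ^^ j) y) / 5)"
        by (rule mult_mono[OF Suc.IH e less_imp_le[OF g_pos] exp_ge_zero]) (use j in simp)
      also have "\<dots> \<le> g ((T ^^ Suc j) y)"
        unfolding t
      proof (rule orbit_step(1)[OF _ j])
        fix i assume "i < K"
        then show "\<eta> / 4 \<le> g ((T ^^ i) y) \<and> g ((T ^^ i) y) < \<Gamma> * \<eta>" using ge[of i] no[of i] by linarith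
      qed
      finally show ?case .
    qed (use y in simp)
    from this[of K] have "\<eta> / 4 * exp (real K * \<beta>) < \<Gamma> * \<eta>" using no[of K] by linarith
    then have "exp (real K * \<beta>) < 4 * \<Gamma>" using \<eta> by (simp add: field_simps)
    then show False using K exp_ge_add_one_self[of "real K * \<beta>"] by linarith
  qed
qed

text \<open>Value of a trajectory started in the band: the mass with which it leaves the band, priced
  \<open>\<kappa> / (10 \<eta>)\<close> per unit, minus the total mass it has while in the shell \<open>g < 10 \<eta>\<close>. The first argument
  truncates the recursion.\<close>

primrec val :: "nat \<Rightarrow> real ^ 'd \<Rightarrow> real" where
  "val 0 y = (if g y \<ge> \<Gamma> * \<eta> then \<kappa> / (10 * \<eta>) else 0)"
| "val (Suc n) y = (if g y \<ge> \<Gamma> * \<eta> then \<kappa> / (10 * \<eta>) else if g y < \<eta> / 4 then 0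
     else f y * val n (T y) - (if g y < 10 * \<eta> then 1 else 0))"

lemma val_measurable [measurable]: "val n \<in> borel_measurable borel"
proof (induction n)
  case 0
  show ?case unfolding val.simps(1)[abs_def] by measurable
next
  case (Suc n)
  note [measurable] = Suc
  have "val (Suc n) = (\<lambda>y. if g y \<ge> \<Gamma> * \<eta> then \<kappa> / (10 * \<eta>) else if g y < \<eta> / 4 then 0
     else f y * val n (T y) - (if g y < 10 * \<eta> then 1 else 0))" by (rule ext) simp
  also have "\<dots> \<in> borel_measurable borel" by measurable
  finally show ?case .
qed

lemma val_bounded: "\<exists>B. \<forall>y. \<bar>val n y\<bar> \<le> B"
proof (induction n)
  case 0
  have "\<bar>val 0 y\<bar> \<le> \<kappa> / (10 * \<eta>)" for y using \<kappa> \<eta> by simp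
  then show ?case by blast
next
  case (Suc n)
  then obtain B where B: "\<And>y. \<bar>val n y\<bar> \<le> B" by blast
  obtain C where C: "\<And>y. \<bar>f y\<bar> \<le> C" using f_bounded by blast
  have fB: "\<bar>f y * val n (T y)\<bar> \<le> C * B" for y
    unfolding abs_mult using B[of "T y"] C[of y] by (intro mult_mono) auto
  have "\<bar>val (Suc n) y\<bar> \<le> \<kappa> / (10 * \<eta>) + (C * B + 1)" for y
  proof -
    have "\<kappa> / (10 * \<eta>) \<ge> 0" using \<kappa> \<eta> by simp
    moreover have "C * B \<ge> 0" using fB[of y] by linarith
    ultimately show ?thesis using fB[of y] unfolding val.simps by (auto simp: abs_le_iff simp del: mult_le_cancel_left_pos)
  qed
  then show ?case by blast
qed

text \<open>The recursion stops at the exit time \<open>k\<close>, so a truncation beyond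
  \<open>k\<close> leaves no trace in the value.\<close>

lemma val_exit:
  assumes "\<And>j. j < k \<Longrightarrow> \<eta> / 4 \<le> g ((T ^^ j) y) \<and> g ((T ^^ j) y) < \<Gamma> * \<eta>" "g ((T ^^ k) y) \<ge> \<Gamma> * \<eta>" "k \<le> n"
  shows "val n y = \<kappa> / (10 * \<eta>) * (\<Prod>i<k. f ((T ^^ i) y))
     - (\<Sum>j<k. if g ((T ^^ j) y) < 10 * \<eta> then \<Prod>i<j. f ((T ^^ i) y) else 0)"
  using assms
proof (induction k arbitrary: y n)
  case 0
  then show ?case by (cases n) auto
next
  case (Suc k)
  then obtain n' where n': "n = Suc n'" "k \<le> n'" by (cases n) auto
  have sh: "(T ^^ j) (T y) = (T ^^ Suc j) y" for j by (simp add: funpow_swap1)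
  have "val n' (T y) = \<kappa> / (10 * \<eta>) * (\<Prod>i<k. f ((T ^^ i) (T y)))
     - (\<Sum>j<k. if g ((T ^^ j) (T y)) < 10 * \<eta> then \<Prod>i<j. f ((T ^^ i) (T y)) else 0)"
  proof (rule Suc.IH)
    show "\<eta> / 4 \<le> g ((T ^^ j) (T y)) \<and> g ((T ^^ j) (T y)) < \<Gamma> * \<eta>" if "j < k" for j
      using Suc.prems(1)[of "Suc j"] that unfolding sh by simp
    show "g ((T ^^ k) (T y)) \<ge> \<Gamma> * \<eta>" using Suc.prems(2) unfolding sh .
  qed (rule n'(2))
  moreover have "val n y = f y * val n' (T y) - (if g y < 10 * \<eta> then 1 else 0)"
    using Suc.prems(1)[of 0] unfolding n'(1) val.simps by (simp add: not_le not_less del: mult_le_cancel_left_pos mult_less_cancel_left_pos)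
  moreover have "f y * (\<Sum>j<k. if g ((T ^^ j) (T y)) < 10 * \<eta> then \<Prod>i<j. f ((T ^^ i) (T y)) else 0)
    = (\<Sum>j<k. if g ((T ^^ Suc j) y) < 10 * \<eta> then \<Prod>i<Suc j. f ((T ^^ i) y) else 0)"
    unfolding sum_distrib_left prod.lessThan_Suc_shift sh by (intro sum.cong refl) simp
  ultimately show ?case
    unfolding sum.lessThan_Suc_shift prod.lessThan_Suc_shift[of _ k] sh
    by (simp add: right_diff_distrib mult_ac)
qed

text \<open>\<open>V\<close> is a Lyapunov function for the mass flow: \<open>V\<close> plus the
  indicator of the shell is at most \<open>f * V\<close> after the move, plus the price of the core.
  Integrated at a fixed point, the \<open>V\<close> terms cancel and the shell has mass at most
  \<open>\<kappa> / (10 * \<eta>) * (\<eta> / \<kappa>) = 1/10\<close>, against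
  \<open>prob_shell\<close>.\<close>

lemma far_contradiction: False
proof -
  let ?E = "\<kappa> / (10 * \<eta>)" and ?A = "{y. \<eta> / 4 \<le> g y \<and> g y < 10 * \<eta>}" and ?C = "{y. \<kappa> \<le> c y}"
  have E0: "?E > 0" using \<kappa> \<eta> by simp
  obtain K where K: "\<And>y. \<eta> / 4 \<le> g y \<Longrightarrow> \<exists>k\<le>K. g ((T ^^ k) y) \<ge> \<Gamma> * \<eta>" using orbit_exit by blast
  define V where "V = val K"
  \<comment> \<open>Nonnegativity is \<open>growth_path\<close>; the equality with one more level of
    truncation makes \<open>V\<close> satisfy its own recursion.\<close>
  have exit: "V y \<ge> 0 \<and> V y = val (Suc K) y" if y: "\<eta> / 4 \<le> g y" for y
  proof -
    define k where "k = (LEAST k. g ((T ^^ k) y) \<ge> \<Gamma> * \<eta>)"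
    obtain k' where k': "k' \<le> K" "g ((T ^^ k') y) \<ge> \<Gamma> * \<eta>" using K[OF y] by blast
    have ex: "g ((T ^^ k) y) \<ge> \<Gamma> * \<eta>" unfolding k_def using k'(2) by (rule LeastI)
    have "k \<le> k'" unfolding k_def using k'(2) by (rule Least_le)
    then have kK: "k \<le> K" using k'(1) by simp
    have lt: "g ((T ^^ j) y) < \<Gamma> * \<eta>" if "j < k" for j
      using not_less_Least[OF that[unfolded k_def]] by (simp only: not_le)
    have ge: "\<eta> / 4 \<le> g ((T ^^ j) y)" if "j < k" for j
      using that
    proof (induction j)
      case (Suc j)
      then have "j < k" by simp
      then show ?case using Suc.IH far_inward[OF band(2)[OF lt[of j]]] by simp
    qed (use y in simp)
    have in_band: "\<eta> / 4 \<le> g ((T ^^ j) y) \<and> g ((T ^^ j) y) < \<Gamma> * \<eta>" if "j < k" for j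
      using ge[OF that] lt[OF that] by blast
    have "(\<Sum>j<k. if g ((T ^^ j) y) < 10 * \<eta> then \<Prod>i<j. 1 - \<eta> + g ((T ^^ i) y) else 0)
        \<le> \<kappa> / (10 * \<eta>) * (\<Prod>i<k. 1 - \<eta> + g ((T ^^ i) y))"
    proof (cases "k = 0")
      case True
      then show ?thesis using E0 by simp
    next
      case False
      then have k0: "0 < k" by simp
      obtain t where t: "t = (norm y)\<^sup>2 * c y / g y" by blast
      have "g y < \<Gamma> * \<eta>" using lt[OF k0] by simp
      then have "norm y > 0" using band(1)[of y] r0(4) by linarith
      then have t0: "t > 0"
        unfolding t by (intro divide_pos_pos mult_pos_pos[of "(norm y)\<^sup>2"] zero_less_power c_pos g_pos)
      have st: "g ((T ^^ j) y) * exp (t * g ((T ^^ j) y) / 5) \<le> g ((T ^^ Suc j) y) \<and>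
          g ((T ^^ Suc j) y) \<le> g ((T ^^ j) y) * exp (3 * t * g ((T ^^ j) y))" if "j < k" for j
        unfolding t by (rule conjI[OF orbit_step[OF in_band that]])
      show ?thesis
        by (rule growth_path[where g="\<lambda>j. g ((T ^^ j) y)", OF \<kappa> \<eta>(1) \<eta>_le(1) \<Gamma> \<eta>_le(2)
            eq_refl[OF \<Gamma>_ln[symmetric]] t0 in_band ex st])
    qed
    moreover have "val n y = \<kappa> / (10 * \<eta>) * (\<Prod>i<k. 1 - \<eta> + g ((T ^^ i) y))
        - (\<Sum>j<k. if g ((T ^^ j) y) < 10 * \<eta> then \<Prod>i<j. 1 - \<eta> + g ((T ^^ i) y) else 0)" if "k \<le> n" for n
      unfolding f_g[symmetric] by (rule val_exit[OF in_band ex that])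
    from this[OF kK] this[OF le_SucI[OF kK]]
    have "V y = val (Suc K) y" "V y = \<kappa> / (10 * \<eta>) * (\<Prod>i<k. 1 - \<eta> + g ((T ^^ i) y))
        - (\<Sum>j<k. if g ((T ^^ j) y) < 10 * \<eta> then \<Prod>i<j. 1 - \<eta> + g ((T ^^ i) y) else 0)"
      unfolding V_def by simp_all
    ultimately show ?thesis by linarith
  qed
  have \<Gamma>\<eta>: "\<Gamma> * \<eta> \<le> \<kappa> / 2"
  proof -
    have "(100 * M + M)\<^sup>2 \<le> (r0 + M)\<^sup>2" using r0 M(1) by (intro power_mono) auto
    then have "exp (- (r0 + M)\<^sup>2 / 2) / real N \<le> \<kappa>" unfolding near_def by (intro divide_right_mono) auto
    then show ?thesis using \<eta>_le(3) by linarith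
  qed
  have \<eta>10: "10 * \<eta> \<le> \<Gamma> * \<eta>" using \<Gamma> \<eta>(1) by (intro mult_right_mono) auto
  have V_low: "V y = 0" if "g y < \<eta> / 4" for y
  proof -
    have "\<not> g y \<ge> \<Gamma> * \<eta>" using that \<eta>10 \<eta>(1) by linarith
    then show ?thesis using that unfolding V_def by (cases K) (simp_all only: val.simps if_False if_True)
  qed
  have V_high: "V y = ?E" if "g y \<ge> \<Gamma> * \<eta>" for y
    using that unfolding V_def by (cases K) (simp_all only: val.simps if_True)
  have V0: "V y \<ge> 0" for y using exit[of y] V_low[of y] by linarith
  have fV0: "f y * V (T y) \<ge> 0" for y by (rule mult_nonneg_nonneg[OF less_imp_le[OF f_pos] V0])
  \<comment> \<open>In the band this is the recursion. Above it, either \<open>y\<close> is outside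
    the core, and then \<open>T y\<close> is above the band too and \<open>f y \<ge> 1\<close>, or
    \<open>y\<close> is in the core and the last term pays for \<open>V y\<close>.\<close>
  have ineq: "V y + indicator ?A y \<le> f y * V (T y) + ?E * indicator ?C y" for y
  proof (cases "g y < \<eta> / 4")
    case True
    have "?E * (indicator ?C y :: real) \<ge> 0" using E0 by (intro mult_nonneg_nonneg) auto
    moreover have "y \<notin> ?A" unfolding mem_Collect_eq using True by linarith
    then have "indicator ?A y = (0::real)" by (rule indicator_simps(2))
    ultimately show ?thesis using V_low[OF True] fV0[of y] by linarith
  next
    case ge: False
    show ?thesis
    proof (cases "g y < \<Gamma> * \<eta>")
      case True
      have "?E * (indicator ?C y :: real) \<ge> 0" using E0 by (intro mult_nonneg_nonneg) auto
      moreover have "V y = f y * V (T y) - (if g y < 10 * \<eta> then 1 else 0)"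
      proof -
        have g4: "\<eta> / 4 \<le> g y" and nl: "\<not> \<Gamma> * \<eta> \<le> g y" using ge True by linarith+
        have "V y = val (Suc K) y" using exit[OF g4] by (rule conjunct2)
        also have "\<dots> = f y * V (T y) - (if g y < 10 * \<eta> then 1 else 0)"
          unfolding V_def by (simp only: val.simps nl ge if_False)
        finally show ?thesis .
      qed
      moreover have "indicator ?A y = (if g y < 10 * \<eta> then 1 else (0::real))"
        using ge by (simp only: indicator_def of_bool_def mem_Collect_eq not_less simp_thms)
      ultimately show ?thesis by linarith
    next
      case False
      then have Vy: "V y = ?E" using V_high by simp
      have "y \<notin> ?A" unfolding mem_Collect_eq using False \<eta>10 by linarith
      then have A: "indicator ?A y = (0::real)" by (rule indicator_simps(2))
      show ?thesis
      proof (cases "c y < \<kappa>")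
        case True
        then have "V (T y) = ?E" using V_high far_inward[OF True] False by simp
        moreover have "f y \<ge> 1" using False \<eta>10 \<eta>(1) f_g[of y] by linarith
        then have "1 * ?E \<le> f y * ?E" using E0 by (intro mult_right_mono) auto
        moreover have "?E * (indicator ?C y :: real) \<ge> 0" using E0 by (intro mult_nonneg_nonneg) auto
        ultimately show ?thesis using Vy A by simp
      next
        case False
        then have "indicator ?C y = (1::real)" by (simp only: indicator_def of_bool_def mem_Collect_eq not_less if_True)
        then show ?thesis using Vy A fV0[of y] by simp
      qed
    qed
  qed
  have sets: "sets \<rho> = sets borel" by (rule prob_measuresD[OF \<rho>])
  have mA: "?A \<in> sets \<rho>" and mC: "?C \<in> sets \<rho>" unfolding sets by measurable
  obtain B where B: "\<And>y. \<bar>V y\<bar> \<le> B" using val_bounded unfolding V_def by blast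
  have [measurable]: "V \<in> borel_measurable borel" by (simp add: V_def)
  have iV: "integrable \<rho> V" by (rule integrable_bounded_prob[OF \<rho> _ B]) simp
  have iT: "integrable \<rho> (\<lambda>y. f y * V (T y))" by (rule integrable_f_mult[where C=B]) (use B in auto)
  have iA: "integrable \<rho> (indicator ?A :: _ \<Rightarrow> real)" and iC: "integrable \<rho> (indicator ?C :: _ \<Rightarrow> real)"
    by (rule integrable_bounded_prob[OF \<rho>, where B=1],
        rule borel_measurable_indicator, rule mA[unfolded sets], simp add: indicator_def)
       (rule integrable_bounded_prob[OF \<rho>, where B=1],
        rule borel_measurable_indicator, rule mC[unfolded sets], simp add: indicator_def)
  have lind: "(\<integral>y. indicator S y \<partial>\<rho>) = measure \<rho> S" for S
    unfolding Bochner_Integration.integral_indicator prob_measuresD(3)[OF \<rho>] Int_UNIV_right ..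
  have "(\<integral>y. V y + indicator ?A y \<partial>\<rho>) \<le> (\<integral>y. f y * V (T y) + ?E * indicator ?C y \<partial>\<rho>)"
    by (rule integral_mono[OF Bochner_Integration.integrable_add[OF iV iA]
        Bochner_Integration.integrable_add[OF iT integrable_mult_right[OF iC]] ineq])
  also have "(\<integral>y. V y + indicator ?A y \<partial>\<rho>) = (\<integral>y. V y \<partial>\<rho>) + measure \<rho> ?A"
    unfolding Bochner_Integration.integral_add[OF iV iA] lind ..
  also have "(\<integral>y. f y * V (T y) + ?E * indicator ?C y \<partial>\<rho>) = (\<integral>y. V y \<partial>\<rho>) + ?E * measure \<rho> ?C"
    unfolding Bochner_Integration.integral_add[OF iT integrable_mult_right[OF iC]] integral_mult_right_zero lind
      integral_fixpoint[OF \<open>V \<in> borel_measurable borel\<close>] ..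
  finally have "measure \<rho> ?A \<le> ?E * measure \<rho> ?C" by linarith
  also have "\<dots> \<le> ?E * (\<eta> / \<kappa>)" using E0 prob_core by (intro mult_left_mono) auto
  also have "\<dots> = 1/10" using \<kappa> \<eta> by simp
  finally show False using prob_shell by linarith
qed

end

lemma far_bound_pos: assumes "N \<ge> 1" shows "far_bound N M > 0"
proof -
  have "near N M > 0" "range_factor N M > 0" using assms by (auto simp: near_def range_factor_def)
  then show ?thesis unfolding far_bound_def using assms by (subst Min_gr_iff) auto
qed

context wfr_fixpoint
begin

lemma fixpoint_lik:
  assumes "\<eta> \<le> far_bound N M"
  shows "b = a" and "i \<in> {1..N} \<Longrightarrow> a i \<ge> gauss (0 :: real ^ 'd) * exp (- 2 * M\<^sup>2)"
proof -
  have ge: "b i \<ge> \<eta> * gauss (0 :: real ^ 'd)" if "i \<in> {1..N}" for i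
  proof (rule ccontr)
    assume "\<not> b i \<ge> \<eta> * gauss (0 :: real ^ 'd)"
    then interpret wfr_far N x \<eta> \<rho> M i using that assms by unfold_locales auto
    show False by (rule far_contradiction)
  qed
  show "b = a" "i \<in> {1..N} \<Longrightarrow> a i \<ge> gauss (0 :: real ^ 'd) * exp (- 2 * M\<^sup>2)"
    using fixpoint_lik_ge[OF ge] by auto
qed

end

section \<open>Full support\<close>

text \<open>Full support in a form that pulls back along a continuous surjection.\<close>

definition charges_open :: "'a::topological_space measure \<Rightarrow> bool" where
  "charges_open \<rho> \<longleftrightarrow> (\<forall>U. open U \<longrightarrow> U \<noteq> {} \<longrightarrow> measure \<rho> U > 0)"

lemma supp_UNIV_charges_open:
  assumes "\<rho> \<in> prob_measures" "supp \<rho> = UNIV" shows "charges_open \<rho>"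
  unfolding charges_open_def
proof (intro allI impI)
  interpret prob_space \<rho> using assms prob_measuresD by blast
  fix U :: "'a set" assume U: "open U" "U \<noteq> {}"
  show "measure \<rho> U > 0"
  proof (rule ccontr)
    assume "\<not> measure \<rho> U > 0"
    then have "measure \<rho> U = 0" using measure_nonneg[of \<rho> U] by linarith
    moreover have "U \<in> sets \<rho>" using U prob_measuresD[OF assms(1)] by simp
    ultimately have "measure \<rho> (- U) = 1"
      using prob_compl[of U] prob_measuresD[OF assms(1)] by (simp add: Compl_eq_Diff_UNIV)
    then have "supp \<rho> \<subseteq> - U" using U unfolding supp_def by blast
    then show False using assms(2) U by auto
  qed
qed

text \<open>A solution is a fixed point of the map taking \<open>y\<close> to
  \<open>z - \<eta> *\<^sub>R force N x w y\<close>, which sends a ball around \<open>z\<close> into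
  itself because the force is bounded. Brouwer rather than a contraction: the likelihoods of early
  iterates may be tiny, and then \<eta> is not small against the variation of the force.\<close>

lemma add_force_surj:
  assumes "\<And>i. i \<in> {1..N} \<Longrightarrow> w i > 0" "\<eta> \<ge> 0"
  obtains y where "y + \<eta> *\<^sub>R force N x w y = z"
proof -
  define C where "C = (1 / real N) * (\<Sum>i=1..N. 1 / w i)"
  have C: "norm (force N x w y) \<le> C" for y unfolding C_def using assms(1) by (rule norm_force_le)
  have C0: "C \<ge> 0" using C[of 0] norm_ge_zero order_trans by blast
  have "\<exists>y\<in>cball z (\<eta> * C). z - \<eta> *\<^sub>R force N x w y = y"
  proof (rule brouwer)
    show "cball z (\<eta> * C) \<noteq> {}" using mult_nonneg_nonneg[OF assms(2) C0] by simp
    show "continuous_on (cball z (\<eta> * C)) (\<lambda>y. z - \<eta> *\<^sub>R force N x w y)"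
      by (intro continuous_intros continuous_force)
    show "(\<lambda>y. z - \<eta> *\<^sub>R force N x w y) \<in> cball z (\<eta> * C) \<rightarrow> cball z (\<eta> * C)"
      using C assms(2) by (auto simp: dist_norm mult_left_mono)
  qed auto
  then obtain y where "z - \<eta> *\<^sub>R force N x w y = y" by blast
  then have "y + \<eta> *\<^sub>R force N x w y = z" by (metis diff_add_cancel)
  then show ?thesis by (rule that)
qed

lemma measure_wfr_step:
  assumes "\<rho> \<in> prob_measures" "0 \<le> \<eta>" "\<eta> \<le> 1" "N \<ge> 1" "A \<in> sets borel"
  shows "measure (wfr_step N x \<eta> \<rho>) A =
    (\<integral>y. growth N x \<eta> \<rho> y * indicator A (move N x \<eta> (fisher_rao_step N x \<eta> \<rho>) y) \<partial>\<rho>)"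
proof -
  have w: "wfr_step N x \<eta> \<rho> \<in> prob_measures"
    using assms by (intro wasserstein_step_prob fisher_rao_step_prob)
  have "measure (wfr_step N x \<eta> \<rho>) A = (\<integral>y. indicator A y \<partial>wfr_step N x \<eta> \<rho>)"
    unfolding Bochner_Integration.integral_indicator prob_measuresD(3)[OF w] Int_UNIV_right ..
  also have "\<dots> = (\<integral>y. growth N x \<eta> \<rho> y * indicator A (move N x \<eta> (fisher_rao_step N x \<eta> \<rho>) y) \<partial>\<rho>)"
    using assms(5) by (intro integral_wfr_step[OF assms(1-4)]) simp
  finally show ?thesis .
qed

text \<open>Serves twice: with \<open>A'\<close> a preimage and \<open>t = 1 - \<eta>\<close> for
  the persistence of full support, and with \<open>A' = A\<close> and \<open>t > 1\<close> for
  growth inside a trap.\<close>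

lemma measure_wfr_step_ge:
  assumes \<rho>: "\<rho> \<in> prob_measures" and \<eta>: "0 \<le> \<eta>" "\<eta> \<le> 1" and N: "N \<ge> 1" and A: "A \<in> sets borel" "A' \<in> sets borel"
    and into: "\<And>y. y \<in> A' \<Longrightarrow> growth N x \<eta> \<rho> y \<ge> t \<and> move N x \<eta> (fisher_rao_step N x \<eta> \<rho>) y \<in> A"
  shows "measure (wfr_step N x \<eta> \<rho>) A \<ge> t * measure \<rho> A'"
proof -
  let ?T = "move N x \<eta> (fisher_rao_step N x \<eta> \<rho>)"
  obtain B where B: "\<And>y. \<bar>growth N x \<eta> \<rho> y\<bar> \<le> B" using growth_bounded[OF \<rho> \<eta>] by blast
  have [measurable]: "A \<in> sets borel" "A' \<in> sets borel" by fact+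
  have g0: "growth N x \<eta> \<rho> y \<ge> 0" for y using growth_ge[OF \<rho> \<eta>(1), of N x y] \<eta> by linarith
  have "(\<integral>y. t * indicator A' y \<partial>\<rho>) \<le> (\<integral>y. growth N x \<eta> \<rho> y * indicator A (?T y) \<partial>\<rho>)"
  proof (rule integral_mono)
    show "integrable \<rho> (\<lambda>y. t * indicator A' y)"
      by (rule integrable_bounded_prob[OF \<rho>, where B="\<bar>t\<bar>"]) (auto simp: indicator_def)
    show "integrable \<rho> (\<lambda>y. growth N x \<eta> \<rho> y * indicator A (?T y))"
      by (rule integrable_bounded_prob[OF \<rho>, where B=B])
         (use B order_trans[OF abs_ge_zero B] in \<open>auto simp: indicator_def\<close>)
    show "t * indicator A' y \<le> growth N x \<eta> \<rho> y * indicator A (?T y)" for y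
      using into[of y] g0[of y] by (auto simp: indicator_def)
  qed
  also have "(\<integral>y. t * indicator A' y \<partial>\<rho>) = t * measure \<rho> A'"
    unfolding integral_mult_right_zero Bochner_Integration.integral_indicator prob_measuresD(3)[OF \<rho>] Int_UNIV_right ..
  finally show ?thesis by (simp add: measure_wfr_step[OF \<rho> \<eta> N A(1)])
qed

lemma charges_open_wfr_step:
  assumes \<rho>: "\<rho> \<in> prob_measures" and "charges_open \<rho>" and \<eta>: "0 \<le> \<eta>" "\<eta> < 1" and N: "N \<ge> 1"
  shows "charges_open (wfr_step N x \<eta> \<rho>)"
  unfolding charges_open_def
proof (intro allI impI)
  fix U :: "(real ^ 'a) set" assume U: "open U" "U \<noteq> {}"
  let ?T = "move N x \<eta> (fisher_rao_step N x \<eta> \<rho>)"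
  have fr: "fisher_rao_step N x \<eta> \<rho> \<in> prob_measures" using \<rho> \<eta> N by (intro fisher_rao_step_prob) auto
  have oV: "open (?T -` U)"
    using U(1) by (intro open_vimage continuous_move continuous_intros)
  obtain z where "z \<in> U" using U(2) by blast
  moreover obtain y where "y + \<eta> *\<^sub>R force N x (lik x (fisher_rao_step N x \<eta> \<rho>)) y = z"
    using add_force_surj[of N "lik x (fisher_rao_step N x \<eta> \<rho>)" \<eta>] lik_pos[OF fr] \<eta> by metis
  ultimately have "?T -` U \<noteq> {}" by (auto simp: move_def)
  then have "measure \<rho> (?T -` U) > 0" using assms(2) oV unfolding charges_open_def by blast
  then have "0 < (1 - \<eta>) * measure \<rho> (?T -` U)" using \<eta> by simp
  also have "\<dots> \<le> measure (wfr_step N x \<eta> \<rho>) U"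
    using U(1) oV \<eta> growth_ge[OF \<rho> \<eta>(1)] by (intro measure_wfr_step_ge[OF \<rho> _ _ N]) auto
  finally show "measure (wfr_step N x \<eta> \<rho>) U > 0" .
qed

lemma charges_open_wfr_gd:
  assumes "\<rho>0 \<in> prob_measures" "charges_open \<rho>0" "0 \<le> \<eta>" "\<eta> < 1" "N \<ge> 1"
  shows "charges_open (wfr_gd N x \<eta> \<rho>0 n)"
proof (induction n)
  case (Suc n)
  then show ?case
    using assms by (auto intro!: charges_open_wfr_step wfr_gd_prob)
qed (simp add: assms)

section \<open>Optimality of the limit\<close>

text \<open>By \<open>ln u \<le> u - 1\<close> with \<open>u\<close> a ratio of likelihoods, the
  log-likelihood gain of any \<mu> over \<rho> is at most the \<mu>-mean of the potential of \<rho>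
  minus 1.\<close>

lemma npmle_if_potential_le_1:
  assumes \<rho>: "\<rho> \<in> prob_measures" and N: "N \<ge> 1" and le: "\<And>y. potential N x (lik x \<rho>) y \<le> 1"
  shows "is_npmle N x \<rho>"
  unfolding is_npmle_def is_arg_min_def
proof (intro conjI notI \<rho>, elim exE conjE)
  fix \<mu> assume \<mu>: "\<mu> \<in> prob_measures" and less: "nll N x \<mu> < nll N x \<rho>"
  interpret prob_space \<mu> using \<mu> prob_measuresD by blast
  have "ln (lik x \<mu> i) - ln (lik x \<rho> i) \<le> lik x \<mu> i / lik x \<rho> i - 1" for i
    using lik_pos[OF \<mu>, of x i] lik_pos[OF \<rho>, of x i] ln_le_minus_one[of "lik x \<mu> i / lik x \<rho> i"]
    by (simp add: ln_div)
  then have "(1 / real N) * (\<Sum>i=1..N. ln (lik x \<mu> i) - ln (lik x \<rho> i))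
      \<le> (1 / real N) * (\<Sum>i=1..N. lik x \<mu> i / lik x \<rho> i - 1)"
    by (intro mult_left_mono sum_mono) auto
  also have "\<dots> = (\<integral>y. potential N x (lik x \<rho>) y \<partial>\<mu>) - 1"
    unfolding integral_potential[OF \<mu>] using N by (simp add: sum_subtractf right_diff_distrib)
  also have "\<dots> \<le> 0"
    using integral_mono[OF integrable_potential[OF \<mu>] integrable_const[of "1::real"] le]
    by (simp add: prob_space)
  finally show False
    using less unfolding nll_def lik_def by (simp add: sum_subtractf right_diff_distrib)
qed

lemma bounded_potential_ge:
  assumes a: "\<And>i. i \<in> {1..N} \<Longrightarrow> a i > 0" and M: "\<And>i. i \<in> {1..N} \<Longrightarrow> norm (x i) \<le> M" and "c > 0"
  shows "bounded {y. potential N x a y \<ge> c}"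
proof -
  define C where "C = (1 / real N) * (\<Sum>i=1..N. 1 / a i)"
  have "norm y \<le> M + (C / c + 1)" if y: "potential N x a y \<ge> c" for y
  proof (rule ccontr)
    assume "\<not> norm y \<le> M + (C / c + 1)"
    then have far: "norm y > M + (C / c + 1)" by simp
    have C0: "C \<ge> 0" unfolding C_def using a by (intro mult_nonneg_nonneg sum_nonneg) (auto simp: less_imp_le)
    define r where "r = C / c + 1"
    have r: "r > 0" "C < r * c" using C0 \<open>c > 0\<close> by (auto simp: r_def field_simps)
    have "gauss (y - x i) / a i \<le> (1 / r) * (1 / a i)" if i: "i \<in> {1..N}" for i
    proof -
      have "r \<le> norm (y - x i)" using far M[OF i] norm_triangle_ineq2[of y "x i"] unfolding r_def by linarith
      then have "gauss (y - x i) * r \<le> gauss (y - x i) * norm (y - x i)" by (intro mult_left_mono) auto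
      also have "\<dots> \<le> 1" by (rule gauss_norm_le)
      finally have "gauss (y - x i) \<le> 1 / r" using r by (simp add: field_simps)
      then have "gauss (y - x i) * (1 / a i) \<le> 1 / r * (1 / a i)" using a[OF i] by (intro mult_right_mono) auto
      then show ?thesis by simp
    qed
    then have "potential N x a y \<le> (1 / real N) * (\<Sum>i=1..N. (1 / r) * (1 / a i))"
      unfolding potential_def by (intro mult_left_mono sum_mono) auto
    also have "\<dots> = C / r" unfolding C_def sum_distrib_left[symmetric] by simp
    also have "\<dots> < c" using r by (simp add: field_simps)
    finally show False using y by simp
  qed
  then show ?thesis by (auto simp: bounded_iff)
qed

text \<open>Hypothesis \<open>eq\<close> makes growth and motion of late iterates follow one and the
  same potential; \<open>step\<close> lets its superlevel set survive a full discrete step.\<close>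

lemma limit_potential_le_1:
  fixes x :: "nat \<Rightarrow> real ^ 'd"
  assumes conv: "weakly_converges (wfr_gd N x \<eta> \<rho>0) \<rho>" and \<rho>0: "\<rho>0 \<in> prob_measures" "charges_open \<rho>0"
    and \<rho>: "\<rho> \<in> prob_measures" and \<eta>: "0 < \<eta>" "\<eta> \<le> 1/2" and N: "N \<ge> 1"
    and M: "\<And>i. i \<in> {1..N} \<Longrightarrow> norm (x i) \<le> M"
    and eq: "lik x (fisher_rao_step N x \<eta> \<rho>) = lik x \<rho>"
    and step: "\<And>y. \<eta> * potential N x (lik x \<rho>) y \<le> 1"
  shows "potential N x (lik x \<rho>) y0 \<le> 1"
proof (rule ccontr)
  assume "\<not> potential N x (lik x \<rho>) y0 \<le> 1"
  then have "1 < potential N x (lik x \<rho>) y0" by simp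
  let ?r = "wfr_gd N x \<eta> \<rho>0"
  define a where "a = lik x \<rho>"
  let ?P = "potential N x a" and ?F = "force N x a"
  have a: "a i > 0" for i unfolding a_def by (rule lik_pos[OF \<rho>])
  obtain c where c: "1 < c" "c < ?P y0" and reg: "\<And>y. ?P y = c \<Longrightarrow> ?F y \<noteq> 0"
    using potential_regular_value[OF \<open>1 < potential N x (lik x \<rho>) y0\<close>] unfolding a_def by metis
  define A where "A = {y. ?P y \<ge> c}"
  have y0: "y0 \<in> A" using c by (simp add: A_def)
  have closedA: "closed A"
    unfolding A_def by (intro closed_Collect_le continuous_on_const continuous_potential continuous_on_id)
  have "compact A"
    using bounded_potential_ge[of N a x M c] a M c closedA by (simp add: compact_eq_bounded_closed A_def)
  \<comment> \<open>On \<open>A\<close> either the level \<open>c\<close> is exceeded or, at a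
    regular level, the force is nonzero; by compactness the larger of margin and force has a
    positive minimum \<open>m\<close>.\<close>
  moreover have "continuous_on A (\<lambda>y. max (?P y - c) (norm (?F y)))"
    by (intro continuous_intros continuous_potential continuous_force)
  ultimately obtain y1 where y1: "y1 \<in> A" "\<And>y. y \<in> A \<Longrightarrow> max (?P y1 - c) (norm (?F y1)) \<le> max (?P y - c) (norm (?F y))"
    using continuous_attains_inf[of A "\<lambda>y. max (?P y - c) (norm (?F y))"] y0 by blast
  define m where "m = max (?P y1 - c) (norm (?F y1))"
  have m: "m > 0"
  proof (cases "?P y1 = c")
    case True
    then show ?thesis using reg by (simp add: m_def)
  next
    case False
    then show ?thesis using y1(1) by (simp add: m_def A_def)
  qed
  have r: "?r n \<in> prob_measures" for n using \<rho>0 \<eta> N by (intro wfr_gd_prob) auto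
  define u where "u n = wdist N (lik x (?r n)) a" for n
  define w where "w n = wdist N (lik x (fisher_rao_step N x \<eta> (?r n))) a" for n
  have "u \<longlonglongrightarrow> 0"
    unfolding u_def a_def using lik_pos[OF \<rho>] by (intro wdist_tendsto weakly_converges_gauss(1)[OF conv])
  moreover have "w \<longlonglongrightarrow> 0"
    unfolding w_def a_def eq[symmetric] 
    using lik_pos[OF fisher_rao_step_prob[OF \<rho>, of \<eta> N x], of x] \<eta> N
    by (intro wdist_tendsto lik_fisher_rao_step_tendsto[OF conv r \<rho>]) auto
  ultimately have "eventually (\<lambda>n. u n < (c - 1) / 2 \<and> w n < min m 1) sequentially"
    using c m by (intro eventually_conj order_tendstoD(2)) auto
  then obtain n0 where n0: "\<And>n. n \<ge> n0 \<Longrightarrow> u n < (c - 1) / 2 \<and> w n < min m 1"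
    by (auto simp: eventually_sequentially)
  define t where "t = 1 + \<eta> * (c - 1) / 2"
  have t: "t > 1" using \<eta> c by (simp add: t_def)
  have into: "growth N x \<eta> (?r n) y \<ge> t \<and> move N x \<eta> (fisher_rao_step N x \<eta> (?r n)) y \<in> A"
    if n: "n \<ge> n0" and y: "y \<in> A" for n y
  proof
    have "potential N x (lik x (?r n)) y \<ge> ?P y - u n"
      using potential_wdist[of N x "lik x (?r n)" y a] unfolding u_def by linarith
    then have "potential N x (lik x (?r n)) y \<ge> 1 + (c - 1) / 2"
      using conjunct1[OF n0[OF n]] y unfolding A_def mem_Collect_eq
      by (simp add: field_simps)
    then have "\<eta> * potential N x (lik x (?r n)) y \<ge> \<eta> * (1 + (c - 1) / 2)" using \<eta> by (intro mult_left_mono) auto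
    then show "growth N x \<eta> (?r n) y \<ge> t" by (simp add: growth_def t_def distrib_left)
    define v where "v = force N x (lik x (fisher_rao_step N x \<eta> (?r n))) y"
    define e where "e = v - ?F y"
    have e: "norm e \<le> w n"
      unfolding e_def v_def w_def by (rule force_wdist)
    have "?P (y + \<eta> *\<^sub>R v) \<ge> ?P y + ?F y \<bullet> (\<eta> *\<^sub>R v) - ?P y * (norm (\<eta> *\<^sub>R v))\<^sup>2 / 2"
      using a by (intro potential_add_ge) auto
    moreover have "?P y * (norm (\<eta> *\<^sub>R v))\<^sup>2 \<le> \<eta> * (norm v)\<^sup>2"
    proof -
      have "(\<eta> * ?P y) * (\<eta> * (norm v)\<^sup>2) \<le> 1 * (\<eta> * (norm v)\<^sup>2)"
        using step[of y] \<eta> unfolding a_def by (intro mult_right_mono) auto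
      then show ?thesis using \<eta> by (simp add: power_mult_distrib power2_eq_square[of \<eta>] mult_ac)
    qed
    \<comment> \<open>Completing the square: moving along the perturbed force \<open>v\<close> costs
      only the square of the error \<open>e\<close>, with no cross term left.\<close>
    moreover have "?F y \<bullet> (\<eta> *\<^sub>R v) - \<eta> * (norm v)\<^sup>2 / 2 = \<eta> / 2 * ((norm (?F y))\<^sup>2 - (norm e)\<^sup>2)"
      unfolding e_def power2_norm_eq_inner
      by (simp add: inner_diff_left inner_diff_right inner_commute algebra_simps)
    ultimately have gain: "?P (y + \<eta> *\<^sub>R v) \<ge> ?P y + \<eta> / 2 * ((norm (?F y))\<^sup>2 - (norm e)\<^sup>2)" by linarith
    have em: "norm e \<le> m" "norm e \<le> 1" using e n0[OF n] by auto
    have "m \<le> max (?P y - c) (norm (?F y))" unfolding m_def by (rule y1(2)[OF y])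
    then have "?P (y + \<eta> *\<^sub>R v) \<ge> c"
    \<comment> \<open>Where the force is at least \<open>m\<close> it beats the error; elsewhere the
      margin above \<open>c\<close> does, as \<open>norm e \<le> 1\<close> gives
      \<open>(norm e)\<^sup>2 \<le> norm e\<close>.\<close>
    proof (cases "m \<le> norm (?F y)")
      case True
      then have "(norm e)\<^sup>2 \<le> (norm (?F y))\<^sup>2" using em by (intro power_mono) auto
      then have "0 \<le> \<eta> / 2 * ((norm (?F y))\<^sup>2 - (norm e)\<^sup>2)" using \<eta> by (intro mult_nonneg_nonneg) auto
      then show ?thesis using gain y unfolding A_def by simp
    next
      case False
      then have Pm: "?P y \<ge> c + m" using \<open>m \<le> max (?P y - c) (norm (?F y))\<close> by auto
      have "(norm e)\<^sup>2 \<le> norm e" using em unfolding power2_eq_square by (intro mult_left_le) auto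
      then have "(norm e)\<^sup>2 \<le> m" using em by linarith
      then have "\<eta> / 2 * (- m) \<le> \<eta> / 2 * ((norm (?F y))\<^sup>2 - (norm e)\<^sup>2)"
        using \<eta> zero_le_power2[of "norm (?F y)"] by (intro mult_left_mono) linarith+
      moreover have "\<eta> / 2 * m \<le> 1 * m" using \<eta> m by (intro mult_right_mono) auto
      ultimately show ?thesis using gain Pm by simp
    qed
    then show "move N x \<eta> (fisher_rao_step N x \<eta> (?r n)) y \<in> A" by (simp add: move_def v_def A_def)
  qed
  have borelA: "A \<in> sets borel" using closedA by simp
  have grow: "measure (?r (n0 + k)) A \<ge> t ^ k * measure (?r n0) A" for k
  proof (induction k)
    case (Suc k)
    have "t * (t ^ k * measure (?r n0) A) \<le> t * measure (?r (n0 + k)) A"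
      using Suc t by (intro mult_left_mono) auto
    also have "\<dots> \<le> measure (wfr_step N x \<eta> (?r (n0 + k))) A"
      using \<eta> into by (intro measure_wfr_step_ge[OF r _ _ N borelA borelA]) auto
    finally show ?case by (simp add: mult.assoc)
  qed simp
  have pos: "measure (?r n0) A > 0"
  proof -
    interpret prob_space "?r n0" using r prob_measuresD by blast
    have "open {y. ?P y > c}"
      by (intro open_Collect_less continuous_on_const continuous_potential continuous_on_id)
    moreover have "{y. ?P y > c} \<noteq> {}" using c by blast
    moreover have "charges_open (?r n0)" using \<rho>0 \<eta> N by (intro charges_open_wfr_gd) auto
    ultimately have "0 < measure (?r n0) {y. ?P y > c}" unfolding charges_open_def by blast
    also have "\<dots> \<le> measure (?r n0) A"
      using borelA prob_measuresD(2)[OF r[of n0]] by (intro finite_measure_mono) (auto simp: A_def)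
    finally show ?thesis .
  qed
  obtain k where "1 / measure (?r n0) A < t ^ k" using real_arch_pow[OF t] by blast
  then have "1 < t ^ k * measure (?r n0) A" using pos by (simp add: field_simps)
  also have "\<dots> \<le> measure (?r (n0 + k)) A" by (rule grow)
  also have "\<dots> \<le> 1"
    using prob_space.prob_le_1[OF prob_measuresD(1)[OF r]] .
  finally show False by simp
qed

section \<open>The bound on the step size\<close>

definition sample_bound :: "nat \<Rightarrow> (nat \<Rightarrow> real ^ 'd) \<Rightarrow> real" where
  "sample_bound N x = 1 + (\<Sum>i=1..N. norm (x i))"

text \<open>In order: a mass factor of at least 1/2; \<eta> times the limit potential at most 1, as
  that potential is at most \<open>exp (2 * (sample_bound N x)\<^sup>2)\<close>; the exclusion of
  mass far away.\<close>

definition max_step :: "nat \<Rightarrow> (nat \<Rightarrow> real ^ 'd) \<Rightarrow> real" where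
  "max_step N x = Min {1/2, exp (- 2 * (sample_bound N x)\<^sup>2), far_bound N (sample_bound N x)}"

lemma wfr_limit_npmle:
  fixes x :: "nat \<Rightarrow> real ^ 'd"
  assumes N: "N \<ge> 1" and \<rho>0: "\<rho>0 \<in> prob_measures" "supp \<rho>0 = UNIV" and \<eta>: "0 < \<eta>" "\<eta> \<le> max_step N x"
    and \<rho>: "\<rho> \<in> prob_measures" and conv: "weakly_converges (wfr_gd N x \<eta> \<rho>0) \<rho>"
  shows "is_npmle N x \<rho>"
proof -
  define M where "M = sample_bound N x"
  have \<eta>': "\<eta> \<le> 1/2" "\<eta> \<le> exp (- 2 * M\<^sup>2)" "\<eta> \<le> far_bound N M"
    using \<eta>(2) by (simp_all add: max_step_def M_def)
  have M: "norm (x i) \<le> M" if "i \<in> {1..N}" for i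
    using member_le_sum[OF that, of "\<lambda>i. norm (x i)"] unfolding M_def sample_bound_def by simp
  interpret wfr_fixpoint N x \<eta> \<rho> M
  proof
    show "M \<ge> 1" unfolding M_def sample_bound_def by (simp add: sum_nonneg)
    show "wfr_step N x \<eta> \<rho> = \<rho>" using \<eta> \<eta>' by (intro weak_limit_stationary[OF conv \<rho>0(1) \<rho> _ _ N]) auto
  qed (use N \<rho> \<eta> \<eta>' M in auto)
  note lik = fixpoint_lik[OF \<eta>'(3)]
  have "potential N x a y \<le> gauss (0 :: real ^ 'd) / (gauss (0 :: real ^ 'd) * exp (- 2 * M\<^sup>2))" for y
    using lik(2) by (intro potential_le[OF N]) auto
  then have P: "potential N x a y \<le> 1 / exp (- 2 * M\<^sup>2)" for y by simp
  have "\<eta> * potential N x a y \<le> exp (- 2 * M\<^sup>2) * (1 / exp (- 2 * M\<^sup>2))" for y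
    using \<eta>(1) \<eta>'(2) P[of y] g_pos[of y] by (intro mult_mono) (auto simp: zero_less_mult_iff)
  then have step: "\<eta> * potential N x (lik x \<rho>) y \<le> 1" for y by (simp add: a_def)
  have "potential N x (lik x \<rho>) y \<le> 1" for y
    using lik(1) unfolding a_def b_def
    by (intro limit_potential_le_1[OF conv \<rho>0(1) supp_UNIV_charges_open[OF \<rho>0] \<rho> \<eta>(1) \<eta>'(1) N M(2) _ step])
  then show ?thesis by (rule npmle_if_potential_le_1[OF \<rho> N])
qed

theorem theorem2:
  fixes N :: nat
  assumes "N \<ge> 1"
  shows "\<exists>\<eta>0 :: (nat \<Rightarrow> real ^ 'd) \<Rightarrow> real.
    \<forall>(\<rho>s :: (real ^ 'd) measure) (\<Omega> :: 'w measure) X.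
      gaussian_mixture_samples \<rho>s \<Omega> N X \<longrightarrow>
      (\<forall>\<omega>\<in>space \<Omega>.
        let x = (\<lambda>i\<in>{1..N}. X i \<omega>) in
          \<eta>0 x > 0 \<and>
          (\<forall>\<rho>0 \<eta> \<rho>hat.
             \<rho>0 \<in> prob_measures \<longrightarrow> supp \<rho>0 = UNIV \<longrightarrow>
             0 < \<eta> \<longrightarrow> \<eta> \<le> \<eta>0 x \<longrightarrow>
             \<rho>hat \<in> prob_measures \<longrightarrow>
             weakly_converges (wfr_gd N x \<eta> \<rho>0) \<rho>hat \<longrightarrow>
             is_npmle N x \<rho>hat))"
proof -
  have "max_step N x > 0" for x :: "nat \<Rightarrow> real ^ 'd"
    unfolding max_step_def using far_bound_pos[OF assms] by (subst Min_gr_iff) auto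
  \<comment> \<open>\<open>max_step N\<close> is a single function of the sample values, fixed
    before the mixture, the initialization and the limit.\<close>
  then show ?thesis
    by (intro exI[of _ "max_step N"] allI impI ballI)
       (unfold Let_def, intro conjI allI impI wfr_limit_npmle[OF assms])
qed

end
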